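(* In the setting described in the context, for every $y\in E$ the sequence $\{\underline{b}_{V^{1/2^n}}(y):n\in\mathbb{N}\}$ is non-decreasing.
   Context: Let $(E,\mathcal{B}(E))$ be a Radon space and $(X,Y)=(\Omega,\mathcal{F},\mathcal{F}_t,(X_t,Y_t),\theta_t,\mathbf{P}_{(x,y)})$ an $\mathbb{R}\times E$-valued right process without killing, $X$ càdlàg, with $\mathbf{E}_{(x,y)}[f(X_t,Y_t)]=\mathbf{E}_{(0,y)}[f(X_t+x,Y_t)]$ for all non-negative measurable $f$, $t\ge0$, $(x,y)$. Assume $\sup_y\mathbf{E}_{(0,y)}[\sup_{s\in[0,1]}|X_s|]<\infty$. Fix $q>0$, measurable $\mathbf{q}:E\to(q,\infty)$, $\beta>1$, $\mathfrak{q}(t)=\int_0^t\mathbf{q}(Y_s)ds$. For $n\in\mathbb{N}$, $\Pi^{1/2^n}$ is the set of pairs $\pi=(L^\pi,R^\pi)$ of non-negative, non-decreasing, càdlàg, $(\mathcal{F}_t)$-adapted processes with $L^\pi_{0-}=R^\pi_{0-}=0$, $U^\pi_t=X_t-L^\pi_t+R^\pi_t\ge0$ for all $t$ a.s., $L^\pi_t=\sum_{k\ge1:\,k/2^n\le t}\ell^\pi_{k/2^n}$ for a non-negative adapted $\ell^\pi$ (dividends only at times $k/2^n$), and $\mathbf{E}_{(x,y)}[\int_{[0,\infty)}e^{-\mathfrak{q}(t)}dR^\pi_t]<\infty$ for all $(x,y)$. $v_\pi(x,y)=\mathbf{E}_{(x,y)}[\int_{[0,\infty)}e^{-\mathfrak{q}}dL^\pi]-\beta\mathbf{E}_{(x,y)}[\int_{[0,\infty)}e^{-\mathfrak{q}}dR^\pi]$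 and $V^{1/2^n}=\sup_{\pi\in\Pi^{1/2^n}}v_\pi$; $x\mapsto V^{1/2^n}(x,y)$ is concave, with right derivative $V^{1/2^n\prime}_+(x,y)$. Define $\underline{b}_{V^{1/2^n}}(y)=\sup\{x\ge0:V^{1/2^n\prime}_+(x,y)>1\}$ with $\sup\emptyset=0$. *)

theory Defs
  imports "HOL-Analysis.Analysis" "HOL-Probability.Probability"
begin

definition univ_measurable_set :: "'a::topological_space set \<Rightarrow> bool" where
  "univ_measurable_set S \<longleftrightarrow>
     (\<forall>\<mu>. sets \<mu> = sets borel \<and> finite_measure \<mu> \<longrightarrow> S \<in> sets (completion \<mu>))"

definition univ_measurable_fun :: "('a::topological_space \<Rightarrow> ennreal) \<Rightarrow> bool" where
  "univ_measurable_fun f \<longleftrightarrow>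
     (\<forall>\<mu>. sets \<mu> = sets borel \<and> finite_measure \<mu> \<longrightarrow> f \<in> borel_measurable (completion \<mu>))"

text \<open>A Radon space: homeomorphic to a universally measurable subset of a compact
  metric space.  Every compact metric space embeds (as a closed subset) into the
  Hilbert cube, so we use the Hilbert cube as the ambient compact metric space.\<close>
definition radon_space :: "'e::topological_space itself \<Rightarrow> bool" where
  "radon_space _ \<longleftrightarrow>
     (\<exists>h :: 'e \<Rightarrow> (nat \<Rightarrow> real).
        inj h \<and> continuous_on UNIV h \<and> continuous_on (range h) (inv h) \<and>
        range h \<subseteq> {f. \<forall>n. f n \<in> {0..1}} \<and> univ_measurable_set (range h))"

section \<open>Right processes (Sharpe's definition)\<close>

definition alpha_excessive ::
  "('z \<Rightarrow> 'w measure) \<Rightarrow> (real \<Rightarrow> 'w \<Rightarrow> 'z::topological_space) \<Rightarrow> real \<Rightarrow> ('z \<Rightarrow> ennreal) \<Rightarrow> bool" where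
  "alpha_excessive P Z \<alpha> f \<longleftrightarrow>
     univ_measurable_fun f \<and>
     (\<forall>t\<ge>0. \<forall>z. ennreal (exp (-\<alpha>*t)) * (\<integral>\<^sup>+\<omega>. f (Z t \<omega>) \<partial>P z) \<le> f z) \<and>
     (\<forall>z. ((\<lambda>t. ennreal (exp (-\<alpha>*t)) * (\<integral>\<^sup>+\<omega>. f (Z t \<omega>) \<partial>P z)) \<longlongrightarrow> f z) (at_right 0))"

text \<open>\<open>M\<close>: the measurable space \<open>(\<Omega>,\<F>)\<close>; \<open>F\<close>: the filtration; \<open>P z\<close>: the law started at \<open>z\<close>;
  \<open>Z\<close>: the process; \<open>\<theta>\<close>: shift operators.  No cemetery state (no killing).\<close>
definition right_process ::
  "'w measure \<Rightarrow> (real \<Rightarrow> 'w measure) \<Rightarrow> ('z \<Rightarrow> 'w measure) \<Rightarrow> (real \<Rightarrow> 'w \<Rightarrow> 'z::topological_space)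
   \<Rightarrow> (real \<Rightarrow> 'w \<Rightarrow> 'w) \<Rightarrow> bool" where
  "right_process M F P Z \<theta> \<longleftrightarrow>
     (\<forall>z. prob_space (P z) \<and> sets (P z) = sets M) \<and>
     (\<forall>t\<ge>0. subalgebra M (F t)) \<and>
     (\<forall>s t. 0 \<le> s \<longrightarrow> s \<le> t \<longrightarrow> sets (F s) \<subseteq> sets (F t)) \<and>
     (\<forall>t\<ge>0. Z t \<in> measurable (F t) borel) \<and>
     (\<forall>A\<in>sets M. univ_measurable_fun (\<lambda>z. emeasure (P z) A)) \<and>
     (\<forall>z. AE \<omega> in P z. Z 0 \<omega> = z) \<and>
     (\<forall>t\<ge>0. \<forall>s\<ge>0. \<forall>\<omega>\<in>space M. \<theta> t \<omega> \<in> space M \<and> Z s (\<theta> t \<omega>) = Z (s + t) \<omega>) \<and>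
     (\<forall>\<omega>\<in>space M. \<forall>t\<ge>0. continuous (at_right t) (\<lambda>s. Z s \<omega>)) \<and>
     (\<forall>z s t (f::'z \<Rightarrow> ennreal) A. 0 \<le> s \<longrightarrow> 0 \<le> t \<longrightarrow> f \<in> borel_measurable borel \<longrightarrow>
        A \<in> sets (F t) \<longrightarrow>
        (\<integral>\<^sup>+\<omega>. f (Z (t + s) \<omega>) * indicator A \<omega> \<partial>P z) =
        (\<integral>\<^sup>+\<omega>. (\<integral>\<^sup>+\<omega>'. f (Z s \<omega>') \<partial>P (Z t \<omega>)) * indicator A \<omega> \<partial>P z)) \<and>
     (\<forall>\<alpha>>0. \<forall>f. alpha_excessive P Z \<alpha> f \<longrightarrow>
        (\<forall>z. AE \<omega> in P z. \<forall>t\<ge>0. continuous (at_right t) (\<lambda>s. f (Z s \<omega>))))"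

definition frakq :: "('e \<Rightarrow> real) \<Rightarrow> (real \<Rightarrow> 'w \<Rightarrow> 'e) \<Rightarrow> real \<Rightarrow> 'w \<Rightarrow> ennreal" where
  "frakq qf Y t \<omega> = (\<integral>\<^sup>+s\<in>{0..t}. ennreal (qf (Y s \<omega>)) \<partial>lborel)"

definition disc :: "('e \<Rightarrow> real) \<Rightarrow> (real \<Rightarrow> 'w \<Rightarrow> 'e) \<Rightarrow> real \<Rightarrow> 'w \<Rightarrow> ennreal" where
  "disc qf Y t \<omega> = (if frakq qf Y t \<omega> = \<top> then 0 else ennreal (exp (- enn2real (frakq qf Y t \<omega>))))"

text \<open>\<open>E_z[\<integral>_{[0,\<infinity>)} e^{-\<frak>q(t)} dA_t]\<close>, where \<open>A\<close> is a path with \<open>A_t = 0\<close> for \<open>t < 0\<close>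
  (encoding \<open>A_{0-} = 0\<close>), so that the jump at 0 is included.\<close>
definition disc_exp :: "('z \<Rightarrow> 'w measure) \<Rightarrow> ('e \<Rightarrow> real) \<Rightarrow> (real \<Rightarrow> 'w \<Rightarrow> 'e)
   \<Rightarrow> (real \<Rightarrow> 'w \<Rightarrow> real) \<Rightarrow> 'z \<Rightarrow> ennreal" where
  "disc_exp P qf Y A z =
     (\<integral>\<^sup>+\<omega>. (\<integral>\<^sup>+t\<in>{0..}. disc qf Y t \<omega> \<partial>interval_measure (\<lambda>s. A s \<omega>)) \<partial>P z)"

definition cadlag_path :: "(real \<Rightarrow> real) \<Rightarrow> bool" where
  "cadlag_path g \<longleftrightarrow>
     (\<forall>t. continuous (at_right t) g) \<and> (\<forall>t. \<exists>l. (g \<longlongrightarrow> l) (at_left t))"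

text \<open>Admissible strategies \<open>\<Pi>^{1/2^n}\<close>.  Processes are indexed by all real times, with
  value 0 at negative times (encoding \<open>L_{0-} = R_{0-} = 0\<close>).\<close>
definition admissible ::
  "nat \<Rightarrow> 'w measure \<Rightarrow> (real \<Rightarrow> 'w measure) \<Rightarrow> (real \<times> 'e \<Rightarrow> 'w measure)
   \<Rightarrow> (real \<Rightarrow> 'w \<Rightarrow> real) \<Rightarrow> (real \<Rightarrow> 'w \<Rightarrow> 'e) \<Rightarrow> ('e \<Rightarrow> real)
   \<Rightarrow> ((real \<Rightarrow> 'w \<Rightarrow> real) \<times> (real \<Rightarrow> 'w \<Rightarrow> real)) set" where
  "admissible n M F P X Y qf =
     {(L, R). (\<forall>\<omega>\<in>space M.
                 (\<forall>t<0. L t \<omega> = 0 \<and> R t \<omega> = 0) \<and>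
                 (\<forall>t. 0 \<le> L t \<omega> \<and> 0 \<le> R t \<omega>) \<and>
                 mono (\<lambda>t. L t \<omega>) \<and> mono (\<lambda>t. R t \<omega>) \<and>
                 cadlag_path (\<lambda>t. L t \<omega>) \<and> cadlag_path (\<lambda>t. R t \<omega>)) \<and>
              (\<forall>t\<ge>0. L t \<in> borel_measurable (F t) \<and> R t \<in> borel_measurable (F t)) \<and>
              (\<forall>z. AE \<omega> in P z. \<forall>t\<ge>0. X t \<omega> - L t \<omega> + R t \<omega> \<ge> 0) \<and>
              (\<exists>ell::nat \<Rightarrow> 'w \<Rightarrow> real.
                 (\<forall>k. ell k \<in> borel_measurable (F (real k / 2 ^ n))) \<and>
                 (\<forall>k. \<forall>\<omega>\<in>space M. 0 \<le> ell k \<omega>) \<and>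
                 (\<forall>t. \<forall>\<omega>\<in>space M. L t \<omega> = (\<Sum>k\<in>{k. 1 \<le> k \<and> real k / 2 ^ n \<le> t}. ell k \<omega>))) \<and>
              (\<forall>z. disc_exp P qf Y R z < \<top>)}"

definition vpi :: "(real \<times> 'e \<Rightarrow> 'w measure) \<Rightarrow> (real \<Rightarrow> 'w \<Rightarrow> 'e) \<Rightarrow> ('e \<Rightarrow> real) \<Rightarrow> real
   \<Rightarrow> (real \<Rightarrow> 'w \<Rightarrow> real) \<times> (real \<Rightarrow> 'w \<Rightarrow> real) \<Rightarrow> real \<times> 'e \<Rightarrow> ereal" where
  "vpi P Y qf \<beta> \<pi> z =
     enn2ereal (disc_exp P qf Y (fst \<pi>) z) - ereal \<beta> * enn2ereal (disc_exp P qf Y (snd \<pi>) z)"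

definition Vn :: "nat \<Rightarrow> 'w measure \<Rightarrow> (real \<Rightarrow> 'w measure) \<Rightarrow> (real \<times> 'e \<Rightarrow> 'w measure)
   \<Rightarrow> (real \<Rightarrow> 'w \<Rightarrow> real) \<Rightarrow> (real \<Rightarrow> 'w \<Rightarrow> 'e) \<Rightarrow> ('e \<Rightarrow> real) \<Rightarrow> real \<Rightarrow> real \<times> 'e \<Rightarrow> ereal" where
  "Vn n M F P X Y qf \<beta> z = (SUP \<pi>\<in>admissible n M F P X Y qf. vpi P Y qf \<beta> \<pi> z)"

text \<open>Right derivative of \<open>x \<mapsto> V^{1/2^n}(x,y)\<close> (a finite concave function by the paper).\<close>
definition Vn_rderiv :: "nat \<Rightarrow> 'w measure \<Rightarrow> (real \<Rightarrow> 'w measure) \<Rightarrow> (real \<times> 'e \<Rightarrow> 'w measure)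
   \<Rightarrow> (real \<Rightarrow> 'w \<Rightarrow> real) \<Rightarrow> (real \<Rightarrow> 'w \<Rightarrow> 'e) \<Rightarrow> ('e \<Rightarrow> real) \<Rightarrow> real \<Rightarrow> real \<Rightarrow> 'e \<Rightarrow> real" where
  "Vn_rderiv n M F P X Y qf \<beta> x y =
     Lim (at_right x) (\<lambda>x'. (real_of_ereal (Vn n M F P X Y qf \<beta> (x', y))
                             - real_of_ereal (Vn n M F P X Y qf \<beta> (x, y))) / (x' - x))"

definition lower_b :: "nat \<Rightarrow> 'w measure \<Rightarrow> (real \<Rightarrow> 'w measure) \<Rightarrow> (real \<times> 'e \<Rightarrow> 'w measure)
   \<Rightarrow> (real \<Rightarrow> 'w \<Rightarrow> real) \<Rightarrow> (real \<Rightarrow> 'w \<Rightarrow> 'e) \<Rightarrow> ('e \<Rightarrow> real) \<Rightarrow> real \<Rightarrow> 'e \<Rightarrow> ereal" where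
  "lower_b n M F P X Y qf \<beta> y =
     (let S = {x. 0 \<le> x \<and> Vn_rderiv n M F P X Y qf \<beta> x y > 1}
      in if S = {} then 0 else Sup (ereal ` S))"

end

theory Submission
  imports Defs
begin

text \<open>
  Write \<open>V\<^sub>n\<close> for the value function with dividends on the grid of mesh \<open>1/2^n\<close>. It suffices that
  the increments \<open>V\<^sub>n (x + h, y) - V\<^sub>n (x, y)\<close> are non-decreasing in \<open>n\<close>: since each
  \<open>V\<^sub>n\<close> is concave in \<open>x\<close> and Lipschitz from above, the right derivatives exist and inherit this
  order, so the sets \<open>{V\<^sub>n' > 1}\<close> increase with \<open>n\<close>.

  The increments are compared by a coupling. Let \<open>L'\<close> be a strategy on the coarse grid started at
  \<open>x + h\<close> and \<open>L\<close> one on the fine grid started at \<open>x\<close>, with injections \<open>R'\<close>, \<open>R\<close>. Until a total of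
  \<open>h\<close> has been spent, book the dividends \<open>L'\<close> to the other path and likewise the injections \<open>R\<close>.
  This yields a coarse strategy started at \<open>x\<close> and a fine one started at \<open>x + h\<close>, with the same total
  dividends and no more total injections.

  To run both strategies on one probability space, every strategy is first replaced by one adapted to
  the natural filtration of \<open>(X, Y)\<close>: by the Markov property, projecting the dividends on the path
  does not change their discounted value and, by Jensen's inequality, does not increase the minimal
  injections \<open>sup\<^bsub>s \<le> t\<^esub> (L\<^sub>s - X\<^sub>s)\<^sup>+\<close>. Such strategies are path functionals and are transferred from
  \<open>P (x, y)\<close> to \<open>P (0, y)\<close> by spatial homogeneity of the path law.
\<close>

text \<open>Refining the grid enlarges the set of strategies, but ordering the values says nothing
  about slopes. What is needed is the exchange inequality \<open>W n (h + x) y + W (Suc n) x y \<le>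
  W (Suc n) (h + x) y + W n x y\<close>. A coarse dividend is allowed on the fine grid but not
  conversely, so dividends can only move from the coarse strategy to the fine one; what the fine
  strategy can hand back is injections. This is why \<open>h\<close> is spent in two currencies. The
  laws for two starting points are linked only through the process, while a strategy adapted to
  \<open>F\<close> may use further information: it has a translate in space only when it is a
  function of the path. Hence the passage to the natural filtration. Homogeneity is given at single
  times and must be lifted to paths by the Markov property; there the obstacle is that expectations
  depend on the starting point only universally measurably, so that Borel versions and completions
  appear throughout. As \<beta> exceeds 1, gain minus cost is bounded over all strategies, and every
  supremum is a real number.\<close>

section \<open>Universal measurability, equality of densities, factorisation\<close>

text \<open>Completing the law of \<open>W\<close> yields a Borel function that agrees with
  \<open>f\<close> along \<open>W\<close> almost surely, which is all that integrals over
  \<open>N\<close> can see.\<close>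

lemma univ_fun_borel_version:
  assumes f: "univ_measurable_fun f" and N: "prob_space N" and W: "W \<in> measurable N borel"
  obtains f' where "f' \<in> borel_measurable borel" "AE \<omega> in N. f (W \<omega>) = f' (W \<omega>)"
proof -
  interpret prob_space N by fact
  interpret D: prob_space "distr N borel W" by (rule prob_space_distr[OF W])
  have "f \<in> borel_measurable (completion (distr N borel W))"
    using f unfolding univ_measurable_fun_def by (auto intro: D.finite_measure_axioms)
  from completion_ex_borel_measurable[OF this]
  obtain f' where f': "f' \<in> borel_measurable (distr N borel W)"
    and ae: "AE x in distr N borel W. f x = f' x"
    by blast
  have "f' \<in> borel_measurable borel" using f' by simp
  moreover have "AE \<omega> in N. f (W \<omega>) = f' (W \<omega>)"
    using AE_distrD[OF W ae] .
  ultimately show thesis by (rule that)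
qed

lemma univ_measurable_fun_mult:
  assumes "univ_measurable_fun f" "univ_measurable_fun g"
  shows "univ_measurable_fun (\<lambda>x. f x * g x)"
  using assms unfolding univ_measurable_fun_def by (auto intro: borel_measurable_times_ennreal)

lemma univ_measurable_fun_borel: "(f :: 'a::topological_space \<Rightarrow> ennreal) \<in> borel_measurable borel \<Longrightarrow> univ_measurable_fun f"
  unfolding univ_measurable_fun_def
proof safe
  fix \<mu> :: "'a measure"
  assume "f \<in> borel_measurable borel" "sets \<mu> = sets borel"
  then have "f \<in> borel_measurable \<mu>" by (simp cong: measurable_cong_sets)
  then show "f \<in> borel_measurable (completion \<mu>)" by (rule measurable_completion)
qed

text \<open>Subsets of null sets are measurable in a completion, so almost everywhere modifications
  stay measurable. This makes the path kernel in \<open>markov_path\<close> measurable.\<close>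

lemma measurable_completion_AE:
  assumes g: "g \<in> measurable (completion N) L" and ae: "AE x in completion N. g x = f x"
    and f: "f \<in> space N \<rightarrow> space L"
  shows "f \<in> measurable (completion N) L"
proof (rule measurableI)
  show "f x \<in> space L" if "x \<in> space (completion N)" for x using f that by auto
  fix A assume "A \<in> sets L"
  with g have "g -` A \<inter> space (completion N) \<in> sets (completion N)" by (rule measurable_sets)
  then show "f -` A \<inter> space (completion N) \<in> sets (completion N)"
  proof (rule completion.in_sets_AE[rotated])
    show "AE x in completion N. (x \<in> g -` A \<inter> space (completion N)) = (x \<in> f -` A \<inter> space (completion N))"
      using ae by eventually_elim simp
  qed simp
qed

text \<open>By hypothesis the densities \<open>u\<close> and \<open>v\<close> define the same
  measure on \<open>G\<close>, and a \<open>G\<close>-measurable integrand sees only that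
  restriction.\<close>

lemma nn_integral_mult_eq_subalgebra:
  fixes u v \<xi> :: "'a \<Rightarrow> ennreal"
  assumes sub: "subalgebra N G" and u: "u \<in> borel_measurable N" and v: "v \<in> borel_measurable N"
    and eq: "\<And>A. A \<in> sets G \<Longrightarrow> (\<integral>\<^sup>+\<omega>. u \<omega> * indicator A \<omega> \<partial>N) = (\<integral>\<^sup>+\<omega>. v \<omega> * indicator A \<omega> \<partial>N)"
    and \<xi>: "\<xi> \<in> borel_measurable G"
  shows "(\<integral>\<^sup>+\<omega>. \<xi> \<omega> * u \<omega> \<partial>N) = (\<integral>\<^sup>+\<omega>. \<xi> \<omega> * v \<omega> \<partial>N)"
proof -
  have subu: "subalgebra (density N u) G" and subv: "subalgebra (density N v) G"
    using sub by (auto simp: subalgebra_def)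
  have meq: "restr_to_subalg (density N u) G = restr_to_subalg (density N v) G"
  proof (rule measure_eqI)
    show "sets (restr_to_subalg (density N u) G) = sets (restr_to_subalg (density N v) G)"
      by (simp add: sets_restr_to_subalg[OF subu] sets_restr_to_subalg[OF subv])
    fix A assume "A \<in> sets (restr_to_subalg (density N u) G)"
    then have A: "A \<in> sets G" by (simp add: sets_restr_to_subalg[OF subu])
    then have AN: "A \<in> sets N" using sub by (auto simp: subalgebra_def)
    show "emeasure (restr_to_subalg (density N u) G) A = emeasure (restr_to_subalg (density N v) G) A"
      using eq[OF A] AN A u v
      by (simp add: emeasure_restr_to_subalg[OF subu] emeasure_restr_to_subalg[OF subv]
          emeasure_density)
  qed
  have \<xi>N: "\<xi> \<in> borel_measurable N" by (rule measurable_from_subalg[OF sub \<xi>])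
  have "(\<integral>\<^sup>+\<omega>. \<xi> \<omega> * u \<omega> \<partial>N) = (\<integral>\<^sup>+\<omega>. \<xi> \<omega> \<partial>density N u)"
    using u \<xi>N by (simp add: nn_integral_density mult.commute)
  also have "\<dots> = (\<integral>\<^sup>+\<omega>. \<xi> \<omega> \<partial>restr_to_subalg (density N u) G)"
    by (rule nn_integral_subalgebra2[symmetric, OF subu \<xi>])
  also have "\<dots> = (\<integral>\<^sup>+\<omega>. \<xi> \<omega> \<partial>density N v)"
    unfolding meq by (rule nn_integral_subalgebra2[OF subv \<xi>])
  also have "\<dots> = (\<integral>\<^sup>+\<omega>. \<xi> \<omega> * v \<omega> \<partial>N)"
    using v \<xi>N by (simp add: nn_integral_density mult.commute)
  finally show ?thesis .
qed

text \<open>Doob-Dynkin factorisation: sets of the pulled back algebra are preimages, and scalings,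
  sums and increasing suprema are imitated on the factors.\<close>

lemma doob_dynkin_ennreal:
  fixes f :: "'a \<Rightarrow> ennreal"
  assumes f: "f \<in> borel_measurable (vimage_algebra \<Omega> g N)" and g: "g \<in> \<Omega> \<rightarrow> space N"
  shows "\<exists>\<phi>\<in>borel_measurable N. \<forall>\<omega>\<in>\<Omega>. f \<omega> = \<phi> (g \<omega>)"
  using f
proof (induct rule: borel_measurable_induct)
  case (cong f' g')
  then show ?case by (metis space_vimage_algebra)
next
  case (set A)
  then obtain B where B: "B \<in> sets N" "A = g -` B \<inter> \<Omega>"
    by (auto simp: sets_vimage_algebra2[OF g])
  have "\<forall>\<omega>\<in>\<Omega>. indicator A \<omega> = (indicator B (g \<omega>) :: ennreal)"
    unfolding B(2) by (simp add: indicator_def)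
  moreover have "(indicator B :: _ \<Rightarrow> ennreal) \<in> borel_measurable N"
    using B(1) by simp
  ultimately show ?case by blast
next
  case (mult u c)
  from mult.hyps obtain \<phi> where "\<phi> \<in> borel_measurable N" "\<forall>\<omega>\<in>\<Omega>. u \<omega> = \<phi> (g \<omega>)"
    by blast
  then show ?case by (intro bexI[of _ "\<lambda>x. c * \<phi> x"]) simp_all
next
  case (add u v)
  from add.hyps obtain \<phi> \<psi> where "\<phi> \<in> borel_measurable N" "\<forall>\<omega>\<in>\<Omega>. u \<omega> = \<phi> (g \<omega>)"
    "\<psi> \<in> borel_measurable N" "\<forall>\<omega>\<in>\<Omega>. v \<omega> = \<psi> (g \<omega>)"
    by blast
  then show ?case by (intro bexI[of _ "\<lambda>x. \<psi> x + \<phi> x"]) simp_all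
next
  case (seq U)
  from seq.hyps have "\<forall>i. \<exists>\<phi>\<in>borel_measurable N. \<forall>\<omega>\<in>\<Omega>. U i \<omega> = \<phi> (g \<omega>)" by blast
  then obtain \<phi> where \<phi>: "\<And>i. \<phi> i \<in> borel_measurable N" "\<And>i. \<forall>\<omega>\<in>\<Omega>. U i \<omega> = \<phi> i (g \<omega>)"
    by metis
  have "(\<lambda>x. SUP i. \<phi> i x) \<in> borel_measurable N" using \<phi>(1) by (rule borel_measurable_SUP[rotated]) simp
  moreover have "\<forall>\<omega>\<in>\<Omega>. (SUP i. U i) \<omega> = (SUP i. \<phi> i (g \<omega>))"
    using \<phi>(2) by (simp add: SUP_apply image_image)
  ultimately show ?case by (intro bexI[where x = "\<lambda>x. SUP i. \<phi> i x"])
qed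

section \<open>The Markov property, from one time to the whole path\<close>

locale right_proc =
  fixes M :: "'w measure" and F :: "real \<Rightarrow> 'w measure"
    and P :: "'z::topological_space \<Rightarrow> 'w measure"
    and Z :: "real \<Rightarrow> 'w \<Rightarrow> 'z" and \<theta> :: "real \<Rightarrow> 'w \<Rightarrow> 'w"
  assumes right_process: "right_process M F P Z \<theta>"
begin

lemma prob_space_P: "prob_space (P z)"
  and sets_P [simp, measurable_cong]: "sets (P z) = sets M"
  and subalg_F: "0 \<le> t \<Longrightarrow> subalgebra M (F t)"
  and F_mono: "0 \<le> s \<Longrightarrow> s \<le> t \<Longrightarrow> sets (F s) \<subseteq> sets (F t)"
  and Z_meas_F: "0 \<le> t \<Longrightarrow> Z t \<in> measurable (F t) borel"
  and P_univ: "A \<in> sets M \<Longrightarrow> univ_measurable_fun (\<lambda>z. emeasure (P z) A)"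
  and Z_0: "AE \<omega> in P z. Z 0 \<omega> = z"
  and Z_right_cont: "\<omega> \<in> space M \<Longrightarrow> 0 \<le> t \<Longrightarrow> continuous (at_right t) (\<lambda>s. Z s \<omega>)"
proof -
  note rp = right_process[unfolded right_process_def]
  note c1 = rp[THEN conjunct1] and rp1 = rp[THEN conjunct2]
  note c2 = rp1[THEN conjunct1] and rp2 = rp1[THEN conjunct2]
  note c3 = rp2[THEN conjunct1] and rp3 = rp2[THEN conjunct2]
  note c4 = rp3[THEN conjunct1] and rp4 = rp3[THEN conjunct2]
  note c5 = rp4[THEN conjunct1] and rp5 = rp4[THEN conjunct2]
  note c6 = rp5[THEN conjunct1] and rp6 = rp5[THEN conjunct2]
  note c8 = rp6[THEN conjunct2, THEN conjunct1]
  show "prob_space (P z)" "sets (P z) = sets M" using c1 by simp_all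
  show "0 \<le> t \<Longrightarrow> subalgebra M (F t)" using c2 by simp
  show "0 \<le> s \<Longrightarrow> s \<le> t \<Longrightarrow> sets (F s) \<subseteq> sets (F t)" using c3 by simp
  show "0 \<le> t \<Longrightarrow> Z t \<in> measurable (F t) borel" using c4 by simp
  show "A \<in> sets M \<Longrightarrow> univ_measurable_fun (\<lambda>z. emeasure (P z) A)" using c5 by simp
  show "AE \<omega> in P z. Z 0 \<omega> = z" using c6 by simp
  show "\<omega> \<in> space M \<Longrightarrow> 0 \<le> t \<Longrightarrow> continuous (at_right t) (\<lambda>s. Z s \<omega>)" using c8 by simp
qed

lemma markov_indicator:
  fixes f :: "'z \<Rightarrow> ennreal"
  assumes "0 \<le> s" "0 \<le> t" "f \<in> borel_measurable borel" "A \<in> sets (F t)"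
  shows "(\<integral>\<^sup>+\<omega>. f (Z (t + s) \<omega>) * indicator A \<omega> \<partial>P z) =
         (\<integral>\<^sup>+\<omega>. (\<integral>\<^sup>+\<omega>'. f (Z s \<omega>') \<partial>P (Z t \<omega>)) * indicator A \<omega> \<partial>P z)"
proof -
  note m = right_process[unfolded right_process_def, THEN conjunct2, THEN conjunct2, THEN conjunct2,
    THEN conjunct2, THEN conjunct2, THEN conjunct2, THEN conjunct2, THEN conjunct2, THEN conjunct1]
  show ?thesis by (rule m[rule_format, OF assms])
qed

lemma space_P [simp]: "space (P z) = space M"
  by (rule sets_eq_imp_space_eq) simp

lemma space_F [simp]: "0 \<le> t \<Longrightarrow> space (F t) = space M"
  using subalg_F[of t] by (auto simp: subalgebra_def)

lemma subalg_F_P: "0 \<le> t \<Longrightarrow> subalgebra (P z) (F t)"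
  using subalg_F[of t] by (auto simp: subalgebra_def)

lemma Z_meas: "0 \<le> t \<Longrightarrow> Z t \<in> measurable M borel"
  by (rule measurable_from_subalg[OF subalg_F Z_meas_F])

lemma F_meas_mono: "0 \<le> s \<Longrightarrow> s \<le> t \<Longrightarrow> f \<in> measurable (F s) N \<Longrightarrow> f \<in> measurable (F t) N"
  using F_mono[of s t] by (auto simp: measurable_def)

lemma F_measD: "0 \<le> t \<Longrightarrow> f \<in> measurable (F t) N \<Longrightarrow> f \<in> measurable M N"
  by (rule measurable_from_subalg[OF subalg_F])

lemma M_measD: "f \<in> measurable M N \<Longrightarrow> f \<in> measurable (P z) N"
  by (simp cong: measurable_cong_sets)

text \<open>For each finite measure \<mu>, \<open>P\<close> is a kernel from the completion of
  \<mu>, and integration against a kernel is measurable.\<close>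

lemma univ_expectation:
  assumes H: "H \<in> borel_measurable M"
  shows "univ_measurable_fun (\<lambda>z. \<integral>\<^sup>+\<omega>. H \<omega> \<partial>P z)"
  unfolding univ_measurable_fun_def
proof safe
  fix \<mu> :: "'z measure"
  assume \<mu>: "sets \<mu> = sets borel" "finite_measure \<mu>"
  have "P \<in> measurable (completion \<mu>) (subprob_algebra M)"
  proof (rule measurable_subprob_algebra)
    show "subprob_space (P z)" for z
      using prob_space_P by (rule prob_space_imp_subprob_space)
    show "(\<lambda>z. emeasure (P z) A) \<in> borel_measurable (completion \<mu>)" if "A \<in> sets M" for A
      using P_univ[OF that] \<mu> by (auto simp: univ_measurable_fun_def)
  qed simp
  then show "(\<lambda>z. \<integral>\<^sup>+\<omega>. H \<omega> \<partial>P z) \<in> borel_measurable (completion \<mu>)"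
    by (rule measurable_compose) (rule nn_integral_measurable_subprob_algebra[OF H])
qed

text \<open>The inner expectation is only universally measurable in \<open>Z t\<close>. A Borel
  version \<open>g\<close> of it lets the equality on events of \<open>F t\<close> be extended to
  weights \<xi> by comparing densities.\<close>

lemma markov_borel:
  fixes f :: "'z \<Rightarrow> ennreal"
  assumes s: "0 \<le> s" and t: "0 \<le> t" and f: "f \<in> borel_measurable borel"
    and \<xi>: "\<xi> \<in> borel_measurable (F t)"
  shows "(\<integral>\<^sup>+\<omega>. \<xi> \<omega> * f (Z (t + s) \<omega>) \<partial>P z) =
         (\<integral>\<^sup>+\<omega>. \<xi> \<omega> * (\<integral>\<^sup>+\<omega>'. f (Z s \<omega>') \<partial>P (Z t \<omega>)) \<partial>P z)"
proof -
  have 1: "univ_measurable_fun (\<lambda>w. \<integral>\<^sup>+\<omega>'. f (Z s \<omega>') \<partial>P w)"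
    by (rule univ_expectation) (use Z_meas[OF s] f in measurable)
  obtain g where g: "g \<in> borel_measurable borel"
    and ae: "AE \<omega> in P z. (\<integral>\<^sup>+\<omega>'. f (Z s \<omega>') \<partial>P (Z t \<omega>)) = g (Z t \<omega>)"
    by (rule univ_fun_borel_version[OF 1 prob_space_P M_measD[OF Z_meas[OF t]]])
  have "(\<integral>\<^sup>+\<omega>. \<xi> \<omega> * f (Z (t + s) \<omega>) \<partial>P z) = (\<integral>\<^sup>+\<omega>. \<xi> \<omega> * g (Z t \<omega>) \<partial>P z)"
  proof (rule nn_integral_mult_eq_subalgebra[OF subalg_F_P[OF t] _ _ _ \<xi>])
    show "(\<lambda>\<omega>. f (Z (t + s) \<omega>)) \<in> borel_measurable (P z)"
      using M_measD[OF Z_meas[of "t+s"]] f s t by simp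
    show "(\<lambda>\<omega>. g (Z t \<omega>)) \<in> borel_measurable (P z)"
      using M_measD[OF Z_meas[of t]] g t by simp
    fix A assume "A \<in> sets (F t)"
    from markov_indicator[OF s t f this, of z]
    show "(\<integral>\<^sup>+\<omega>. f (Z (t + s) \<omega>) * indicator A \<omega> \<partial>P z) = (\<integral>\<^sup>+\<omega>. g (Z t \<omega>) * indicator A \<omega> \<partial>P z)"
      using ae by (auto intro: nn_integral_cong_AE)
  qed
  also have "\<dots> = (\<integral>\<^sup>+\<omega>. \<xi> \<omega> * (\<integral>\<^sup>+\<omega>'. f (Z s \<omega>') \<partial>P (Z t \<omega>)) \<partial>P z)"
    using ae by (intro nn_integral_cong_AE) auto
  finally show ?thesis .
qed

text \<open>Iterating the Markov property applies it to functions that are themselves expectations,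
  hence this generality. A Borel version of \<open>f\<close> is exact outside a set \<open>N\<close>
  that is null for the law at time \<open>t + s\<close>; the Borel case for the indicator of
  \<open>N\<close> shows that \<open>N\<close> is null at time \<open>s\<close> under almost every
  restarted law as well.\<close>

lemma markov_univ:
  fixes f :: "'z \<Rightarrow> ennreal"
  assumes s: "0 \<le> s" and t: "0 \<le> t" and f: "univ_measurable_fun f"
    and \<xi>: "\<xi> \<in> borel_measurable (F t)"
  shows "(\<integral>\<^sup>+\<omega>. \<xi> \<omega> * f (Z (t + s) \<omega>) \<partial>P z) =
         (\<integral>\<^sup>+\<omega>. \<xi> \<omega> * (\<integral>\<^sup>+\<omega>'. f (Z s \<omega>') \<partial>P (Z t \<omega>)) \<partial>P z)"
proof -
  interpret Pz: prob_space "P z" by (rule prob_space_P)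
  have Zts: "Z (t + s) \<in> measurable (P z) borel" using M_measD[OF Z_meas] s t by simp
  interpret D: prob_space "distr (P z) borel (Z (t + s))" by (rule Pz.prob_space_distr[OF Zts])
  have "f \<in> borel_measurable (completion (distr (P z) borel (Z (t + s))))"
    using f unfolding univ_measurable_fun_def by (auto intro: D.finite_measure_axioms)
  from completion_ex_borel_measurable[OF this]
  obtain f' where f': "f' \<in> borel_measurable borel"
    and ae: "AE x in distr (P z) borel (Z (t + s)). f x = f' x"
    by auto
  from AE_E[OF ae] obtain N where N: "{x. f x \<noteq> f' x} \<subseteq> N" "N \<in> sets borel"
    and N0: "emeasure (distr (P z) borel (Z (t + s))) N = 0"
    by auto
  have N': "f x = f' x" if "x \<notin> N" for x using N(1) that by blast
  have "(\<integral>\<^sup>+\<omega>. 1 * indicator N (Z (t + s) \<omega>) \<partial>P z) = 0"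
    using N0 N Zts by (simp add: nn_integral_distr[symmetric])
  then have I0: "(\<integral>\<^sup>+\<omega>. 1 * (\<integral>\<^sup>+\<omega>'. indicator N (Z s \<omega>') \<partial>P (Z t \<omega>)) \<partial>P z) = 0"
    by (subst markov_borel[OF s t, symmetric]) (use N in auto)
  have U: "univ_measurable_fun (\<lambda>w. \<integral>\<^sup>+\<omega>'. indicator N (Z s \<omega>') \<partial>P w)"
    by (rule univ_expectation) (use Z_meas[OF s] N in measurable)
  obtain g where g: "g \<in> borel_measurable borel"
    and aeg: "AE \<omega> in P z. (\<integral>\<^sup>+\<omega>'. indicator N (Z s \<omega>') \<partial>P (Z t \<omega>)) = g (Z t \<omega>)"
    by (rule univ_fun_borel_version[OF U prob_space_P M_measD[OF Z_meas[OF t]]])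
  have "(\<integral>\<^sup>+\<omega>. g (Z t \<omega>) \<partial>P z) = 0"
    using nn_integral_cong_AE[OF aeg] I0 by simp
  moreover have "(\<lambda>\<omega>. g (Z t \<omega>)) \<in> borel_measurable (P z)"
    using M_measD[OF Z_meas[of t]] g t by simp
  ultimately have "AE \<omega> in P z. g (Z t \<omega>) = 0"
    by (simp add: nn_integral_0_iff_AE)
  with aeg have "AE \<omega> in P z. (\<integral>\<^sup>+\<omega>'. indicator N (Z s \<omega>') \<partial>P (Z t \<omega>)) = 0"
    by eventually_elim simp
  then have ae2: "AE \<omega> in P z. (\<integral>\<^sup>+\<omega>'. f' (Z s \<omega>') \<partial>P (Z t \<omega>)) = (\<integral>\<^sup>+\<omega>'. f (Z s \<omega>') \<partial>P (Z t \<omega>))"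
  proof eventually_elim
    case (elim \<omega>)
    have "(\<lambda>\<omega>'. indicator N (Z s \<omega>') :: ennreal) \<in> borel_measurable (P (Z t \<omega>))"
      using M_measD[OF Z_meas[OF s]] N by simp
    with elim have "AE \<omega>' in P (Z t \<omega>). (indicator N (Z s \<omega>') :: ennreal) = 0"
      by (simp add: nn_integral_0_iff_AE)
    then have "AE \<omega>' in P (Z t \<omega>). f' (Z s \<omega>') = f (Z s \<omega>')"
      by eventually_elim (simp add: N' indicator_eq_0_iff)
    then show ?case by (rule nn_integral_cong_AE)
  qed
  have "(\<integral>\<^sup>+\<omega>. \<xi> \<omega> * f (Z (t + s) \<omega>) \<partial>P z) = (\<integral>\<^sup>+\<omega>. \<xi> \<omega> * f' (Z (t + s) \<omega>) \<partial>P z)"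
    using AE_distrD[OF Zts ae] by (intro nn_integral_cong_AE) auto
  also have "\<dots> = (\<integral>\<^sup>+\<omega>. \<xi> \<omega> * (\<integral>\<^sup>+\<omega>'. f' (Z s \<omega>') \<partial>P (Z t \<omega>)) \<partial>P z)"
    by (rule markov_borel[OF s t f' \<xi>])
  also have "\<dots> = (\<integral>\<^sup>+\<omega>. \<xi> \<omega> * (\<integral>\<^sup>+\<omega>'. f (Z s \<omega>') \<partial>P (Z t \<omega>)) \<partial>P z)"
    using ae2 by (intro nn_integral_cong_AE) auto
  finally show ?thesis .
qed

lemma Z_prod_meas:
  assumes "finite J" "\<And>j. j \<in> J \<Longrightarrow> 0 \<le> t + j" "\<And>j. j \<in> J \<Longrightarrow> f j \<in> borel_measurable borel"
  shows "(\<lambda>\<omega>. \<Prod>j\<in>J. f j (Z (t + j) \<omega>) :: ennreal) \<in> borel_measurable M"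
  using assms by (intro borel_measurable_prod_ennreal measurable_compose[OF Z_meas]) auto

text \<open>The earliest time \<open>s\<close> is split off and the others are counted from
  \<open>s\<close>. The induction hypothesis turns the later factors into a function
  \<open>G\<close> of the state at that time, which leaves a single-time problem for
  \<open>f s\<close> times \<open>G\<close>.\<close>

lemma markov_fin:
  fixes f :: "real \<Rightarrow> 'z \<Rightarrow> ennreal"
  assumes "finite J" "J \<subseteq> {0..}" "\<And>j. j \<in> J \<Longrightarrow> f j \<in> borel_measurable borel"
    "0 \<le> t" "\<xi> \<in> borel_measurable (F t)"
  shows "(\<integral>\<^sup>+\<omega>. \<xi> \<omega> * (\<Prod>j\<in>J. f j (Z (t + j) \<omega>)) \<partial>P z) =
         (\<integral>\<^sup>+\<omega>. \<xi> \<omega> * (\<integral>\<^sup>+\<omega>'. (\<Prod>j\<in>J. f j (Z j \<omega>')) \<partial>P (Z t \<omega>)) \<partial>P z)"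
  using assms
proof (induction "card J" arbitrary: J f t \<xi> z)
  case 0
  then show ?case using prob_space.emeasure_space_1[OF prob_space_P] by simp
next
  case (Suc n)
  define s where "s = Min J"
  have Jne: "J \<noteq> {}" using Suc by auto
  have sJ: "s \<in> J" "\<And>j. j \<in> J \<Longrightarrow> s \<le> j" using Suc.prems Jne by (auto simp: s_def)
  have s0: "0 \<le> s" using sJ Suc.prems by auto
  define J' where "J' = (\<lambda>j. j - s) ` (J - {s})"
  have inj: "inj_on (\<lambda>j. j - s) (J - {s})" by (auto simp: inj_on_def)
  define f' where "f' i = f (i + s)" for i
  have J': "finite J'" "J' \<subseteq> {0..}" "\<And>j. j \<in> J' \<Longrightarrow> f' j \<in> borel_measurable borel" "n = card J'"
    using Suc.prems Suc.hyps sJ by (auto simp: J'_def f'_def card_image[OF inj])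
  have split: "(\<Prod>j\<in>J. f j (Z (r + j) \<omega>)) = f s (Z (r + s) \<omega>) * (\<Prod>j\<in>J'. f' j (Z ((r + s) + j) \<omega>))" for r \<omega>
    unfolding J'_def prod.reindex[OF inj]
    by (subst prod.remove[OF Suc.prems(1) sJ(1)]) (simp add: f'_def add.commute add.left_commute)
  define G where "G w = (\<integral>\<^sup>+\<omega>'. (\<Prod>j\<in>J'. f' j (Z j \<omega>')) \<partial>P w)" for w
  have Guniv: "univ_measurable_fun G"
    unfolding G_def
    by (rule univ_expectation) (use Z_prod_meas[of J' 0 f'] J' in auto)
  have fs: "f s \<in> borel_measurable borel" using Suc.prems sJ by auto
  have fG: "univ_measurable_fun (\<lambda>w. f s w * G w)"
    by (intro univ_measurable_fun_mult Guniv univ_measurable_fun_borel fs)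
  have fsF: "(\<lambda>\<omega>. f s (Z r \<omega>)) \<in> borel_measurable (F r)" if "0 \<le> r" for r
    using measurable_compose[OF Z_meas_F[OF that] fs] .
  have IH: "(\<integral>\<^sup>+\<omega>. \<eta> \<omega> * (\<Prod>j\<in>J'. f' j (Z (r + j) \<omega>)) \<partial>P w) = (\<integral>\<^sup>+\<omega>. \<eta> \<omega> * G (Z r \<omega>) \<partial>P w)"
    if "0 \<le> r" "\<eta> \<in> borel_measurable (F r)" for \<eta> r w
    unfolding G_def by (rule Suc.hyps(1)[OF J'(4,1,2)]) (use J' that in auto)
  have \<xi>': "(\<lambda>\<omega>. \<xi> \<omega> * f s (Z (t + s) \<omega>)) \<in> borel_measurable (F (t + s))"
    using F_meas_mono[of t "t + s" \<xi> borel] fsF[of "t + s"] Suc.prems s0 by auto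
  have "(\<integral>\<^sup>+\<omega>. \<xi> \<omega> * (\<Prod>j\<in>J. f j (Z (t + j) \<omega>)) \<partial>P z)
      = (\<integral>\<^sup>+\<omega>. (\<xi> \<omega> * f s (Z (t + s) \<omega>)) * (\<Prod>j\<in>J'. f' j (Z ((t + s) + j) \<omega>)) \<partial>P z)"
    by (simp add: split mult.assoc)
  also have "\<dots> = (\<integral>\<^sup>+\<omega>. \<xi> \<omega> * f s (Z (t + s) \<omega>) * G (Z (t + s) \<omega>) \<partial>P z)"
    using IH[OF _ \<xi>'] Suc.prems s0 by simp
  also have "\<dots> = (\<integral>\<^sup>+\<omega>. \<xi> \<omega> * (\<integral>\<^sup>+\<omega>'. f s (Z s \<omega>') * G (Z s \<omega>') \<partial>P (Z t \<omega>)) \<partial>P z)"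
    using markov_univ[OF s0 \<open>0 \<le> t\<close> fG \<open>\<xi> \<in> borel_measurable (F t)\<close>] by (simp add: mult.assoc)
  \<comment> \<open>The induction hypothesis once more, read backwards: now under the inner laws, at
    time \<open>s\<close> and with \<open>f s\<close> as weight.\<close>
  also have "(\<lambda>w. \<integral>\<^sup>+\<omega>'. f s (Z s \<omega>') * G (Z s \<omega>') \<partial>P w) = (\<lambda>w. \<integral>\<^sup>+\<omega>'. (\<Prod>j\<in>J. f j (Z j \<omega>')) \<partial>P w)"
    using IH[OF s0 fsF[OF s0]] split[of 0] by simp
  finally show ?case .
qed

abbreviation S :: "(real \<Rightarrow> 'z) measure" where
  "S \<equiv> Pi\<^sub>M {0..} (\<lambda>_. borel)"

lemma coord_meas: "0 \<le> t \<Longrightarrow> (\<lambda>w. w t) \<in> measurable S borel"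
  using measurable_component_singleton[of t "{0..}" "\<lambda>_. borel"] by simp

definition traj :: "'w \<Rightarrow> real \<Rightarrow> 'z" where
  "traj \<omega> = (\<lambda>t\<in>{0..}. Z t \<omega>)"

lemma traj_apply [simp]: "0 \<le> t \<Longrightarrow> traj \<omega> t = Z t \<omega>"
  by (simp add: traj_def)

lemma traj_meas: "traj \<in> measurable M S"
  unfolding traj_def by (rule measurable_restrict) (use Z_meas in auto)

lemma shifted_path_meas: "0 \<le> k \<Longrightarrow> (\<lambda>\<omega>. \<lambda>t\<in>{0..}. Z (k + t) \<omega>) \<in> measurable M S"
  by (rule measurable_restrict) (use Z_meas in auto)

text \<open>\<open>N\<close> is left free so that measures with a density, as in
  \<open>conditional_independence\<close>, are covered; \<open>c = 0\<close> gives the law of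
  \<open>traj\<close>.\<close>

lemma emeasure_path_cylinder:
  assumes J: "finite J" "J \<subseteq> {0..}" and A: "\<And>j. j \<in> J \<Longrightarrow> A j \<in> sets borel"
    and N: "sets N = sets M" and c: "0 \<le> c"
  shows "emeasure (distr N S (\<lambda>\<omega>. \<lambda>t\<in>{0..}. Z (c + t) \<omega>)) (prod_emb {0..} (\<lambda>_. borel) J (Pi\<^sub>E J A))
       = (\<integral>\<^sup>+\<omega>. (\<Prod>j\<in>J. indicator (A j) (Z (c + j) \<omega>)) \<partial>N)"
proof -
  have spN: "space N = space M" using N by (rule sets_eq_imp_space_eq)
  have m: "(\<lambda>\<omega>. \<lambda>t\<in>{0..}. Z (c + t) \<omega>) \<in> measurable N S"
    using shifted_path_meas[OF c] N by (simp cong: measurable_cong_sets)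
  have B: "prod_emb {0..} (\<lambda>_. borel) J (Pi\<^sub>E J A) \<in> sets S"
    using J A by (intro sets_PiM_I) auto
  have "emeasure (distr N S (\<lambda>\<omega>. \<lambda>t\<in>{0..}. Z (c + t) \<omega>)) (prod_emb {0..} (\<lambda>_. borel) J (Pi\<^sub>E J A))
     = (\<integral>\<^sup>+w. indicator (prod_emb {0..} (\<lambda>_. borel) J (Pi\<^sub>E J A)) w \<partial>distr N S (\<lambda>\<omega>. \<lambda>t\<in>{0..}. Z (c + t) \<omega>))"
    using B by simp
  also have "\<dots> = (\<integral>\<^sup>+\<omega>. indicator (prod_emb {0..} (\<lambda>_. borel) J (Pi\<^sub>E J A)) (\<lambda>t\<in>{0..}. Z (c + t) \<omega>) \<partial>N)"
    using B by (intro nn_integral_distr m) auto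
  also have "\<dots> = (\<integral>\<^sup>+\<omega>. (\<Prod>j\<in>J. indicator (A j) (Z (c + j) \<omega>)) \<partial>N)"
  proof (rule nn_integral_cong)
    fix \<omega>
    have "(\<lambda>t\<in>{0..}. Z (c + t) \<omega>) \<in> prod_emb {0..} (\<lambda>_. borel) J (Pi\<^sub>E J A)
        \<longleftrightarrow> (\<forall>j\<in>J. Z (c + j) \<omega> \<in> A j)"
      using J by (auto simp: prod_emb_def PiE_def Pi_def extensional_def subset_eq)
    then show "indicator (prod_emb {0..} (\<lambda>_. borel) J (Pi\<^sub>E J A)) (\<lambda>t\<in>{0..}. Z (c + t) \<omega>)
        = (\<Prod>j\<in>J. indicator (A j) (Z (c + j) \<omega>) :: ennreal)"
      using J(1) by (auto simp: indicator_def prod_zero_iff)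
  qed
  finally show ?thesis .
qed

text \<open>The law of the restarted path and the mixture of the laws \<open>K \<omega>\<close>
  agree on cylinders by \<open>markov_fin\<close>, hence on \<open>S\<close>. Since \<open>K\<close>
  is measurable only after completion, the mixture is taken over \<open>completion (P z)\<close>,
  which leaves non-negative integrals unchanged.\<close>

lemma markov_path:
  fixes f :: "(real \<Rightarrow> 'z) \<Rightarrow> ennreal"
  assumes k: "0 \<le> k" and f: "f \<in> borel_measurable S"
  shows "(\<integral>\<^sup>+\<omega>. f (\<lambda>t\<in>{0..}. Z (k + t) \<omega>) \<partial>P z) = (\<integral>\<^sup>+\<omega>. (\<integral>\<^sup>+\<omega>'. f (traj \<omega>') \<partial>P (Z k \<omega>)) \<partial>P z)"
proof -
  interpret Pz: prob_space "P z" by (rule prob_space_P)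
  define K where "K \<omega> = distr (P (Z k \<omega>)) S traj" for \<omega>
  have trajP: "traj \<in> measurable (P w) S" for w by (rule M_measD[OF traj_meas])
  have K: "K \<in> measurable (completion (P z)) (subprob_algebra S)"
  proof (rule measurable_subprob_algebra)
    show "subprob_space (K \<omega>)" for \<omega>
      unfolding K_def
      by (intro prob_space_imp_subprob_space prob_space.prob_space_distr prob_space_P trajP)
    show "sets (K \<omega>) = sets S" for \<omega> by (simp add: K_def)
    fix B assume B: "B \<in> sets S"
    then have B': "traj -` B \<inter> space M \<in> sets M" using traj_meas by (rule measurable_sets[rotated])
    have eqK: "emeasure (K \<omega>) B = emeasure (P (Z k \<omega>)) (traj -` B \<inter> space M)" for \<omega>
      unfolding K_def using emeasure_distr[OF trajP B] by simp
    obtain g where g: "g \<in> borel_measurable borel"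
      and aeg: "AE \<omega> in P z. emeasure (P (Z k \<omega>)) (traj -` B \<inter> space M) = g (Z k \<omega>)"
      by (rule univ_fun_borel_version[OF P_univ[OF B'] prob_space_P M_measD[OF Z_meas[OF k]]])
    have "(\<lambda>\<omega>. g (Z k \<omega>)) \<in> borel_measurable (completion (P z))"
      by (rule measurable_completion) (use M_measD[OF Z_meas[of k]] g k in simp)
    moreover have "AE \<omega> in completion (P z). g (Z k \<omega>) = emeasure (K \<omega>) B"
      unfolding AE_completion_iff using aeg by eventually_elim (simp add: eqK)
    ultimately show "(\<lambda>\<omega>. emeasure (K \<omega>) B) \<in> borel_measurable (completion (P z))"
      by (rule measurable_completion_AE) simp
  qed
  have "distr (P z) S (\<lambda>\<omega>. \<lambda>t\<in>{0..}. Z (k + t) \<omega>) = bind (completion (P z)) K"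
  proof (rule measure_eqI_PiM_infinite)
    show "sets (distr (P z) S (\<lambda>\<omega>. \<lambda>t\<in>{0..}. Z (k + t) \<omega>)) = sets S" by simp
    show "sets (bind (completion (P z)) K) = sets S"
      by (rule sets_bind) (use Pz.not_empty in \<open>auto simp: K_def\<close>)
    show "finite_measure (distr (P z) S (\<lambda>\<omega>. \<lambda>t\<in>{0..}. Z (k + t) \<omega>))"
      by (intro prob_space.finite_measure Pz.prob_space_distr M_measD shifted_path_meas k)
    fix J :: "real set" and A assume J: "finite J" "J \<subseteq> {0..}" and A: "\<And>i. i \<in> J \<Longrightarrow> A i \<in> sets (borel::'z measure)"
    let ?B = "prod_emb {0..} (\<lambda>_. borel) J (Pi\<^sub>E J A)"
    have B: "?B \<in> sets S" using J A by (intro sets_PiM_I) auto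
    have "emeasure (distr (P z) S (\<lambda>\<omega>. \<lambda>t\<in>{0..}. Z (k + t) \<omega>)) ?B
        = (\<integral>\<^sup>+\<omega>. 1 * (\<Prod>j\<in>J. indicator (A j) (Z (k + j) \<omega>)) \<partial>P z)"
      using emeasure_path_cylinder[OF J A sets_P k] by simp
    also have "\<dots> = (\<integral>\<^sup>+\<omega>. 1 * (\<integral>\<^sup>+\<omega>'. (\<Prod>j\<in>J. indicator (A j) (Z j \<omega>')) \<partial>P (Z k \<omega>)) \<partial>P z)"
      using J A k by (intro markov_fin) auto
    also have "\<dots> = (\<integral>\<^sup>+\<omega>. emeasure (K \<omega>) ?B \<partial>P z)"
      using emeasure_path_cylinder[OF J A sets_P order_refl] by (simp add: K_def traj_def[abs_def])
    also have "\<dots> = (\<integral>\<^sup>+\<omega>. emeasure (K \<omega>) ?B \<partial>completion (P z))"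
      by (simp add: nn_integral_completion)
    also have "\<dots> = emeasure (bind (completion (P z)) K) ?B"
      using emeasure_bind[OF _ K B] Pz.not_empty by simp
    finally show "emeasure (distr (P z) S (\<lambda>\<omega>. \<lambda>t\<in>{0..}. Z (k + t) \<omega>)) ?B
        = emeasure (bind (completion (P z)) K) ?B" .
  qed
  then have "(\<integral>\<^sup>+w. f w \<partial>distr (P z) S (\<lambda>\<omega>. \<lambda>t\<in>{0..}. Z (k + t) \<omega>)) = (\<integral>\<^sup>+w. f w \<partial>bind (completion (P z)) K)"
    by simp
  also have "\<dots> = (\<integral>\<^sup>+\<omega>. (\<integral>\<^sup>+w. f w \<partial>K \<omega>) \<partial>completion (P z))"
    by (rule nn_integral_bind[OF f K])
  also have "\<dots> = (\<integral>\<^sup>+\<omega>. (\<integral>\<^sup>+\<omega>'. f (traj \<omega>') \<partial>P (Z k \<omega>)) \<partial>P z)"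
    unfolding nn_integral_completion K_def by (simp add: nn_integral_distr[OF trajP] f)
  also have "(\<integral>\<^sup>+w. f w \<partial>distr (P z) S (\<lambda>\<omega>. \<lambda>t\<in>{0..}. Z (k + t) \<omega>)) = (\<integral>\<^sup>+\<omega>. f (\<lambda>t\<in>{0..}. Z (k + t) \<omega>) \<partial>P z)"
    by (simp add: nn_integral_distr[OF M_measD[OF shifted_path_meas[OF k]]] f)
  finally show ?thesis .
qed

end

section \<open>Increasing paths\<close>

text \<open>Distribution functions whose Stieltjes measure lives on the half line from 0; vanishing
  before 0 turns the value at 0 into an atom.\<close>

definition incr_path :: "(real \<Rightarrow> real) \<Rightarrow> bool" where
  "incr_path A \<longleftrightarrow> mono A \<and> (\<forall>t. continuous (at_right t) A) \<and> (\<forall>t<0. A t = 0)"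

lemma incr_path_nonneg: "incr_path A \<Longrightarrow> 0 \<le> A t"
proof (cases "t < 0")
  case False
  assume A: "incr_path A"
  then have "A (-1) \<le> A t" using False monoD[of A "-1" t] by (simp add: incr_path_def)
  then show ?thesis using A by (simp add: incr_path_def)
qed (simp add: incr_path_def)

lemma incr_path_add: "incr_path A \<Longrightarrow> incr_path B \<Longrightarrow> incr_path (\<lambda>t. A t + B t)"
  unfolding incr_path_def by (auto simp: mono_def add_mono intro!: continuous_intros)

lemma incr_path_mono: "incr_path A \<Longrightarrow> s \<le> t \<Longrightarrow> A s \<le> A t"
  unfolding incr_path_def by (simp add: monoD)

lemma mono_has_left_limit:
  fixes A :: "real \<Rightarrow> real"
  assumes "mono A"
  shows "\<exists>l. (A \<longlongrightarrow> l) (at_left t)"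
proof
  have bdd: "bdd_above (A ` {..<t})" using assms by (intro bdd_aboveI[of _ "A t"]) (auto intro: monoD)
  show "(A \<longlongrightarrow> Sup (A ` {..<t})) (at_left t)"
  proof (rule order_tendstoI)
    fix a assume "a < Sup (A ` {..<t})"
    then obtain s where s: "s < t" "a < A s" using bdd by (subst (asm) less_cSup_iff) auto
    have "\<forall>\<^sub>F x in at_left t. s < x" by (rule eventually_at_leftI[OF _ s(1)]) simp
    then show "\<forall>\<^sub>F x in at_left t. a < A x"
    proof eventually_elim
      case (elim x)
      then show ?case using s(2) monoD[OF assms, of s x] by simp
    qed
  next
    fix a assume a: "Sup (A ` {..<t}) < a"
    have "\<forall>\<^sub>F x in at_left t. x < t" by (simp add: eventually_at_filter)
    then show "\<forall>\<^sub>F x in at_left t. A x < a"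
      by eventually_elim (rule le_less_trans[OF cSup_upper[OF imageI bdd] a], simp)
  qed
qed

lemma incr_path_cadlag: "incr_path A \<Longrightarrow> cadlag_path A"
  unfolding incr_path_def cadlag_path_def using mono_has_left_limit by blast

section \<open>Running maxima\<close>

text \<open>\<open>ennreal\<close> sends negative reals to 0, so this is the running supremum of the
  positive part, meaningful without any boundedness.\<close>

definition runmax :: "(real \<Rightarrow> real) \<Rightarrow> real \<Rightarrow> ennreal" where
  "runmax c t = (SUP s\<in>{0..t}. ennreal (c s))"

lemma runmax_mono: "s \<le> t \<Longrightarrow> runmax c s \<le> runmax c t"
  unfolding runmax_def by (rule SUP_subset_mono) auto

lemma runmax_upper: "0 \<le> s \<Longrightarrow> s \<le> t \<Longrightarrow> ennreal (c s) \<le> runmax c t"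
  unfolding runmax_def by (rule SUP_upper) auto

lemma runmax_least: "(\<And>s. 0 \<le> s \<Longrightarrow> s \<le> t \<Longrightarrow> ennreal (c s) \<le> y) \<Longrightarrow> runmax c t \<le> y"
  unfolding runmax_def by (rule SUP_least) auto

lemma runmax_neg: "t < 0 \<Longrightarrow> runmax c t = 0"
  unfolding runmax_def by (simp add: bot_ennreal)

text \<open>Right continuity recovers every \<open>s < t\<close> from rationals to its right;
  \<open>t\<close> must be added because its right neighbours leave the interval. The countable
  supremum is what measurability proofs use.\<close>

lemma runmax_rat:
  assumes rc: "\<And>s. 0 \<le> s \<Longrightarrow> continuous (at_right s) c" and t: "0 \<le> t"
  shows "runmax c t = (SUP s\<in>insert t ({0..t} \<inter> \<rat>). ennreal (c s))"
proof (rule antisym)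
  show "(SUP s\<in>insert t ({0..t} \<inter> \<rat>). ennreal (c s)) \<le> runmax c t"
    unfolding runmax_def using t by (intro SUP_subset_mono) auto
  show "runmax c t \<le> (SUP s\<in>insert t ({0..t} \<inter> \<rat>). ennreal (c s))" (is "_ \<le> ?S")
  proof (rule runmax_least)
    fix s assume s: "0 \<le> s" "s \<le> t"
    show "ennreal (c s) \<le> ?S"
    proof (cases "s = t")
      case True
      then show ?thesis by (auto intro: SUP_upper)
    next
      case False
      have lim: "((\<lambda>r. ennreal (c r)) \<longlongrightarrow> ennreal (c s)) (at_right s)"
        using rc[OF s(1)] by (intro tendsto_ennrealI) (simp add: continuous_within)
      show ?thesis
      proof (rule ccontr)
        assume "\<not> ennreal (c s) \<le> ?S"
        then have "?S < ennreal (c s)" by simp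
        from order_tendstoD(1)[OF lim this]
        obtain b where b: "b > s" "\<And>r. s < r \<Longrightarrow> r < b \<Longrightarrow> ?S < ennreal (c r)"
          by (auto simp: eventually_at_right_field)
        have "s < min b t" using b s False by auto
        then obtain r where r: "r \<in> \<rat>" "s < r" "r < min b t"
          using Rats_dense_in_real by blast
        then have "ennreal (c r) \<le> ?S" using s by (intro SUP_upper) auto
        with b(2)[of r] r show False by auto
      qed
    qed
  qed
qed

text \<open>The one-sided limits bound the path near each point, and finitely many such
  neighbourhoods cover the compact interval.\<close>

lemma cadlag_bdd:
  fixes c :: "real \<Rightarrow> real"
  assumes rc: "\<And>s. 0 \<le> s \<Longrightarrow> continuous (at_right s) c"
    and ll: "\<And>s. 0 < s \<Longrightarrow> \<exists>l. (c \<longlongrightarrow> l) (at_left s)"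
  shows "\<exists>B. \<forall>s\<in>{0..t}. \<bar>c s\<bar> \<le> B"
proof -
  have "\<exists>a b B. a < s \<and> s < b \<and> (\<forall>r. a < r \<longrightarrow> r < b \<longrightarrow> 0 \<le> r \<longrightarrow> \<bar>c r\<bar> \<le> B)" if s: "0 \<le> s" for s
  proof -
    have "(c \<longlongrightarrow> c s) (at_right s)" using rc[OF s] by (simp add: continuous_within)
    then have "((\<lambda>r. \<bar>c r\<bar>) \<longlongrightarrow> \<bar>c s\<bar>) (at_right s)" by (rule tendsto_rabs)
    from order_tendstoD(2)[OF this, of "\<bar>c s\<bar> + 1"]
    obtain b where b: "b > s" "\<And>r. s < r \<Longrightarrow> r < b \<Longrightarrow> \<bar>c r\<bar> < \<bar>c s\<bar> + 1"
      by (auto simp: eventually_at_right_field)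
    have "\<exists>a B. a < s \<and> (\<forall>r. a < r \<longrightarrow> r < s \<longrightarrow> 0 \<le> r \<longrightarrow> \<bar>c r\<bar> \<le> B)"
    proof (cases "s = 0")
      case True
      then show ?thesis by (intro exI[of _ "-1"]) auto
    next
      case False
      then obtain l where "(c \<longlongrightarrow> l) (at_left s)" using ll[of s] s by auto
      then have "((\<lambda>r. \<bar>c r\<bar>) \<longlongrightarrow> \<bar>l\<bar>) (at_left s)" by (rule tendsto_rabs)
      from order_tendstoD(2)[OF this, of "\<bar>l\<bar> + 1"]
      obtain a where a: "a < s" "\<And>r. a < r \<Longrightarrow> r < s \<Longrightarrow> \<bar>c r\<bar> < \<bar>l\<bar> + 1"
        by (auto simp: eventually_at_left_field)
      show ?thesis using a by (intro exI[of _ a] exI[of _ "\<bar>l\<bar> + 1"]) (auto intro: less_imp_le)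
    qed
    then obtain a B where a: "a < s" "\<And>r. a < r \<Longrightarrow> r < s \<Longrightarrow> 0 \<le> r \<Longrightarrow> \<bar>c r\<bar> \<le> B" by blast
    show ?thesis
    proof (rule exI[of _ a], rule exI[of _ b], rule exI[of _ "max B (\<bar>c s\<bar> + 1)"], intro conjI allI impI)
      fix r assume r: "a < r" "r < b" "0 \<le> r"
      consider "r < s" | "r = s" | "s < r" by linarith
      then show "\<bar>c r\<bar> \<le> max B (\<bar>c s\<bar> + 1)"
      proof cases
        case 1
        then have "\<bar>c r\<bar> \<le> B" using a(2) r by blast
        then show ?thesis by linarith
      next
        case 2
        then show ?thesis by simp
      next
        case 3
        then have "\<bar>c r\<bar> < \<bar>c s\<bar> + 1" using b(2) r by blast
        then show ?thesis by linarith
      qed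
    qed (use a b in auto)
  qed
  then obtain a b B where ab: "\<And>s. 0 \<le> s \<Longrightarrow> a s < s \<and> s < b s"
    and B: "\<And>s r. 0 \<le> s \<Longrightarrow> a s < r \<Longrightarrow> r < b s \<Longrightarrow> 0 \<le> r \<Longrightarrow> \<bar>c r\<bar> \<le> B s"
    by metis
  have "compact {0..t}" by simp
  moreover have "\<And>s. s \<in> {0..t} \<Longrightarrow> open {a s<..<b s}" by simp
  moreover have "{0..t} \<subseteq> (\<Union>s\<in>{0..t}. {a s<..<b s})" using ab by force
  ultimately obtain D where D: "D \<subseteq> {0..t}" "finite D" "{0..t} \<subseteq> (\<Union>s\<in>D. {a s<..<b s})"
    by (rule compactE_image)
  have "\<bar>c r\<bar> \<le> (\<Sum>s\<in>D. \<bar>B s\<bar>)" if r: "r \<in> {0..t}" for r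
  proof -
    obtain s where s: "s \<in> D" "a s < r" "r < b s" using D(3) r by fastforce
    then have "\<bar>c r\<bar> \<le> B s" using B[of s r] D(1) r by auto
    also have "\<dots> \<le> \<bar>B s\<bar>" by simp
    also have "\<dots> \<le> (\<Sum>s\<in>D. \<bar>B s\<bar>)" using s(1) D(2) by (intro member_le_sum) auto
    finally show ?thesis .
  qed
  then show ?thesis by blast
qed

lemma runmax_finite: "(\<And>s. 0 \<le> s \<Longrightarrow> s \<le> t \<Longrightarrow> c s \<le> B) \<Longrightarrow> runmax c t < \<top>"
  by (rule le_less_trans[OF runmax_least[of t c "ennreal B"]]) (auto intro: ennreal_leI)

lemma runmax_incr_path:
  assumes rc: "\<And>s. 0 \<le> s \<Longrightarrow> continuous (at_right s) c"
    and fin: "\<And>t. runmax c t < \<top>"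
  shows "incr_path (\<lambda>t. enn2real (runmax c t))"
  unfolding incr_path_def
proof (intro conjI allI impI)
  show mono: "mono (\<lambda>t. enn2real (runmax c t))"
    using fin by (auto intro!: monoI enn2real_mono runmax_mono)
  show "enn2real (runmax c t) = 0" if "t < 0" for t using that by (simp add: runmax_neg)
  fix t :: real
  show "continuous (at_right t) (\<lambda>t. enn2real (runmax c t))"
  proof (cases "t < 0")
    case True
    have "\<forall>\<^sub>F s in at_right t. enn2real (runmax c s) = 0"
      unfolding eventually_at_right_field by (rule exI[of _ 0]) (use True in \<open>auto simp: runmax_neg\<close>)
    then show ?thesis
      unfolding continuous_within using True by (simp add: runmax_neg tendsto_eventually)
  next
    case False
    then have t: "0 \<le> t" by simp
    have lim: "(c \<longlongrightarrow> c t) (at_right t)" using rc[OF t] by (simp add: continuous_within)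
    show ?thesis
      unfolding continuous_within
    proof (rule order_tendstoI)
      fix a assume a: "a < enn2real (runmax c t)"
      have "\<forall>\<^sub>F s in at_right t. t < s" by (simp add: eventually_at_filter)
      then show "\<forall>\<^sub>F s in at_right t. a < enn2real (runmax c s)"
      proof eventually_elim
        case (elim s)
        with monoD[OF mono, of t s] a show ?case by simp
      qed
    next
      fix a assume a: "enn2real (runmax c t) < a"
      \<comment> \<open>The midpoint leaves room: by right continuity \<open>c\<close> stays below
        \<open>a'\<close> just after \<open>t\<close>, so the maximum over the longer interval is at
        most \<open>a'\<close>, strictly below \<open>a\<close>.\<close>
      define a' where "a' = (enn2real (runmax c t) + a) / 2"
      have a': "enn2real (runmax c t) < a'" "a' < a"
        using a by (auto simp: a'_def field_simps)
      then have a'0: "0 \<le> a'" using enn2real_nonneg[of "runmax c t"] by linarith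
      have "ennreal (c t) \<le> runmax c t" using t by (intro runmax_upper) auto
      then have "c t \<le> enn2real (runmax c t)" using fin[of t]
        by (metis ennreal_enn2real enn2real_nonneg ennreal_le_iff)
      then have "c t < a'" using a' by simp
      from order_tendstoD(2)[OF lim this]
      obtain b where b: "b > t" "\<And>r. t < r \<Longrightarrow> r < b \<Longrightarrow> c r < a'"
        by (auto simp: eventually_at_right_field)
      have "enn2real (runmax c s) < a" if s: "t < s" "s < b" for s
      proof -
        have "runmax c s \<le> ennreal a'"
        proof (rule runmax_least)
          fix r assume r: "0 \<le> r" "r \<le> s"
          show "ennreal (c r) \<le> ennreal a'"
          proof (cases "r \<le> t")
            case True
            then have "ennreal (c r) \<le> runmax c t" using r by (intro runmax_upper) auto
            also have "\<dots> = ennreal (enn2real (runmax c t))" using fin[of t] by simp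
            also have "\<dots> \<le> ennreal a'" using a' by (intro ennreal_leI) simp
            finally show ?thesis .
          next
            case False
            then show ?thesis using b(2)[of r] r s by (intro ennreal_leI) auto
          qed
        qed
        then have "enn2real (runmax c s) \<le> enn2real (ennreal a')" by (rule enn2real_mono) simp
        then show ?thesis using a' a'0 by simp
      qed
      then show "\<forall>\<^sub>F s in at_right t. enn2real (runmax c s) < a"
        unfolding eventually_at_right_field using b(1) by blast
    qed
  qed
qed

section \<open>Step processes on a dyadic grid\<close>

text \<open>For negative \<open>t\<close> the \<open>nat\<close> of a negative floor is 0, so that
  \<open>{1..grid_index n t}\<close> is empty; starting at 1 it also excludes a dividend at time
  0.\<close>

definition grid_index :: "nat \<Rightarrow> real \<Rightarrow> nat" where
  "grid_index n t = nat \<lfloor>t * 2 ^ n\<rfloor>"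

definition step :: "nat \<Rightarrow> (nat \<Rightarrow> real) \<Rightarrow> real \<Rightarrow> real" where
  "step n e t = (\<Sum>k\<in>{k. 1 \<le> k \<and> real k / 2 ^ n \<le> t}. e k)"

lemma grid_le_iff: "1 \<le> k \<Longrightarrow> real k / 2 ^ n \<le> t \<longleftrightarrow> k \<le> grid_index n t"
proof -
  assume k: "1 \<le> k"
  have "real k / 2 ^ n \<le> t \<longleftrightarrow> real_of_int (int k) \<le> t * 2 ^ n" by (simp add: field_simps)
  also have "\<dots> \<longleftrightarrow> int k \<le> \<lfloor>t * 2 ^ n\<rfloor>" by (simp add: le_floor_iff)
  also have "\<dots> \<longleftrightarrow> k \<le> grid_index n t" unfolding grid_index_def using k by linarith
  finally show ?thesis .
qed

lemma step_eq: "step n e t = (\<Sum>k\<in>{1..grid_index n t}. e k)"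
  unfolding step_def by (rule sum.cong) (auto simp: grid_le_iff)

lemma grid_index_mono: "s \<le> t \<Longrightarrow> grid_index n s \<le> grid_index n t"
  unfolding grid_index_def by (intro nat_mono floor_mono) auto

lemma grid_index_le: "0 \<le> t \<Longrightarrow> real (grid_index n t) / 2 ^ n \<le> t"
  unfolding grid_index_def by (simp add: divide_simps)

lemma grid_index_right: "\<exists>b>t. \<forall>s. t < s \<longrightarrow> s < b \<longrightarrow> grid_index n s = grid_index n t"
proof (intro exI conjI allI impI)
  have "t * 2 ^ n < of_int (\<lfloor>t * 2 ^ n\<rfloor> + 1)" by linarith
  then show "t < of_int (\<lfloor>t * 2 ^ n\<rfloor> + 1) / 2 ^ n" by (simp add: divide_simps)
  fix s assume s: "t < s" "s < of_int (\<lfloor>t * 2 ^ n\<rfloor> + 1) / 2 ^ n"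
  have "t * 2 ^ n \<le> s * 2 ^ n" "s * 2 ^ n < of_int (\<lfloor>t * 2 ^ n\<rfloor> + 1)"
    using s by (simp_all add: divide_simps)
  then have "\<lfloor>s * 2 ^ n\<rfloor> = \<lfloor>t * 2 ^ n\<rfloor>" by linarith
  then show "grid_index n s = grid_index n t" by (simp add: grid_index_def)
qed

lemma step_right_cont: "continuous (at_right t) (step n e)"
proof -
  obtain b where "b > t" "\<And>s. t < s \<Longrightarrow> s < b \<Longrightarrow> grid_index n s = grid_index n t"
    using grid_index_right[of t n] by blast
  then have "\<forall>\<^sub>F s in at_right t. step n e s = step n e t"
    unfolding eventually_at_right_field step_eq by (intro exI[of _ b]) auto
  then show ?thesis unfolding continuous_within by (rule tendsto_eventually)
qed

lemma step_incr_path: "(\<And>k. 0 \<le> e k) \<Longrightarrow> incr_path (step n e)"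
  unfolding incr_path_def
proof (intro conjI allI impI)
  assume e: "\<And>k. 0 \<le> e k"
  show "mono (step n e)"
    unfolding step_eq by (auto intro!: monoI sum_mono2 e dest: grid_index_mono[of _ _ n])
  show "step n e t = 0" if "t < 0" for t
  proof -
    have "t * 2 ^ n < 0" using that by (simp add: mult_neg_pos)
    then have "grid_index n t = 0" by (simp add: grid_index_def)
    then show ?thesis by (simp add: step_eq)
  qed
qed (rule step_right_cont)

text \<open>Coarse grid points are the even fine grid points. This is what allows a fine strategy to
  pay coarse dividends.\<close>

lemma step_Suc: "step n e t = step (Suc n) (\<lambda>k. if even k then e (k div 2) else 0) t"
proof -
  have "step n e t = (\<Sum>k\<in>{k. 1 \<le> k \<and> real k / 2 ^ n \<le> t}. e k)" by (simp add: step_def)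
  also have "\<dots> = (\<Sum>k\<in>(*) 2 ` {k. 1 \<le> k \<and> real k / 2 ^ n \<le> t}. e (k div 2))"
    by (subst sum.reindex) (auto simp: inj_on_def)
  also have "(*) 2 ` {k. 1 \<le> k \<and> real k / 2 ^ n \<le> t} = {k. 1 \<le> k \<and> real k / 2 ^ Suc n \<le> t \<and> even k}"
    by (force elim!: evenE)
  also have "(\<Sum>k\<in>{k. 1 \<le> k \<and> real k / 2 ^ Suc n \<le> t \<and> even k}. e (k div 2))
      = (\<Sum>k\<in>{1..grid_index (Suc n) t} \<inter> {k. even k}. e (k div 2))"
    by (rule sum.cong) (auto simp: grid_le_iff simp del: power_Suc)
  also have "\<dots> = (\<Sum>k\<in>{1..grid_index (Suc n) t}. if even k then e (k div 2) else 0)"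
    by (subst sum.inter_restrict) auto
  finally show ?thesis by (simp add: step_eq)
qed

lemma step_add: "step n e t + step n e' t = step n (\<lambda>k. e k + e' k) t"
  and step_diff: "step n e t - step n e' t = step n (\<lambda>k. e k - e' k) t"
  and step_scale: "c * step n e t = step n (\<lambda>k. c * e k) t"
  unfolding step_def by (simp_all add: sum.distrib sum_subtractf sum_distrib_left)

section \<open>The pathwise coupling\<close>

text \<open>Greedy transfer of the coarse dividends \<open>e\<close>. The amount \<open>h\<close> is
  also claimed by the injections \<open>r\<close> of the other path; each dividend is moved as far
  as both claims leave room, and \<open>max 0\<close> freezes the transfer once nothing is
  left.\<close>

fun alloc :: "real \<Rightarrow> (nat \<Rightarrow> real) \<Rightarrow> (nat \<Rightarrow> real) \<Rightarrow> nat \<Rightarrow> real" where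
  "alloc h e r 0 = 0"
| "alloc h e r (Suc k) = alloc h e r k + min (e (Suc k)) (max 0 (h - alloc h e r k - r (Suc k)))"

definition alloc_inc :: "real \<Rightarrow> (nat \<Rightarrow> real) \<Rightarrow> (nat \<Rightarrow> real) \<Rightarrow> nat \<Rightarrow> real" where
  "alloc_inc h e r k = alloc h e r k - alloc h e r (k - 1)"

context
  fixes h :: real and e r :: "nat \<Rightarrow> real"
  assumes h: "0 \<le> h" and e: "\<And>k. 0 \<le> e k" and r: "mono r" and r0: "\<And>k. 0 \<le> r k"
begin

lemma alloc_inc_bounds: "0 \<le> alloc_inc h e r k" "alloc_inc h e r k \<le> e k"
  by (cases k; use e in \<open>auto simp: alloc_inc_def\<close>)+

lemma sum_alloc_inc: "(\<Sum>k\<in>{1..m}. alloc_inc h e r k) = alloc h e r m"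
  by (induction m) (auto simp: alloc_inc_def)

lemma alloc_mono: "i \<le> k \<Longrightarrow> alloc h e r i \<le> alloc h e r k"
  by (rule lift_Suc_mono_le[of "alloc h e r"]) (use e in auto)

lemma alloc_le: "alloc h e r k \<le> h"
proof (induction k)
  case (Suc k)
  then show ?case using r0[of "Suc k"] by auto
qed (use h in simp)

text \<open>Take the last index \<open>u\<close> after \<open>i\<close> at which the total grew:
  that increment was capped by what \<open>r u\<close> left of \<open>h\<close>, and the total has
  not changed since.\<close>

lemma alloc_stalled:
  "i \<le> k \<Longrightarrow> alloc h e r k = alloc h e r i \<or> (\<exists>u. i < u \<and> u \<le> k \<and> alloc h e r k + r u \<le> h)"
proof (induction k)
  case (Suc k)
  show ?case
  proof (cases "i = Suc k")
    case False
    then have "i \<le> k" using Suc by auto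
    show ?thesis
    proof (cases "alloc h e r (Suc k) = alloc h e r k")
      case True
      then show ?thesis using Suc.IH[OF \<open>i \<le> k\<close>] by auto
    next
      case False
      then have "alloc h e r (Suc k) + r (Suc k) \<le> h"
        using e[of "Suc k"] by (auto simp: min_def max_def split: if_splits)
      then show ?thesis using \<open>i \<le> k\<close> by (intro disjI2 exI[of _ "Suc k"]) auto
    qed
  qed auto
qed auto

text \<open>An increment that is cut short leaves total plus \<open>r\<close> at \<open>h\<close> or
  above, and both only increase afterwards. Below \<open>h\<close>, therefore, nothing has been
  cut.\<close>

lemma alloc_full: "alloc h e r k + r k < h \<Longrightarrow> alloc h e r k = (\<Sum>j\<in>{1..k}. e j)"
proof (induction k)
  case (Suc k)
  have m: "r k \<le> r (Suc k)" using r by (simp add: monoD)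
  have "alloc h e r k \<le> alloc h e r (Suc k)" by (rule alloc_mono) simp
  then have "alloc h e r k = (\<Sum>j\<in>{1..k}. e j)" using Suc m by simp
  moreover have "min (e (Suc k)) (max 0 (h - alloc h e r k - r (Suc k))) = e (Suc k)"
    using Suc.prems by (auto simp: min_def max_def split: if_splits)
  ultimately show ?case by simp
qed simp

end

text \<open>Two controlled paths, started at \<open>x + h\<close> (dividends \<open>L'\<close> on the coarse grid) and at \<open>x\<close>
  (dividends \<open>L\<close>), exchange the amount \<open>h\<close>: until it is used up, the dividends \<open>L'\<close> and the
  injections \<open>R\<close> are booked to the other path.\<close>
lemma coupling:
  fixes L L' c R R' :: "real \<Rightarrow> real" and n :: nat and h :: real and e :: "nat \<Rightarrow> real"
  defines "a \<equiv> step n (alloc_inc h e (\<lambda>k. R (real k / 2 ^ n)))"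
  assumes h: "0 \<le> h" and e: "\<And>k. 0 \<le> e k" and L': "L' = step n e" and L: "\<And>s. 0 \<le> L s"
    and R: "\<And>s t. 0 \<le> s \<Longrightarrow> s \<le> t \<Longrightarrow> R s \<le> R t" "\<And>s. 0 \<le> R s" "\<And>s. 0 \<le> s \<Longrightarrow> L s - c s \<le> R s"
    and R': "\<And>s t. 0 \<le> s \<Longrightarrow> s \<le> t \<Longrightarrow> R' s \<le> R' t" "\<And>s. 0 \<le> R' s" "\<And>s. 0 \<le> s \<Longrightarrow> L' s - (h + c s) \<le> R' s"
    and s: "0 \<le> s" "s \<le> t"
  shows "L s + a s - (h + c s) \<le> max 0 (R t + a t - h)"
    and "L' s - a s - c s \<le> R' t + min (R t) (h - a t)"
    and "a t \<le> h"
proof -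
  define r where "r k = R (real k / 2 ^ n)" for k
  have r: "mono r" "\<And>k. 0 \<le> r k"
    by (auto simp: r_def mono_def intro!: R divide_right_mono)
  have a_eq: "a t = alloc h e r (grid_index n t)" for t
    by (simp add: a_def step_eq r_def[symmetric] sum_alloc_inc[OF h e r, simplified])
  have ast: "a s \<le> a t" unfolding a_eq using s by (intro alloc_mono[OF h e r] grid_index_mono)
  have ah: "a u \<le> h" for u unfolding a_eq by (rule alloc_le[OF h e r])
  then show "a t \<le> h" .
  show "L s + a s - (h + c s) \<le> max 0 (R t + a t - h)"
    using R(3)[OF s(1)] R(1)[OF s] ast by linarith
  have r_le: "r (grid_index n s) \<le> R s"
    unfolding r_def using s by (intro R) (auto intro: grid_index_le)
  \<comment> \<open>\<open>min (R s) (h - a s)\<close> is the injection handed to the coarse path so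
    far. It must not decrease although \<open>h - a\<close> does: if \<open>a\<close> has grown
    after \<open>s\<close>, then at the last grid time \<open>u\<close> of growth there was still
    room for \<open>r u\<close>, which is at least \<open>R s\<close>.\<close>
  have N: "min (R s) (h - a s) \<le> min (R t) (h - a t)"
  proof -
    have "a t = a s \<or> (\<exists>u. grid_index n s < u \<and> u \<le> grid_index n t \<and> a t + r u \<le> h)"
      unfolding a_eq by (rule alloc_stalled[OF h e r]) (rule grid_index_mono[OF s(2)])
    then show ?thesis
    proof
      assume "a t = a s"
      then show ?thesis using R(1)[OF s] by auto
    next
      assume "\<exists>u. grid_index n s < u \<and> u \<le> grid_index n t \<and> a t + r u \<le> h"
      then obtain u where u: "grid_index n s < u" "a t + r u \<le> h" by blast
      have "\<not> real u / 2 ^ n \<le> s" using u(1) by (subst grid_le_iff) auto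
      then have "R s \<le> r u" unfolding r_def using s by (intro R) auto
      then show ?thesis using u R(1)[OF s] by auto
    qed
  qed
  \<comment> \<open>Before \<open>h\<close> is exhausted, all coarse dividends have been passed on
    (\<open>alloc_full\<close>) and only \<open>- c s\<close> remains, which \<open>R s\<close>
    covers because \<open>L s\<close> is non-negative. Afterwards, \<open>a s\<close> in dividends
    and \<open>h - a s\<close> in injections make up for the missing capital
    \<open>h\<close>.\<close>
  show "L' s - a s - c s \<le> R' t + min (R t) (h - a t)"
  proof (cases "a s + R s < h")
    case True
    then have "alloc h e r (grid_index n s) + r (grid_index n s) < h"
      using r_le unfolding a_eq by linarith
    then have "a s = L' s" unfolding a_eq L' step_eq by (rule alloc_full[OF h e r])
    then show ?thesis using True N L[of s] R(3)[OF s(1)] R'(2)[of t] by (simp add: min_def split: if_splits)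
  next
    case False
    then have "min (R s) (h - a s) = h - a s" by simp
    then show ?thesis using N R'(3)[OF s(1)] R'(1)[OF s] by linarith
  qed
qed

section \<open>Stieltjes integrals of left-continuous discount functions\<close>

text \<open>The Abel-summed form of the left-endpoint Riemann sum of \<open>\<integral>\<^bsub>[0,N]\<^esub> d dA\<close>: for decreasing
  \<open>d\<close> it is linear in \<open>A\<close> with non-negative coefficients.\<close>
definition abel_sum :: "nat \<Rightarrow> nat \<Rightarrow> (real \<Rightarrow> ennreal) \<Rightarrow> (real \<Rightarrow> ennreal) \<Rightarrow> ennreal" where
  "abel_sum m N d A =
     (\<Sum>j\<in>{1..<N * 2 ^ m}. A (real j / 2 ^ m) * (d (real (j - 1) / 2 ^ m) - d (real j / 2 ^ m)))
     + A (real N) * d (real (N * 2 ^ m - 1) / 2 ^ m)"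

text \<open>An integral that uses only countably many values of \<open>d\<close> and
  \<open>A\<close>, so that measurability and monotonicity in \<open>A\<close> are immediate.
  \<open>liminf\<close> avoids a convergence hypothesis; for the integrands and increasing paths
  below it is a limit.\<close>

definition stieltjes :: "(real \<Rightarrow> ennreal) \<Rightarrow> (real \<Rightarrow> ennreal) \<Rightarrow> ennreal" where
  "stieltjes d A = (SUP N. liminf (\<lambda>m. abel_sum m (Suc N) d A))"

lemma dyadic_le: "j \<le> N * 2 ^ m \<Longrightarrow> real j / 2 ^ m \<le> real N"
proof -
  assume "j \<le> N * 2 ^ m"
  then have "real j \<le> real (N * 2 ^ m)" by (simp only: of_nat_le_iff)
  then show ?thesis by (simp add: divide_le_eq)
qed

lemma abel_sum_mono:
  assumes "\<And>t. 0 \<le> t \<Longrightarrow> t \<le> real N \<Longrightarrow> A t \<le> B t"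
  shows "abel_sum m N d A \<le> abel_sum m N d B"
  unfolding abel_sum_def
  by (intro add_mono sum_mono mult_right_mono assms dyadic_le) simp_all

lemma abel_sum_cong:
  "(\<And>t. 0 \<le> t \<Longrightarrow> t \<le> real N \<Longrightarrow> A t = B t) \<Longrightarrow> abel_sum m N d A = abel_sum m N d B"
  by (intro antisym abel_sum_mono) simp_all

lemma stieltjes_mono: "(\<And>t. 0 \<le> t \<Longrightarrow> A t \<le> B t) \<Longrightarrow> stieltjes d A \<le> stieltjes d B"
  unfolding stieltjes_def by (intro SUP_mono' Liminf_mono always_eventually allI abel_sum_mono) auto

lemma abel_sum_add: "abel_sum m N d (\<lambda>t. A t + B t) = abel_sum m N d A + abel_sum m N d B"
  unfolding abel_sum_def by (simp add: sum.distrib distrib_right add_ac)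

lemma abel_sum_measurable [measurable]:
  assumes "\<And>t. 0 \<le> t \<Longrightarrow> (\<lambda>\<omega>. d \<omega> t) \<in> borel_measurable N" "\<And>t. 0 \<le> t \<Longrightarrow> (\<lambda>\<omega>. A \<omega> t) \<in> borel_measurable N"
  shows "(\<lambda>\<omega>. abel_sum m K (d \<omega>) (A \<omega>)) \<in> borel_measurable N"
  unfolding abel_sum_def
  by (intro borel_measurable_add borel_measurable_sum borel_measurable_times_ennreal
      borel_measurable_minus_ennreal assms) simp_all

lemma stieltjes_measurable:
  assumes "\<And>t. 0 \<le> t \<Longrightarrow> (\<lambda>\<omega>. d \<omega> t) \<in> borel_measurable N" "\<And>t. 0 \<le> t \<Longrightarrow> (\<lambda>\<omega>. A \<omega> t) \<in> borel_measurable N"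
  shows "(\<lambda>\<omega>. stieltjes (d \<omega>) (A \<omega>)) \<in> borel_measurable N"
  unfolding stieltjes_def
  by (intro borel_measurable_SUP borel_measurable_liminf abel_sum_measurable assms) auto

text \<open>Summation by parts, the jump at 0 being the extra term. The last coefficient is at
  \<open>J - 1\<close> because the sums use left endpoints.\<close>

lemma abel_summation:
  fixes a \<delta> :: "nat \<Rightarrow> real"
  assumes "1 \<le> J"
  shows "\<delta> 0 * a 0 + (\<Sum>j<J. \<delta> j * (a (Suc j) - a j))
       = (\<Sum>j\<in>{1..<J}. a j * (\<delta> (j - 1) - \<delta> j)) + a J * \<delta> (J - 1)"
  using assms
proof (induction J rule: dec_induct)
  case base
  then show ?case by (simp add: algebra_simps)
next
  case (step J)
  have "{1..<Suc J} = insert J {1..<J}" using step by auto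
  then show ?case using step by (simp add: algebra_simps)
qed

text \<open>Left continuity is the right demand: the discount factor may drop to 0 immediately after
  a time when the integrated rate explodes. It is also what makes left-endpoint sums converge at
  every point, atoms of the integrator included.\<close>

locale stieltjes_integrand =
  fixes d :: "real \<Rightarrow> ennreal"
  assumes d_le_1: "\<And>t. 0 \<le> t \<Longrightarrow> d t \<le> 1"
    and d_anti: "\<And>s t. 0 \<le> s \<Longrightarrow> s \<le> t \<Longrightarrow> d t \<le> d s"
    and d_left: "\<And>t. 0 < t \<Longrightarrow> (d \<longlongrightarrow> d t) (at_left t)"
begin

text \<open>Cells open on the left match the increments of \<open>interval_measure\<close>; the
  point 0 carries the initial jump and gets its own term.\<close>

definition left_step :: "nat \<Rightarrow> nat \<Rightarrow> real \<Rightarrow> ennreal" where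
  "left_step m N t = d 0 * indicator {0} t +
     (\<Sum>j<N * 2 ^ m. d (real j / 2 ^ m) * indicator {real j / 2 ^ m<..real (Suc j) / 2 ^ m} t)"

lemma left_step_0: "left_step m N 0 = d 0"
proof -
  have "(0::real) \<notin> {real j / 2 ^ m<..real (Suc j) / 2 ^ m}" for j by (simp add: not_less)
  then show ?thesis unfolding left_step_def by (subst sum.neutral) auto
qed

lemma left_step_pos:
  assumes t: "0 < t" "t \<le> real N"
  shows "left_step m N t = d (real (nat (\<lceil>t * 2 ^ m\<rceil> - 1)) / 2 ^ m)"
proof -
  define k where "k = nat (\<lceil>t * 2 ^ m\<rceil> - 1)"
  have "0 < t * 2 ^ m" using t by simp
  then have c1: "1 \<le> \<lceil>t * 2 ^ m\<rceil>" by linarith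
  then have kr: "real k = of_int \<lceil>t * 2 ^ m\<rceil> - 1" by (simp add: k_def)
  have k1: "real k < t * 2 ^ m" "t * 2 ^ m \<le> real k + 1"
    unfolding kr by linarith+
  have "t * 2 ^ m \<le> real N * 2 ^ m" using t by simp
  then have "real k < real (N * 2 ^ m)" using k1(1) by (simp only: of_nat_mult of_nat_power of_nat_numeral)
  then have kJ: "k < N * 2 ^ m" by (simp only: of_nat_less_iff)
  have uniq: "t \<in> {real j / 2 ^ m<..real (Suc j) / 2 ^ m} \<longleftrightarrow> j = k" for j
  proof -
    have "t \<in> {real j / 2 ^ m<..real (Suc j) / 2 ^ m} \<longleftrightarrow> real j < t * 2 ^ m \<and> t * 2 ^ m \<le> real j + 1"
      by (simp add: field_simps)
    also have "\<dots> \<longleftrightarrow> j = k"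
    proof
      assume "real j < t * 2 ^ m \<and> t * 2 ^ m \<le> real j + 1"
      with k1 have "real j < real k + 1" "real k < real j + 1" by linarith+
      then show "j = k" by linarith
    qed (use k1 in auto)
    finally show ?thesis .
  qed
  have "left_step m N t = (\<Sum>j<N * 2 ^ m. if j = k then d (real j / 2 ^ m) else 0)"
    unfolding left_step_def using t uniq by (auto simp: indicator_def intro!: sum.cong)
  also have "\<dots> = d (real k / 2 ^ m)" using kJ by (simp add: sum.delta)
  finally show ?thesis by (simp add: k_def)
qed

lemma left_step_le_1: "t \<in> {0..real N} \<Longrightarrow> left_step m N t \<le> 1"
  using left_step_0 left_step_pos[of t N m] by (cases "t = 0") (auto intro!: d_le_1)

lemma left_step_ge: "t \<in> {0..real N} \<Longrightarrow> d t \<le> left_step m N t"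
proof (cases "t = 0")
  case False
  assume t: "t \<in> {0..real N}"
  then have "0 < t * 2 ^ m" using False by simp
  then have "real (nat (\<lceil>t * 2 ^ m\<rceil> - 1)) \<le> t * 2 ^ m" by linarith
  then show ?thesis
    using False t by (auto simp: left_step_pos field_simps intro!: d_anti)
qed (simp add: left_step_0)

lemma left_step_tendsto:
  assumes t: "t \<in> {0..real N}"
  shows "(\<lambda>m. left_step m N t) \<longlonglongrightarrow> d t"
proof (cases "t = 0")
  case False
  then have t0: "0 < t" "t \<le> real N" using t by auto
  define u where "u m = real (nat (\<lceil>t * 2 ^ m\<rceil> - 1)) / 2 ^ m" for m
  have u: "u m < t \<and> t - (1/2) ^ m \<le> u m" for m
  proof -
    have "0 < t * 2 ^ m" using t0 by simp
    then have "real (nat (\<lceil>t * 2 ^ m\<rceil> - 1)) = of_int \<lceil>t * 2 ^ m\<rceil> - 1" by simp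
    then have "real (nat (\<lceil>t * 2 ^ m\<rceil> - 1)) < t * 2 ^ m"
      "t * 2 ^ m - 1 \<le> real (nat (\<lceil>t * 2 ^ m\<rceil> - 1))" by linarith+
    then show ?thesis by (simp add: u_def field_simps power_divide)
  qed
  have "(\<lambda>m. t - (1/2) ^ m) \<longlonglongrightarrow> t - 0"
    by (intro tendsto_diff tendsto_const LIMSEQ_realpow_zero) auto
  then have "u \<longlonglongrightarrow> t"
    by (intro tendsto_sandwich[of "\<lambda>m. t - (1/2)^m" u sequentially "\<lambda>_. t"])
       (use u in \<open>auto intro!: always_eventually less_imp_le\<close>)
  then have "filterlim u (at_left t) sequentially"
    unfolding filterlim_at using u by (auto intro!: always_eventually)
  from filterlim_compose[OF d_left[OF t0(1)] this]
  show ?thesis using t0 by (simp add: left_step_pos u_def)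
qed (simp add: left_step_0)

context
  fixes A :: "real \<Rightarrow> real"
  assumes A: "incr_path A"
begin

lemma emeasure_Ioc_incr: "a \<le> b \<Longrightarrow> emeasure (interval_measure A) {a<..b} = ennreal (A b - A a)"
  using A by (intro emeasure_interval_measure_Ioc) (auto simp: incr_path_def dest: monoD)

text \<open>Since \<open>A\<close> vanishes before 0, the interval from -1 to 0 without its
  endpoints is null, so the mass equals that of \<open>{-1<..b}\<close>. The number -1 is
  arbitrary.\<close>

lemma emeasure_Icc_incr: "0 \<le> b \<Longrightarrow> emeasure (interval_measure A) {0..b} = ennreal (A b)"
proof -
  assume b: "0 \<le> b"
  have A0: "A t = 0" if "t < 0" for t using A that by (simp add: incr_path_def)
  have "emeasure (interval_measure A) (\<Union>n. {-1<..-(1 / real (Suc n))}) = 0"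
    by (rule emeasure_UN_eq_0) (auto simp: emeasure_Ioc_incr A0)
  moreover have "(\<Union>n. {-1<..-(1 / real (Suc n))}) = {-1<..<0}"
  proof (intro equalityI subsetI)
    fix x :: real assume x: "x \<in> {-1<..<0}"
    then obtain n where "inverse (real (Suc n)) < -x" using reals_Archimedean[of "-x"] by auto
    then show "x \<in> (\<Union>n. {-1<..-(1 / real (Suc n))})"
      using x by (intro UN_I[of n]) (auto simp: inverse_eq_divide)
  next
    fix x :: real assume "x \<in> (\<Union>n. {-1<..-(1 / real (Suc n))})"
    then obtain n where n: "-1 < x" "x \<le> -(1 / real (Suc n))" by auto
    have "0 < 1 / real (Suc n)" by simp
    then have "x < 0" using n(2) by linarith
    then show "x \<in> {-1<..<0}" using n(1) by simp
  qed
  ultimately have z: "emeasure (interval_measure A) {-1<..<0} = 0" by simp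
  have "{-1<..b} = {-1<..<0} \<union> {0..b}" using b by auto
  then have "emeasure (interval_measure A) {-1<..b}
      = emeasure (interval_measure A) {-1<..<0} + emeasure (interval_measure A) {0..b}"
    by (simp only:) (rule plus_emeasure[symmetric], auto)
  then show ?thesis using b z by (simp add: emeasure_Ioc_incr A0)
qed

text \<open>Integrating the step function gives a Riemann-Stieltjes sum, which
  \<open>abel_summation\<close> rearranges. The detour through the reals \<delta> and
  \<open>a\<close> makes the subtractions well behaved.\<close>

lemma abel_sum_eq_integral:
  assumes N: "1 \<le> N"
  shows "abel_sum m N d (\<lambda>t. ennreal (A t)) = (\<integral>\<^sup>+t\<in>{0..real N}. left_step m N t \<partial>interval_measure A)"
proof -
  define \<delta> where "\<delta> j = enn2real (d (real j / 2 ^ m))" for j :: nat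
  define a where "a j = A (real j / 2 ^ m)" for j :: nat
  define J where "J = N * 2 ^ m"
  have dfin: "d t < \<top>" if "0 \<le> t" for t using d_le_1[OF that] by (rule le_less_trans) simp
  have d\<delta>: "d (real j / 2 ^ m) = ennreal (\<delta> j)" for j
    using dfin[of "real j / 2 ^ m"] by (simp add: \<delta>_def)
  have \<delta>0: "0 \<le> \<delta> j" for j by (simp add: \<delta>_def)
  have \<delta>anti: "\<delta> j \<le> \<delta> (j - 1)" for j
    unfolding \<delta>_def using dfin by (intro enn2real_mono d_anti divide_right_mono) auto
  have a0: "0 \<le> a j" for j by (simp add: a_def incr_path_nonneg[OF A])
  have amono: "a j \<le> a (Suc j)" for j
    unfolding a_def by (rule incr_path_mono[OF A]) (simp add: divide_right_mono)
  have J: "1 \<le> J" "real J / 2 ^ m = real N" using N by (auto simp: J_def)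
  have "(\<integral>\<^sup>+t\<in>{0..real N}. left_step m N t \<partial>interval_measure A)
     = (\<integral>\<^sup>+t. d 0 * indicator {0} t +
         (\<Sum>j<J. d (real j / 2 ^ m) * indicator {real j / 2 ^ m<..real (Suc j) / 2 ^ m} t) \<partial>interval_measure A)"
  proof (rule nn_integral_cong)
    fix t
    show "left_step m N t * indicator {0..real N} t = d 0 * indicator {0} t +
         (\<Sum>j<J. d (real j / 2 ^ m) * indicator {real j / 2 ^ m<..real (Suc j) / 2 ^ m} t)"
    proof (cases "t \<in> {0..real N}")
      case False
      have "t \<notin> {real j / 2 ^ m<..real (Suc j) / 2 ^ m}" if "j < J" for j
      proof -
        have "real (Suc j) \<le> real J" using that by simp
        then have "real (Suc j) / 2 ^ m \<le> real N" using J(2) by (metis divide_right_mono zero_le_numeral zero_le_power)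
        moreover have "0 \<le> real j / 2 ^ m" by simp
        ultimately show ?thesis using False unfolding greaterThanAtMost_iff atLeastAtMost_iff by linarith
      qed
      then show ?thesis using False N by (auto simp: indicator_def)
    qed (simp add: left_step_def J_def)
  qed
  also have "\<dots> = d 0 * emeasure (interval_measure A) {0} +
      (\<Sum>j<J. d (real j / 2 ^ m) * emeasure (interval_measure A) {real j / 2 ^ m<..real (Suc j) / 2 ^ m})"
  proof -
    have s: "(\<integral>\<^sup>+t. (\<Sum>j<J. d (real j / 2 ^ m) * indicator {real j / 2 ^ m<..real (Suc j) / 2 ^ m} t) \<partial>interval_measure A)
      = (\<Sum>j<J. d (real j / 2 ^ m) * emeasure (interval_measure A) {real j / 2 ^ m<..real (Suc j) / 2 ^ m})"
      by (subst nn_integral_sum) (simp_all only: nn_integral_cmult_indicator sets_interval_measure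
          borel_measurable_times_ennreal borel_measurable_const borel_measurable_indicator greaterThanAtMost_borel)
    show ?thesis
    proof (subst nn_integral_add)
      show "(\<lambda>t. \<Sum>j<J. d (real j / 2 ^ m) * indicator {real j / 2 ^ m<..real (Suc j) / 2 ^ m} t)
          \<in> borel_measurable (interval_measure A)"
        by measurable
    qed (simp_all only: s nn_integral_cmult_indicator, simp_all)
  qed
  also have "emeasure (interval_measure A) {0} = ennreal (A 0)" using emeasure_Icc_incr[of 0] by simp
  also have "d 0 * ennreal (A 0) + (\<Sum>j<J. d (real j / 2 ^ m) * emeasure (interval_measure A) {real j / 2 ^ m<..real (Suc j) / 2 ^ m})
      = ennreal (\<delta> 0 * a 0 + (\<Sum>j<J. \<delta> j * (a (Suc j) - a j)))"
  proof -
    have "emeasure (interval_measure A) {real j / 2 ^ m<..real (Suc j) / 2 ^ m} = ennreal (a (Suc j) - a j)" for j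
      unfolding a_def by (rule emeasure_Ioc_incr) (simp add: divide_right_mono)
    then have "(\<Sum>j<J. d (real j / 2 ^ m) * emeasure (interval_measure A) {real j / 2 ^ m<..real (Suc j) / 2 ^ m})
        = (\<Sum>j<J. ennreal (\<delta> j * (a (Suc j) - a j)))"
      using \<delta>0 amono by (intro sum.cong) (auto simp: d\<delta> ennreal_mult)
    also have "\<dots> = ennreal (\<Sum>j<J. \<delta> j * (a (Suc j) - a j))"
      using \<delta>0 amono by (intro sum_ennreal) simp
    finally have "(\<Sum>j<J. d (real j / 2 ^ m) * emeasure (interval_measure A) {real j / 2 ^ m<..real (Suc j) / 2 ^ m})
        = ennreal (\<Sum>j<J. \<delta> j * (a (Suc j) - a j))" .
    moreover have "d 0 * ennreal (A 0) = ennreal (\<delta> 0 * a 0)"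
      using d\<delta>[of 0] \<delta>0[of 0] a0[of 0] by (simp add: ennreal_mult a_def)
    ultimately show ?thesis
      using \<delta>0 a0 amono by (simp only:) (rule ennreal_plus[symmetric], auto intro!: sum_nonneg)
  qed
  also have "\<delta> 0 * a 0 + (\<Sum>j<J. \<delta> j * (a (Suc j) - a j))
       = (\<Sum>j\<in>{1..<J}. a j * (\<delta> (j - 1) - \<delta> j)) + a J * \<delta> (J - 1)"
    by (rule abel_summation[OF J(1)])
  also have "ennreal \<dots> = ennreal (\<Sum>j\<in>{1..<J}. a j * (\<delta> (j - 1) - \<delta> j)) + ennreal (a J * \<delta> (J - 1))"
    using a0 \<delta>0 \<delta>anti by (intro ennreal_plus sum_nonneg mult_nonneg_nonneg) (simp_all only: diff_ge_0_iff_ge)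
  also have "ennreal (\<Sum>j\<in>{1..<J}. a j * (\<delta> (j - 1) - \<delta> j)) = (\<Sum>j\<in>{1..<J}. ennreal (a j * (\<delta> (j - 1) - \<delta> j)))"
    using a0 \<delta>anti by (intro sum_ennreal[symmetric] mult_nonneg_nonneg) (simp_all only: diff_ge_0_iff_ge)
  also have "\<dots> = (\<Sum>j\<in>{1..<J}. ennreal (a j) * (ennreal (\<delta> (j - 1)) - ennreal (\<delta> j)))"
    using a0 \<delta>0 \<delta>anti by (intro sum.cong refl) (simp only: ennreal_minus ennreal_mult' ennreal_mult diff_ge_0_iff_ge)
  also have "ennreal (a J * \<delta> (J - 1)) = ennreal (A (real N)) * d (real (J - 1) / 2 ^ m)"
    using a0[of J] \<delta>0[of "J - 1"] J(2) unfolding d\<delta> by (simp add: ennreal_mult a_def)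
  also have "(\<Sum>j\<in>{1..<J}. ennreal (a j) * (ennreal (\<delta> (j - 1)) - ennreal (\<delta> j)))
      + ennreal (A (real N)) * d (real (J - 1) / 2 ^ m) = abel_sum m N d (\<lambda>t. ennreal (A t))"
    unfolding abel_sum_def J_def[symmetric] d\<delta> a_def ..
  finally show ?thesis by simp
qed

lemma abel_sum_le: "1 \<le> N \<Longrightarrow> abel_sum m N d (\<lambda>t. ennreal (A t)) \<le> ennreal (A (real N))"
proof -
  assume N: "1 \<le> N"
  have "abel_sum m N d (\<lambda>t. ennreal (A t)) \<le> (\<integral>\<^sup>+t. indicator {0..real N} t \<partial>interval_measure A)"
    unfolding abel_sum_eq_integral[OF N]
    by (intro nn_integral_mono) (auto simp: indicator_def intro: left_step_le_1)
  also have "\<dots> = ennreal (A (real N))" by (simp add: emeasure_Icc_incr)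
  finally show ?thesis .
qed

lemma d_measurable_Icc: "(\<lambda>t. d t * indicator {0..real N} t) \<in> borel_measurable borel"
proof (rule borel_measurable_LIMSEQ_order)
  show "(\<lambda>m. left_step m N t * indicator {0..real N} t) \<longlonglongrightarrow> d t * indicator {0..real N} t" for t
    using left_step_tendsto[of t N] by (cases "t \<in> {0..real N}") auto
  show "(\<lambda>t. left_step m N t * indicator {0..real N} t) \<in> borel_measurable borel" for m
    unfolding left_step_def by measurable
qed

text \<open>Dominated convergence: the step functions tend to \<open>d\<close> pointwise and are at
  most 1 on an interval of finite mass.\<close>

lemma abel_sum_tendsto:
  assumes N: "1 \<le> N"
  shows "(\<lambda>m. abel_sum m N d (\<lambda>t. ennreal (A t))) \<longlonglongrightarrow> (\<integral>\<^sup>+t\<in>{0..real N}. d t \<partial>interval_measure A)"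
  unfolding abel_sum_eq_integral[OF N]
proof (rule nn_integral_dominated_convergence[where w = "indicator {0..real N}"])
  show "(\<lambda>t. left_step m N t * indicator {0..real N} t) \<in> borel_measurable (interval_measure A)" for m
    unfolding left_step_def by measurable
  show "(\<lambda>t. d t * indicator {0..real N} t) \<in> borel_measurable (interval_measure A)"
    using d_measurable_Icc by simp
  show "(\<integral>\<^sup>+ x. indicator {0..real N} x \<partial>interval_measure A) < \<infinity>"
    by (simp add: emeasure_Icc_incr)
  show "AE t in interval_measure A. left_step m N t * indicator {0..real N} t \<le> indicator {0..real N} t" for m
    by (rule AE_I2) (auto simp: indicator_def intro: left_step_le_1)
  show "AE t in interval_measure A. (\<lambda>m. left_step m N t * indicator {0..real N} t) \<longlonglongrightarrow> d t * indicator {0..real N} t"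
  proof (rule AE_I2)
    fix t show "(\<lambda>m. left_step m N t * indicator {0..real N} t) \<longlonglongrightarrow> d t * indicator {0..real N} t"
      using left_step_tendsto[of t N] by (cases "t \<in> {0..real N}") auto
  qed
qed simp

lemma integral_Icc_le_abel_sum:
  assumes N: "1 \<le> N"
  shows "(\<integral>\<^sup>+t\<in>{0..real N}. d t \<partial>interval_measure A) \<le> abel_sum m N d (\<lambda>t. ennreal (A t))"
  unfolding abel_sum_eq_integral[OF N]
  by (intro nn_integral_mono) (auto simp: indicator_def intro: left_step_ge)

lemma integral_Ici_SUP:
  "(\<integral>\<^sup>+t\<in>{0..}. d t \<partial>interval_measure A) = (SUP N. \<integral>\<^sup>+t\<in>{0..real (Suc N)}. d t \<partial>interval_measure A)"
proof -
  have "(\<integral>\<^sup>+t\<in>{0..}. d t \<partial>interval_measure A)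
      = (\<integral>\<^sup>+t. (SUP N. d t * indicator {0..real (Suc N)} t) \<partial>interval_measure A)"
  proof (rule nn_integral_cong)
    fix t :: real
    show "d t * indicator {0..} t = (SUP N. d t * indicator {0..real (Suc N)} t)"
    proof (cases "0 \<le> t")
      case True
      obtain N where N: "t \<le> real N" using real_arch_simple by blast
      show ?thesis
      proof (rule antisym)
        have "d t * indicator {0..} t \<le> d t * indicator {0..real (Suc N)} t"
          using True N by (simp add: indicator_def)
        also have "\<dots> \<le> (SUP N. d t * indicator {0..real (Suc N)} t)" by (rule SUP_upper) simp
        finally show "d t * indicator {0..} t \<le> (SUP N. d t * indicator {0..real (Suc N)} t)" .
        show "(SUP N. d t * indicator {0..real (Suc N)} t) \<le> d t * indicator {0..} t"
          using True by (intro SUP_least) (auto simp: indicator_def)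
      qed
    qed (simp add: indicator_def)
  qed
  also have "\<dots> = (SUP N. \<integral>\<^sup>+t\<in>{0..real (Suc N)}. d t \<partial>interval_measure A)"
  proof (rule nn_integral_monotone_convergence_SUP)
    show "incseq (\<lambda>N t. d t * indicator {0..real (Suc N)} t)"
      by (auto simp: incseq_def le_fun_def indicator_def)
    show "(\<lambda>t. d t * indicator {0..real (Suc N)} t) \<in> borel_measurable (interval_measure A)" for N
      using d_measurable_Icc[of "Suc N"] by simp
  qed
  finally show ?thesis .
qed

lemma integral_Icc_incseq: "incseq (\<lambda>N. \<integral>\<^sup>+t\<in>{0..real (Suc N)}. d t \<partial>interval_measure A)"
  by (auto simp: incseq_def indicator_def intro!: nn_integral_mono)

lemma stieltjes_eq: "stieltjes d (\<lambda>t. ennreal (A t)) = (\<integral>\<^sup>+t\<in>{0..}. d t \<partial>interval_measure A)"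
  unfolding stieltjes_def integral_Ici_SUP
  by (intro SUP_cong refl lim_imp_Liminf abel_sum_tendsto) auto

lemma stieltjes_le_bound:
  assumes "\<And>t. A t \<le> c"
  shows "stieltjes d (\<lambda>t. ennreal (A t)) \<le> ennreal c"
  unfolding stieltjes_def
proof (rule SUP_least)
  fix N
  have "liminf (\<lambda>m. abel_sum m (Suc N) d (\<lambda>t. ennreal (A t))) \<le> liminf (\<lambda>m. ennreal c)"
    by (intro Liminf_mono always_eventually allI order_trans[OF abel_sum_le] ennreal_leI assms) auto
  then show "liminf (\<lambda>m. abel_sum m (Suc N) d (\<lambda>t. ennreal (A t))) \<le> ennreal c"
    by (simp add: Liminf_const)
qed

text \<open>Left endpoints overestimate a decreasing integrand at every mesh, so mesh 1 already
  gives an upper bound, and it involves integer times only.\<close>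

lemma stieltjes_le_SUP_abel_sum:
  "stieltjes d (\<lambda>t. ennreal (A t)) \<le> (SUP N. abel_sum 0 (Suc N) d (\<lambda>t. ennreal (A t)))"
  unfolding stieltjes_eq integral_Ici_SUP
  by (intro SUP_mono' integral_Icc_le_abel_sum) simp

end

text \<open>Abel sums are linear in the integrator, so their limits, the integrals up to each
  \<open>N\<close>, add up; suprema of increasing sequences then add up too.\<close>

lemma stieltjes_add:
  assumes A: "incr_path A" and B: "incr_path B"
  shows "stieltjes d (\<lambda>t. ennreal (A t + B t))
       = stieltjes d (\<lambda>t. ennreal (A t)) + stieltjes d (\<lambda>t. ennreal (B t))"
proof -
  note AB = incr_path_add[OF A B]
  have eq: "abel_sum m N d (\<lambda>t. ennreal (A t + B t))
      = abel_sum m N d (\<lambda>t. ennreal (A t)) + abel_sum m N d (\<lambda>t. ennreal (B t))" for m N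
    unfolding abel_sum_add[symmetric]
    by (rule abel_sum_cong) (simp add: incr_path_nonneg[OF A] incr_path_nonneg[OF B])
  have Neq: "(\<integral>\<^sup>+t\<in>{0..real (Suc N)}. d t \<partial>interval_measure (\<lambda>t. A t + B t))
      = (\<integral>\<^sup>+t\<in>{0..real (Suc N)}. d t \<partial>interval_measure A) + (\<integral>\<^sup>+t\<in>{0..real (Suc N)}. d t \<partial>interval_measure B)" for N
  proof (rule LIMSEQ_unique)
    show "(\<lambda>m. abel_sum m (Suc N) d (\<lambda>t. ennreal (A t + B t))) \<longlonglongrightarrow>
      (\<integral>\<^sup>+t\<in>{0..real (Suc N)}. d t \<partial>interval_measure (\<lambda>t. A t + B t))"
      by (rule abel_sum_tendsto[OF AB]) simp
    show "(\<lambda>m. abel_sum m (Suc N) d (\<lambda>t. ennreal (A t + B t))) \<longlonglongrightarrow>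
      (\<integral>\<^sup>+t\<in>{0..real (Suc N)}. d t \<partial>interval_measure A) + (\<integral>\<^sup>+t\<in>{0..real (Suc N)}. d t \<partial>interval_measure B)"
      unfolding eq by (intro tendsto_add abel_sum_tendsto A B) auto
  qed
  show ?thesis
    unfolding stieltjes_eq[OF A] stieltjes_eq[OF B] stieltjes_eq[OF AB] integral_Ici_SUP[OF A]
      integral_Ici_SUP[OF B] integral_Ici_SUP[OF AB] Neq
    by (rule ennreal_SUP_add[OF integral_Icc_incseq[OF A] integral_Icc_incseq[OF B]])
qed

end

section \<open>Joint measurability of right-continuous processes with values in a Radon space\<close>

text \<open>Exhibits the topology of \<open>'e\<close> as induced from the metric space of real
  sequences, where limit arguments are possible.\<close>

lemma radon_embedding:
  assumes "radon_space TYPE('e::topological_space)"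
  obtains h :: "'e::topological_space \<Rightarrow> nat \<Rightarrow> real" where "inj h" "continuous_on UNIV h"
    "\<And>U. open U \<Longrightarrow> \<exists>W. open W \<and> U = h -` W"
proof -
  obtain h :: "'e \<Rightarrow> nat \<Rightarrow> real" where h: "inj h" "continuous_on UNIV h" "continuous_on (range h) (inv h)"
    using assms unfolding radon_space_def by blast
  have "\<exists>W. open W \<and> U = h -` W" if U: "open U" for U
  proof -
    from h(3) U obtain W where W: "open W" "W \<inter> range h = inv h -` U \<inter> range h"
      unfolding continuous_on_open_invariant by blast
    have "U = h -` W"
    proof (intro set_eqI iffI)
      fix x assume "x \<in> U"
      then have "h x \<in> inv h -` U \<inter> range h" using h(1) by simp
      then show "x \<in> h -` W" using W by blast
    next
      fix x assume "x \<in> h -` W"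
      then have "h x \<in> inv h -` U \<inter> range h" using W by blast
      then show "x \<in> U" using h(1) by simp
    qed
    then show ?thesis using W by blast
  qed
  with h show thesis by (intro that)
qed

text \<open>\<open>'e\<close> carries no metric, so measurability of pointwise limits is used for
  \<open>h (Y s)\<close> instead, approximated by values at dyadic times strictly to the right of
  \<open>s\<close>; open sets are then pulled back along \<open>h\<close>. \<open>max 0\<close>
  extends the process to negative times.\<close>

lemma right_cont_jointly_measurable:
  fixes Y :: "real \<Rightarrow> 'w \<Rightarrow> 'e::topological_space"
  assumes radon: "radon_space TYPE('e)"
    and Y: "\<And>t. 0 \<le> t \<Longrightarrow> Y t \<in> measurable N borel"
    and rc: "\<And>\<omega> t. \<omega> \<in> space N \<Longrightarrow> 0 \<le> t \<Longrightarrow> continuous (at_right t) (\<lambda>s. Y s \<omega>)"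
  shows "(\<lambda>(\<omega>, s). Y (max 0 s) \<omega>) \<in> measurable (N \<Otimes>\<^sub>M (borel :: real measure)) borel"
proof -
  obtain h :: "'e \<Rightarrow> nat \<Rightarrow> real" where h: "inj h" "continuous_on UNIV h"
    and hU: "\<And>U. open U \<Longrightarrow> \<exists>W. open W \<and> U = h -` W"
    using radon_embedding[OF radon] by metis
  have hm: "h \<in> borel_measurable borel" using h(2) by (rule borel_measurable_continuous_onI)
  have joint: "(\<lambda>(\<omega>, s). h (Y (max 0 s) \<omega>)) \<in> borel_measurable (N \<Otimes>\<^sub>M (borel :: real measure))"
  proof (rule borel_measurable_LIMSEQ_metric)
    fix m :: nat
    have f: "(\<lambda>p. h (Y (real (Suc k) / 2 ^ m) (fst p))) \<in> borel_measurable (N \<Otimes>\<^sub>M (borel :: real measure))" for k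
      by (rule measurable_compose[OF measurable_fst measurable_compose[OF Y hm]]) simp
    have g: "(\<lambda>p. grid_index m (max 0 (snd p))) \<in> measurable (N \<Otimes>\<^sub>M (borel :: real measure)) (count_space UNIV)"
      unfolding grid_index_def by measurable
    show "(\<lambda>p. h (Y (real (Suc (grid_index m (max 0 (snd p)))) / 2 ^ m) (fst p)))
        \<in> borel_measurable (N \<Otimes>\<^sub>M (borel :: real measure))"
      by (rule measurable_compose_countable[OF f g])
  next
    fix p :: "'w \<times> real" assume "p \<in> space (N \<Otimes>\<^sub>M (borel :: real measure))"
    then have \<omega>: "fst p \<in> space N" by (auto simp: space_pair_measure)
    define s where "s = max 0 (snd p)"
    define u where "u m = real (Suc (grid_index m s)) / 2 ^ m" for m
    have s0: "0 \<le> s" by (simp add: s_def)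
    have u: "s < u m \<and> u m \<le> s + (1/2) ^ m" for m
    proof -
      have "0 \<le> s * 2 ^ m" using s0 by simp
      then have "real (grid_index m s) = of_int \<lfloor>s * 2 ^ m\<rfloor>" unfolding grid_index_def by simp
      then have "s * 2 ^ m < real (Suc (grid_index m s))" "real (Suc (grid_index m s)) \<le> s * 2 ^ m + 1"
        by simp_all linarith
      then show ?thesis by (simp add: u_def field_simps power_divide del: of_nat_Suc)
    qed
    have "(\<lambda>m. s + (1/2) ^ m) \<longlonglongrightarrow> s + 0"
      by (intro tendsto_add tendsto_const LIMSEQ_realpow_zero) auto
    then have "u \<longlonglongrightarrow> s"
      by (intro tendsto_sandwich[of "\<lambda>_. s" u sequentially "\<lambda>m. s + (1/2)^m"])
         (use u in \<open>auto intro!: always_eventually less_imp_le\<close>)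
    then have ul: "filterlim u (at_right s) sequentially"
      unfolding filterlim_at using u by (auto intro!: always_eventually)
    have "((\<lambda>r. Y r (fst p)) \<longlongrightarrow> Y s (fst p)) (at_right s)"
      using rc[OF \<omega> s0] by (simp add: continuous_within)
    then have "((\<lambda>r. h (Y r (fst p))) \<longlongrightarrow> h (Y s (fst p))) (at_right s)"
      by (rule continuous_on_tendsto_compose[OF h(2)]) simp_all
    from filterlim_compose[OF this ul]
    show "(\<lambda>m. h (Y (real (Suc (grid_index m (max 0 (snd p)))) / 2 ^ m) (fst p)))
        \<longlonglongrightarrow> (case p of (\<omega>, s) \<Rightarrow> h (Y (max 0 s) \<omega>))"
      by (simp add: u_def s_def case_prod_beta del: of_nat_Suc)
  qed
  show ?thesis
  proof (rule borel_measurableI)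
    fix U :: "'e set" assume "open U"
    then obtain W where W: "open W" "U = h -` W" using hU by blast
    have "(\<lambda>(\<omega>, s). Y (max 0 s) \<omega>) -` U \<inter> space (N \<Otimes>\<^sub>M (borel :: real measure))
       = (\<lambda>(\<omega>, s). h (Y (max 0 s) \<omega>)) -` W \<inter> space (N \<Otimes>\<^sub>M (borel :: real measure))"
      unfolding W(2) by auto
    also have "\<dots> \<in> sets (N \<Otimes>\<^sub>M (borel :: real measure))"
      using joint W(1) by (intro measurable_sets[OF joint]) simp
    finally show "(\<lambda>(\<omega>, s). Y (max 0 s) \<omega>) -` U \<inter> space (N \<Otimes>\<^sub>M (borel :: real measure))
        \<in> sets (N \<Otimes>\<^sub>M (borel :: real measure))" .
  qed
qed

section \<open>The discount factor\<close>

definition discount :: "ennreal \<Rightarrow> ennreal" where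
  "discount v = (if v = \<top> then 0 else ennreal (exp (- enn2real v)))"

lemma disc_eq: "disc qf Y t \<omega> = discount (frakq qf Y t \<omega>)"
  by (simp add: disc_def discount_def)

lemma discount_measurable [measurable]: "discount \<in> borel_measurable borel"
  unfolding discount_def by measurable

lemma discount_le_1: "discount v \<le> 1"
  by (auto simp: discount_def ennreal_le_1)

lemma discount_anti: "u \<le> v \<Longrightarrow> discount v \<le> discount u"
  by (auto simp: discount_def top_unique intro!: ennreal_leI enn2real_mono) (simp add: less_top)

text \<open>The bound by \<open>v\<close> keeps all values finite when \<open>v\<close> is, and
  there \<open>discount\<close> is a continuous exponential. For infinite \<open>v\<close> the
  exponential of \<open>- K\<close> is arbitrarily small.\<close>

lemma discount_tendsto:
  assumes u: "(u \<longlongrightarrow> v) \<F>" and le: "\<And>t. u t \<le> v"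
  shows "((\<lambda>t. discount (u t)) \<longlongrightarrow> discount v) \<F>"
proof (cases "v = \<top>")
  case False
  then have "u t \<noteq> \<top>" for t using le[of t] by (auto simp: top_unique)
  then have "(\<lambda>t. discount (u t)) = (\<lambda>t. ennreal (exp (- enn2real (u t))))"
    by (simp add: discount_def)
  moreover have "((\<lambda>t. ennreal (exp (- enn2real (u t)))) \<longlongrightarrow> ennreal (exp (- enn2real v))) \<F>"
    using False u by (intro tendsto_ennrealI tendsto_exp tendsto_minus tendsto_enn2real) (auto simp: less_top)
  ultimately show ?thesis using False by (simp add: discount_def)
next
  case True
  have "((\<lambda>t. discount (u t)) \<longlongrightarrow> 0) \<F>"
  proof (rule order_tendstoI)
    fix a :: ennreal assume a: "0 < a"
    obtain K :: real where K: "0 \<le> K" "ennreal (exp (- K)) < a"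
    proof (cases "a = \<top>")
      case True
      then show ?thesis by (intro that[of 0]) auto
    next
      case False
      then have "0 < enn2real a" "ennreal (enn2real a) = a" using a by (auto simp: enn2real_positive_iff less_top)
      moreover obtain K where "exp (- K) < enn2real a" "0 \<le> K"
      proof -
        \<comment> \<open>One more than \<open>- ln a\<close> makes the exponential strictly
          smaller; \<open>max 0\<close> keeps the witness non-negative.\<close>
        have "exp (- (max 0 (- ln (enn2real a)) + 1)) < exp (ln (enn2real a))" by simp
        then show ?thesis using \<open>0 < enn2real a\<close> by (intro that[of "max 0 (- ln (enn2real a)) + 1"]) auto
      qed
      ultimately show ?thesis by (intro that[of K]) (auto intro: ennreal_lessI, metis ennreal_lessI)
    qed
    have "\<forall>\<^sub>F t in \<F>. ennreal K < u t" using order_tendstoD(1)[OF u, of "ennreal K"] True by simp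
    then show "\<forall>\<^sub>F t in \<F>. discount (u t) < a"
    proof eventually_elim
      case (elim t)
      then have "discount (u t) \<le> discount (ennreal K)" by (intro discount_anti) simp
      also have "\<dots> < a" using K by (simp add: discount_def)
      finally show ?case .
    qed
  qed simp
  then show ?thesis using True by (simp add: discount_def)
qed

text \<open>Monotone convergence from the left, valid even for infinite integrals; the endpoint
  \<open>t\<close> is Lebesgue null.\<close>

lemma frakq_left_cont:
  fixes Y :: "real \<Rightarrow> 'w \<Rightarrow> 'e"
  assumes m: "(\<lambda>s. ennreal (qf (Y (max 0 s) \<omega>))) \<in> borel_measurable borel" and t: "0 < t"
  shows "((\<lambda>t. frakq qf Y t \<omega>) \<longlongrightarrow> frakq qf Y t \<omega>) (at_left t)"
proof (rule tendsto_at_left_sequentially[of 0 t])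
  fix S :: "nat \<Rightarrow> real"
  assume S: "\<And>n. S n < t" "\<And>n. 0 < S n" "incseq S" "S \<longlonglongrightarrow> t"
  define f where "f s = ennreal (qf (Y (max 0 s) \<omega>))" for s
  have fq: "frakq qf Y u \<omega> = (\<integral>\<^sup>+s. f s * indicator {0..u} s \<partial>lborel)" for u
    unfolding frakq_def f_def by (rule nn_integral_cong) (simp add: indicator_def max_def)
  have fm: "f \<in> borel_measurable borel" using m by (simp add: f_def[abs_def])
  have "(\<lambda>n. \<integral>\<^sup>+s. f s * indicator {0..S n} s \<partial>lborel) \<longlonglongrightarrow> (\<integral>\<^sup>+s. f s * indicator {0..<t} s \<partial>lborel)"
  proof (rule nn_integral_LIMSEQ)
    show "incseq (\<lambda>n s. f s * indicator {0..S n} s)"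
      using S(3) by (auto simp: incseq_def le_fun_def indicator_def) (meson order_trans)
    show "(\<lambda>s. f s * indicator {0..S n} s) \<in> borel_measurable lborel" for n using fm by measurable
    show "(\<lambda>n. f s * indicator {0..S n} s) \<longlonglongrightarrow> f s * indicator {0..<t} s" for s
    proof (cases "0 \<le> s \<and> s < t")
      case True
      then have "\<forall>\<^sub>F n in sequentially. s < S n" using order_tendstoD(1)[OF S(4), of s] by simp
      then have "\<forall>\<^sub>F n in sequentially. f s * indicator {0..S n} s = f s * indicator {0..<t} s"
        by eventually_elim (use True in simp)
      then show ?thesis by (rule tendsto_eventually)
    next
      case False
      then have z: "f s * indicator {0..S n} s = 0" "f s * indicator {0..<t} s = 0" for n
        using S(1)[of n] by (auto simp: indicator_def)
      show ?thesis unfolding z by (rule tendsto_const)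
    qed
  qed
  also have "(\<integral>\<^sup>+s. f s * indicator {0..<t} s \<partial>lborel) = (\<integral>\<^sup>+s. f s * indicator {0..t} s \<partial>lborel)"
    by (rule nn_integral_cong_AE, use AE_lborel_singleton[of t] in eventually_elim) (auto simp: indicator_def)
  finally show "(\<lambda>n. frakq qf Y (S n) \<omega>) \<longlonglongrightarrow> frakq qf Y t \<omega>" by (simp add: fq)
qed (use t in auto)

lemma frakq_mono: "s \<le> t \<Longrightarrow> frakq qf Y s \<omega> \<le> frakq qf Y t \<omega>"
  unfolding frakq_def by (intro nn_integral_mono) (auto simp: indicator_def)

lemma disc_stieltjes_integrand:
  fixes Y :: "real \<Rightarrow> 'w \<Rightarrow> 'e"
  assumes m: "(\<lambda>s. ennreal (qf (Y (max 0 s) \<omega>))) \<in> borel_measurable borel"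
  shows "stieltjes_integrand (\<lambda>t. disc qf Y t \<omega>)"
proof
  show "disc qf Y t \<omega> \<le> 1" for t by (simp add: disc_eq discount_le_1)
  show "disc qf Y t \<omega> \<le> disc qf Y s \<omega>" if "s \<le> t" for s t
    using that by (auto simp: disc_eq intro: discount_anti frakq_mono)
  fix t :: real assume t: "0 < t"
  \<comment> \<open>Stopping at \<open>t\<close> provides the bound that
    \<open>discount_tendsto\<close> requires at all arguments, and changes nothing to the left of
    \<open>t\<close>.\<close>
  define v where "v s = frakq qf Y (min s t) \<omega>" for s
  have fl: "((\<lambda>s. frakq qf Y s \<omega>) \<longlongrightarrow> frakq qf Y t \<omega>) (at_left t)"
    by (rule frakq_left_cont[where qf = qf and Y = Y, OF m t])
  have ev: "\<forall>\<^sub>F s in at_left t. min s t = s" by (simp add: eventually_at_filter)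
  then have "\<forall>\<^sub>F s in at_left t. frakq qf Y s \<omega> = v s" by eventually_elim (simp add: v_def)
  with fl have "(v \<longlongrightarrow> frakq qf Y t \<omega>) (at_left t)" by (rule Lim_transform_eventually)
  then have dl: "((\<lambda>s. discount (v s)) \<longlongrightarrow> disc qf Y t \<omega>) (at_left t)"
    unfolding disc_eq by (rule discount_tendsto) (simp add: v_def frakq_mono)
  from ev have "\<forall>\<^sub>F s in at_left t. discount (v s) = disc qf Y s \<omega>"
    by eventually_elim (simp add: v_def disc_eq)
  with dl show "((\<lambda>s. disc qf Y s \<omega>) \<longlongrightarrow> disc qf Y t \<omega>) (at_left t)"
    by (rule Lim_transform_eventually)
qed

lemma disc_le_exp:
  assumes "\<And>e. q < qf e" "0 \<le> t" "0 < q"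
  shows "disc qf Y t \<omega> \<le> ennreal (exp (- q * t))"
proof -
  have "ennreal (q * t) = (\<integral>\<^sup>+s. ennreal q * indicator {0..t} s \<partial>lborel)"
    using assms by (simp add: nn_integral_cmult_indicator ennreal_mult)
  also have "\<dots> \<le> frakq qf Y t \<omega>"
    unfolding frakq_def by (intro nn_integral_mono) (auto simp: indicator_def intro!: ennreal_leI assms(1)[THEN less_imp_le])
  finally have "discount (frakq qf Y t \<omega>) \<le> discount (ennreal (q * t))" by (rule discount_anti)
  then show ?thesis using assms by (simp add: disc_eq discount_def)
qed

section \<open>The controlled model and measurability of its discount factor\<close>

locale bailout =
  fixes M :: "'w measure" and F :: "real \<Rightarrow> 'w measure"
    and P :: "real \<times> 'e::topological_space \<Rightarrow> 'w measure"
    and X :: "real \<Rightarrow> 'w \<Rightarrow> real" and Y :: "real \<Rightarrow> 'w \<Rightarrow> 'e"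
    and \<theta> :: "real \<Rightarrow> 'w \<Rightarrow> 'w"
    and q :: real and qf :: "'e \<Rightarrow> real" and \<beta> :: real
  assumes radon: "radon_space TYPE('e)"
    and rp: "right_process M F P (\<lambda>t \<omega>. (X t \<omega>, Y t \<omega>)) \<theta>"
    and X_cadlag: "\<forall>\<omega>\<in>space M. \<forall>t>0. \<exists>l. ((\<lambda>s. X s \<omega>) \<longlongrightarrow> l) (at_left t)"
    and homog: "\<And>(f :: real \<times> 'e \<Rightarrow> ennreal) t x y. f \<in> borel_measurable borel \<Longrightarrow> 0 \<le> t \<Longrightarrow>
        (\<integral>\<^sup>+\<omega>. f (X t \<omega>, Y t \<omega>) \<partial>P (x, y)) = (\<integral>\<^sup>+\<omega>. f (X t \<omega> + x, Y t \<omega>) \<partial>P (0, y))"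
    and sup_bound: "\<exists>C<\<top>. \<forall>y. (\<integral>\<^sup>+\<omega>. (SUP s\<in>{0..1}. ennreal \<bar>X s \<omega>\<bar>) \<partial>P (0, y)) \<le> C"
    and q_pos: "q > 0"
    and qf_meas: "qf \<in> borel_measurable borel"
    and qf_gt: "\<forall>e. qf e > q"
    and beta: "\<beta> > 1"
begin

sublocale right_proc M F P "\<lambda>t \<omega>. (X t \<omega>, Y t \<omega>)" \<theta>
  using rp by unfold_locales

lemma fst_borel [measurable]: "(fst :: real \<times> 'e \<Rightarrow> real) \<in> borel_measurable borel"
  by (rule borel_measurable_continuous_onI) (intro continuous_intros)

lemma snd_borel [measurable]: "(snd :: real \<times> 'e \<Rightarrow> 'e) \<in> borel_measurable borel"
  by (rule borel_measurable_continuous_onI) (intro continuous_intros)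

lemma X_meas_F: "0 \<le> t \<Longrightarrow> X t \<in> borel_measurable (F t)"
  using measurable_compose[OF Z_meas_F fst_borel, of t] by simp

lemma X_meas: "0 \<le> t \<Longrightarrow> X t \<in> borel_measurable M"
  using measurable_compose[OF Z_meas fst_borel, of t] by simp

lemma Y_meas: "0 \<le> t \<Longrightarrow> Y t \<in> borel_measurable M"
  using measurable_compose[OF Z_meas snd_borel, of t] by simp

lemma X_right_cont: "\<omega> \<in> space M \<Longrightarrow> 0 \<le> t \<Longrightarrow> continuous (at_right t) (\<lambda>s. X s \<omega>)"
  by (drule (1) continuous_fst[OF Z_right_cont]) (simp only: fst_conv)

lemma Y_right_cont: "\<omega> \<in> space M \<Longrightarrow> 0 \<le> t \<Longrightarrow> continuous (at_right t) (\<lambda>s. Y s \<omega>)"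
  by (drule (1) continuous_snd[OF Z_right_cont]) (simp only: snd_conv)

lemma X_bdd: "\<omega> \<in> space M \<Longrightarrow> \<exists>B. \<forall>s\<in>{0..t}. \<bar>X s \<omega>\<bar> \<le> B"
  by (rule cadlag_bdd) (simp_all add: X_right_cont X_cadlag)

definition SY :: "(real \<Rightarrow> 'e) measure" where "SY = Pi\<^sub>M {0..} (\<lambda>_. borel)"

definition Ytraj :: "'w \<Rightarrow> real \<Rightarrow> 'e" where "Ytraj \<omega> = (\<lambda>t\<in>{0..}. Y t \<omega>)"

abbreviation D :: "real \<Rightarrow> 'w \<Rightarrow> ennreal" where "D t \<omega> \<equiv> disc qf Y t \<omega>"

abbreviation disc_int :: "(real \<Rightarrow> 'w \<Rightarrow> real) \<Rightarrow> 'w \<Rightarrow> ennreal" where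
  "disc_int A \<omega> \<equiv> stieltjes (\<lambda>t. D t \<omega>) (\<lambda>t. ennreal (A t \<omega>))"

abbreviation expected_disc :: "real \<times> 'e \<Rightarrow> (real \<Rightarrow> 'w \<Rightarrow> real) \<Rightarrow> ennreal" where
  "expected_disc z A \<equiv> (\<integral>\<^sup>+\<omega>. disc_int A \<omega> \<partial>P z)"

lemma Ytraj_space: "Ytraj \<in> space M \<rightarrow> space SY"
  by (auto simp: Ytraj_def SY_def space_PiM)

lemma qf_joint:
  assumes N: "space N = space M" "\<And>t. 0 \<le> t \<Longrightarrow> Y t \<in> measurable N borel"
  shows "(\<lambda>(\<omega>, s). ennreal (qf (Y (max 0 s) \<omega>))) \<in> borel_measurable (N \<Otimes>\<^sub>M (borel :: real measure))"
proof -
  have "(\<lambda>(\<omega>, s). Y (max 0 s) \<omega>) \<in> measurable (N \<Otimes>\<^sub>M (borel :: real measure)) borel"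
    by (rule right_cont_jointly_measurable[OF radon N(2)]) (use N(1) Y_right_cont in auto)
  from measurable_compose[OF this, of "\<lambda>e. ennreal (qf e)" borel] qf_meas
  show ?thesis by (simp add: case_prod_beta)
qed

lemma D_measurable:
  assumes N: "space N = space M" "\<And>t. 0 \<le> t \<Longrightarrow> Y t \<in> measurable N borel"
  shows "D t \<in> borel_measurable N"
proof -
  note J = qf_joint[OF N]
  have "(\<lambda>\<omega>. \<integral>\<^sup>+s. ennreal (qf (Y (max 0 s) \<omega>)) * indicator {0..t} s \<partial>lborel) \<in> borel_measurable N"
  proof (rule lborel.borel_measurable_nn_integral)
    have "(\<lambda>p. (case p of (\<omega>, s) \<Rightarrow> ennreal (qf (Y (max 0 s) \<omega>))) * indicator {0..t} (snd p))
       \<in> borel_measurable (N \<Otimes>\<^sub>M (borel :: real measure))"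
      by (intro borel_measurable_times_ennreal J) measurable
    then show "(\<lambda>(\<omega>, s). ennreal (qf (Y (max 0 s) \<omega>)) * indicator {0..t} s) \<in> borel_measurable (N \<Otimes>\<^sub>M lborel)"
      by (simp add: case_prod_beta cong: measurable_cong_sets sets_pair_measure_cong)
  qed
  moreover have "(\<lambda>\<omega>. \<integral>\<^sup>+s. ennreal (qf (Y (max 0 s) \<omega>)) * indicator {0..t} s \<partial>lborel) = frakq qf Y t"
    unfolding frakq_def by (intro ext nn_integral_cong) (simp add: indicator_def max_def)
  ultimately have "frakq qf Y t \<in> borel_measurable N" by simp
  from measurable_compose[OF this discount_measurable] show ?thesis by (simp add: disc_eq)
qed

lemma D_integrand: "\<omega> \<in> space M \<Longrightarrow> stieltjes_integrand (\<lambda>t. D t \<omega>)"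
proof (rule disc_stieltjes_integrand)
  assume \<omega>: "\<omega> \<in> space M"
  have "(\<lambda>s. (\<omega>, s)) \<in> measurable borel (M \<Otimes>\<^sub>M (borel :: real measure))"
    using \<omega> by (intro measurable_Pair measurable_const measurable_ident_sets) auto
  from measurable_compose[OF this qf_joint[OF refl Y_meas]]
  show "(\<lambda>s. ennreal (qf (Y (max 0 s) \<omega>))) \<in> borel_measurable borel" by simp
qed

lemma D_le_exp: "0 \<le> t \<Longrightarrow> D t \<omega> \<le> ennreal (exp (- q * t))"
  using qf_gt q_pos by (intro disc_le_exp) auto

text \<open>\<open>D_measurable\<close> only asks that the variables \<open>Y s\<close> be
  measurable, so it applies to the algebra generated by the path of \<open>Y\<close>, and
  Doob-Dynkin gives the factor.\<close>

lemma D_factor: "\<exists>\<phi>. \<phi> \<in> borel_measurable SY \<and> (\<forall>\<omega>\<in>space M. D t \<omega> = \<phi> (Ytraj \<omega>))"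
proof -
  define G where "G = vimage_algebra (space M) Ytraj SY"
  have "D t \<in> borel_measurable G"
  proof (rule D_measurable)
    show "space G = space M" by (simp add: G_def)
    fix s :: real assume s: "0 \<le> s"
    have "(\<lambda>\<omega>. Ytraj \<omega> s) \<in> measurable G borel"
      unfolding G_def
      by (rule measurable_compose[OF measurable_vimage_algebra1[OF Ytraj_space]])
         (use s in \<open>simp add: SY_def measurable_component_singleton\<close>)
    then show "Y s \<in> measurable G borel" using s by (simp add: Ytraj_def)
  qed
  from doob_dynkin_ennreal[OF this[unfolded G_def] Ytraj_space] show ?thesis by blast
qed

text \<open>A fixed choice of this factor. Reading \<open>Y\<close> alone, it is invariant under
  translations of \<open>X\<close>.\<close>

definition Dfun :: "real \<Rightarrow> (real \<Rightarrow> 'e) \<Rightarrow> ennreal" where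
  "Dfun t = (SOME \<phi>. \<phi> \<in> borel_measurable SY \<and> (\<forall>\<omega>\<in>space M. D t \<omega> = \<phi> (Ytraj \<omega>)))"

lemma Dfun_meas: "Dfun t \<in> borel_measurable SY"
  and Dfun_eq: "\<omega> \<in> space M \<Longrightarrow> D t \<omega> = Dfun t (Ytraj \<omega>)"
proof -
  have "Dfun t \<in> borel_measurable SY \<and> (\<forall>\<omega>\<in>space M. D t \<omega> = Dfun t (Ytraj \<omega>))"
    unfolding Dfun_def by (rule someI_ex[OF D_factor])
  then show "Dfun t \<in> borel_measurable SY" "\<omega> \<in> space M \<Longrightarrow> D t \<omega> = Dfun t (Ytraj \<omega>)"
    by blast+
qed

section \<open>Spatial homogeneity of the path law\<close>

definition shift1 :: "real \<Rightarrow> real \<times> 'e \<Rightarrow> real \<times> 'e" where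
  "shift1 x z = (fst z + x, snd z)"

definition shift :: "real \<Rightarrow> (real \<Rightarrow> real \<times> 'e) \<Rightarrow> real \<Rightarrow> real \<times> 'e" where
  "shift x w = (\<lambda>t\<in>{0..}. shift1 x (w t))"

definition Ypart :: "(real \<Rightarrow> real \<times> 'e) \<Rightarrow> real \<Rightarrow> 'e" where
  "Ypart w = (\<lambda>t\<in>{0..}. snd (w t))"

lemma shift1_meas: "shift1 x \<in> measurable borel borel"
  unfolding shift1_def by (rule borel_measurable_continuous_onI) (intro continuous_intros)

lemma shift_meas: "shift x \<in> measurable S S"
  unfolding shift_def
  by (rule measurable_restrict) (rule measurable_compose[OF coord_meas shift1_meas], simp)

lemma Ypart_meas: "Ypart \<in> measurable S SY"
  unfolding Ypart_def SY_def
  by (rule measurable_restrict) (rule measurable_compose[OF coord_meas snd_borel], simp)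

lemma Ypart_traj: "Ypart (traj \<omega>) = Ytraj \<omega>" and Ypart_shift: "Ypart (shift x w) = Ypart w"
  by (simp_all add: Ypart_def traj_def Ytraj_def shift_def shift1_def fun_eq_iff)

text \<open>The functions of the state met in \<open>homog_fin\<close> are expectations, hence only
  universally measurable. Homogeneity for the indicator of the exceptional set shows that it is null
  for the translated law as well.\<close>

lemma homog_univ:
  fixes f :: "real \<times> 'e \<Rightarrow> ennreal"
  assumes f: "univ_measurable_fun f" and t: "0 \<le> t"
  shows "(\<integral>\<^sup>+\<omega>. f (X t \<omega>, Y t \<omega>) \<partial>P (x, y)) = (\<integral>\<^sup>+\<omega>. f (shift1 x (X t \<omega>, Y t \<omega>)) \<partial>P (0, y))"
proof -
  have homog': "(\<integral>\<^sup>+\<omega>. g (X t \<omega>, Y t \<omega>) \<partial>P (x, y)) = (\<integral>\<^sup>+\<omega>. g (shift1 x (X t \<omega>, Y t \<omega>)) \<partial>P (0, y))"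
    if "g \<in> borel_measurable borel" for g :: "real \<times> 'e \<Rightarrow> ennreal"
    using homog[OF that t] by (simp add: shift1_def)
  let ?Z = "\<lambda>\<omega>. (X t \<omega>, Y t \<omega>)"
  have Zm: "?Z \<in> measurable (P z) borel" for z by (rule M_measD[OF Z_meas[OF t]])
  interpret Pz: prob_space "P (x, y)" by (rule prob_space_P)
  interpret Dz: prob_space "distr (P (x, y)) borel ?Z" by (rule Pz.prob_space_distr[OF Zm])
  have "f \<in> borel_measurable (completion (distr (P (x, y)) borel ?Z))"
    using f unfolding univ_measurable_fun_def by (auto intro: Dz.finite_measure_axioms)
  from completion_ex_borel_measurable[OF this]
  obtain f' where f'': "f' \<in> borel_measurable (distr (P (x, y)) borel ?Z)"
    and ae: "AE z in distr (P (x, y)) borel ?Z. f z = f' z"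
    by blast
  from f'' have f': "f' \<in> borel_measurable borel" by simp
  from AE_E[OF ae] obtain N where "{z \<in> space (distr (P (x, y)) borel ?Z). f z \<noteq> f' z} \<subseteq> N"
    and N0: "emeasure (distr (P (x, y)) borel ?Z) N = 0" and "N \<in> sets (distr (P (x, y)) borel ?Z)"
    by blast
  then have N: "{z. f z \<noteq> f' z} \<subseteq> N" "N \<in> sets borel" by (simp_all only: space_distr space_borel sets_distr UNIV_I simp_thms)
  have N': "f z = f' z" if "z \<notin> N" for z using N(1) that by blast
  have "(\<integral>\<^sup>+\<omega>. indicator N (?Z \<omega>) \<partial>P (x, y)) = (\<integral>\<^sup>+z. indicator N z \<partial>distr (P (x, y)) borel ?Z)"
    by (rule nn_integral_distr[symmetric, OF Zm]) (use N in simp)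
  also have "\<dots> = 0" using N N0 by simp
  finally have "(\<integral>\<^sup>+\<omega>. indicator N (?Z \<omega>) \<partial>P (x, y)) = 0" .
  then have "(\<integral>\<^sup>+\<omega>. indicator N (shift1 x (?Z \<omega>)) \<partial>P (0, y)) = 0"
    using homog'[of "indicator N"] N by simp
  moreover have "(\<lambda>\<omega>. indicator N (shift1 x (?Z \<omega>)) :: ennreal) \<in> borel_measurable (P (0, y))"
    by (rule measurable_compose[OF measurable_compose[OF Zm shift1_meas]]) (use N in simp)
  ultimately have "AE \<omega> in P (0, y). (indicator N (shift1 x (?Z \<omega>)) :: ennreal) = 0"
    by (simp add: nn_integral_0_iff_AE)
  then have ae0: "AE \<omega> in P (0, y). f (shift1 x (?Z \<omega>)) = f' (shift1 x (?Z \<omega>))"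
    by eventually_elim (simp add: N' indicator_eq_0_iff)
  have "(\<integral>\<^sup>+\<omega>. f (?Z \<omega>) \<partial>P (x, y)) = (\<integral>\<^sup>+\<omega>. f' (?Z \<omega>) \<partial>P (x, y))"
    using AE_distrD[OF Zm ae] by (rule nn_integral_cong_AE)
  also have "\<dots> = (\<integral>\<^sup>+\<omega>. f' (shift1 x (?Z \<omega>)) \<partial>P (0, y))" by (rule homog'[OF f'])
  also have "\<dots> = (\<integral>\<^sup>+\<omega>. f (shift1 x (?Z \<omega>)) \<partial>P (0, y))"
    by (rule nn_integral_cong_AE) (use ae0 in auto)
  finally show ?thesis .
qed

text \<open>The Markov property at the earliest time removes one time. The induction has to range
  over all starting points, since the process restarts from a random state.\<close>

lemma homog_fin:
  fixes f :: "real \<Rightarrow> real \<times> 'e \<Rightarrow> ennreal"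
  assumes "finite J" "J \<subseteq> {0..}" "\<And>j. j \<in> J \<Longrightarrow> f j \<in> borel_measurable borel"
  shows "(\<integral>\<^sup>+\<omega>. (\<Prod>j\<in>J. f j (X j \<omega>, Y j \<omega>)) \<partial>P (x, y))
       = (\<integral>\<^sup>+\<omega>. (\<Prod>j\<in>J. f j (shift1 x (X j \<omega>, Y j \<omega>))) \<partial>P (0, y))"
  using assms
proof (induction "card J" arbitrary: J f x y)
  case 0
  then show ?case using prob_space.emeasure_space_1[OF prob_space_P] by simp
next
  case (Suc n)
  define s where "s = Min J"
  have Jne: "J \<noteq> {}" using Suc by auto
  have sJ: "s \<in> J" "\<And>j. j \<in> J \<Longrightarrow> s \<le> j" using Suc.prems Jne by (auto simp: s_def)
  have s0: "0 \<le> s" using sJ Suc.prems by auto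
  define J' where "J' = (\<lambda>j. j - s) ` (J - {s})"
  have inj: "inj_on (\<lambda>j. j - s) (J - {s})" by (auto simp: inj_on_def)
  have J': "finite J'" "J' \<subseteq> {0..}" "n = card J'"
    using Suc.prems Suc.hyps sJ by (auto simp: J'_def card_image[OF inj])
  let ?Z = "\<lambda>t \<omega>. (X t \<omega>, Y t \<omega>)"
  have step: "(\<integral>\<^sup>+\<omega>. (\<Prod>j\<in>J. g j (?Z j \<omega>)) \<partial>P z)
      = (\<integral>\<^sup>+\<omega>. g s (?Z s \<omega>) * (\<integral>\<^sup>+\<omega>'. (\<Prod>j\<in>J'. g (j + s) (?Z j \<omega>')) \<partial>P (?Z s \<omega>)) \<partial>P z)"
    if g: "\<And>j. j \<in> J \<Longrightarrow> g j \<in> borel_measurable borel" for g z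
  proof -
    have "(\<Prod>j\<in>J. g j (?Z j \<omega>)) = g s (?Z s \<omega>) * (\<Prod>j\<in>J'. g (j + s) (?Z (s + j) \<omega>))" for \<omega>
      unfolding J'_def prod.reindex[OF inj]
      by (subst prod.remove[OF Suc.prems(1) sJ(1)]) simp
    moreover have "g (j + s) \<in> borel_measurable borel" if "j \<in> J'" for j
      using g that by (auto simp: J'_def)
    ultimately show ?thesis
      by (simp only:) (rule markov_fin[where f = "\<lambda>j. g (j + s)", OF J'(1,2) _ s0
          measurable_compose[OF Z_meas_F[OF s0] g[OF sJ(1)]]])
  qed
  define G where "G w = (\<integral>\<^sup>+\<omega>'. (\<Prod>j\<in>J'. f (j + s) (?Z j \<omega>')) \<partial>P w)" for w
  define Gx where "Gx w = (\<integral>\<^sup>+\<omega>'. (\<Prod>j\<in>J'. f (j + s) (shift1 x (?Z j \<omega>'))) \<partial>P w)" for w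
  have fJ': "f (j + s) \<in> borel_measurable borel" if "j \<in> J'" for j
    using Suc.prems(3) that by (auto simp: J'_def)
  have Guniv: "univ_measurable_fun G"
    unfolding G_def
    by (rule univ_expectation) (use Z_prod_meas[of J' 0 "\<lambda>j. f (j + s)"] J' fJ' in auto)
  have fs: "f s \<in> borel_measurable borel" using Suc.prems sJ by auto
  have fG: "univ_measurable_fun (\<lambda>w. f s w * G w)"
    by (intro univ_measurable_fun_mult Guniv univ_measurable_fun_borel fs)
  \<comment> \<open>Translating the state is translating the path: the induction hypothesis refers
    the starting points \<open>a + x\<close> and \<open>a\<close> to the common origin 0.\<close>
  have Geq: "G (shift1 x w) = Gx w" for w
  proof -
    obtain a b where w: "w = (a, b)" by (cases w)
    have "G (shift1 x w) = (\<integral>\<^sup>+\<omega>. (\<Prod>j\<in>J'. f (j + s) (shift1 (a + x) (?Z j \<omega>))) \<partial>P (0, b))"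
      unfolding w G_def shift1_def[of x] fst_conv snd_conv
      by (rule Suc.hyps(1)[OF J'(3,1,2) fJ'])
    also have "\<dots> = (\<integral>\<^sup>+\<omega>. (\<Prod>j\<in>J'. f (j + s) (shift1 x (shift1 a (?Z j \<omega>)))) \<partial>P (0, b))"
      by (simp add: shift1_def add.assoc)
    also have "\<dots> = Gx w"
      unfolding w Gx_def
      by (rule Suc.hyps(1)[OF J'(3,1,2), symmetric]) (rule measurable_compose[OF shift1_meas fJ'])
    finally show ?thesis .
  qed
  have "(\<integral>\<^sup>+\<omega>. (\<Prod>j\<in>J. f j (?Z j \<omega>)) \<partial>P (x, y)) = (\<integral>\<^sup>+\<omega>. f s (?Z s \<omega>) * G (?Z s \<omega>) \<partial>P (x, y))"
    unfolding G_def by (rule step) (use Suc.prems in auto)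
  also have "\<dots> = (\<integral>\<^sup>+\<omega>. f s (shift1 x (?Z s \<omega>)) * Gx (?Z s \<omega>) \<partial>P (0, y))"
    using homog_univ[OF fG s0] by (simp add: Geq)
  also have "\<dots> = (\<integral>\<^sup>+\<omega>. (\<Prod>j\<in>J. f j (shift1 x (?Z j \<omega>))) \<partial>P (0, y))"
    unfolding Gx_def
    by (rule step[of "\<lambda>j z. f j (shift1 x z)", symmetric])
       (rule measurable_compose[OF shift1_meas Suc.prems(3)])
  finally show ?case .
qed

lemma traj_law:
  assumes f: "f \<in> borel_measurable S"
  shows "(\<integral>\<^sup>+\<omega>. f (traj \<omega>) \<partial>P (x, y)) = (\<integral>\<^sup>+\<omega>. f (shift x (traj \<omega>)) \<partial>P (0, y))"
proof -
  interpret P1: prob_space "P (x, y)" by (rule prob_space_P)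
  have trajP: "traj \<in> measurable (P w) S" for w by (rule M_measD[OF traj_meas])
  have strajP: "(\<lambda>\<omega>. shift x (traj \<omega>)) \<in> measurable (P w) S" for w
    by (rule measurable_compose[OF trajP shift_meas])
  have "distr (P (x, y)) S traj = distr (P (0, y)) S (\<lambda>\<omega>. shift x (traj \<omega>))"
  proof (rule measure_eqI_PiM_infinite)
    show "finite_measure (distr (P (x, y)) S traj)"
      by (intro prob_space.finite_measure P1.prob_space_distr trajP)
    fix J :: "real set" and A
    assume J: "finite J" "J \<subseteq> {0..}" and A: "\<And>i. i \<in> J \<Longrightarrow> A i \<in> sets (borel :: (real \<times> 'e) measure)"
    let ?B = "prod_emb {0..} (\<lambda>_. borel) J (Pi\<^sub>E J A)"
    have B: "?B \<in> sets S" using J A by (intro sets_PiM_I) auto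
    have iB: "shift x (traj \<omega>) \<in> ?B \<longleftrightarrow> (\<forall>j\<in>J. shift1 x (X j \<omega>, Y j \<omega>) \<in> A j)" for \<omega>
      using J by (auto simp: prod_emb_def PiE_def Pi_def extensional_def subset_eq shift_def)
    have "emeasure (distr (P (x, y)) S traj) ?B
        = (\<integral>\<^sup>+\<omega>. (\<Prod>j\<in>J. indicator (A j) (X j \<omega>, Y j \<omega>)) \<partial>P (x, y))"
      using emeasure_path_cylinder[OF J A sets_P order_refl] by (simp add: traj_def[abs_def])
    also have "\<dots> = (\<integral>\<^sup>+\<omega>. (\<Prod>j\<in>J. indicator (A j) (shift1 x (X j \<omega>, Y j \<omega>))) \<partial>P (0, y))"
      using J A by (intro homog_fin) auto
    also have "\<dots> = (\<integral>\<^sup>+\<omega>. indicator ?B (shift x (traj \<omega>)) \<partial>P (0, y))"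
      by (rule nn_integral_cong) (use J(1) iB in \<open>auto simp: indicator_def prod_zero_iff\<close>)
    also have "\<dots> = (\<integral>\<^sup>+w. indicator ?B w \<partial>distr (P (0, y)) S (\<lambda>\<omega>. shift x (traj \<omega>)))"
      using B by (intro nn_integral_distr[symmetric] strajP) simp
    also have "\<dots> = emeasure (distr (P (0, y)) S (\<lambda>\<omega>. shift x (traj \<omega>))) ?B"
      using B by simp
    finally show "emeasure (distr (P (x, y)) S traj) ?B
        = emeasure (distr (P (0, y)) S (\<lambda>\<omega>. shift x (traj \<omega>))) ?B" .
  qed simp_all
  then have "(\<integral>\<^sup>+w. f w \<partial>distr (P (x, y)) S traj) = (\<integral>\<^sup>+w. f w \<partial>distr (P (0, y)) S (\<lambda>\<omega>. shift x (traj \<omega>)))"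
    by simp
  then show ?thesis
    by (simp add: nn_integral_distr[OF trajP] nn_integral_distr[OF strajP] f)
qed

section \<open>Integrability of the running maximum\<close>

definition Xmax :: "real \<Rightarrow> 'w \<Rightarrow> ennreal" where
  "Xmax t \<omega> = runmax (\<lambda>s. \<bar>X s \<omega>\<bar>) t"

lemma Xmax_meas: "0 \<le> t \<Longrightarrow> Xmax t \<in> borel_measurable M"
proof -
  assume t: "0 \<le> t"
  have "(\<lambda>\<omega>. SUP s\<in>insert t ({0..t} \<inter> \<rat>). ennreal \<bar>X s \<omega>\<bar>) \<in> borel_measurable M"
    using t by (intro borel_measurable_SUP) (auto intro!: countable_Int2 countable_rat measurable_compose[OF X_meas])
  moreover have "Xmax t \<omega> = (SUP s\<in>insert t ({0..t} \<inter> \<rat>). ennreal \<bar>X s \<omega>\<bar>)" if "\<omega> \<in> space M" for \<omega>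
    unfolding Xmax_def by (rule runmax_rat[OF _ t]) (intro continuous_intros X_right_cont that)
  ultimately show ?thesis by (simp cong: measurable_cong)
qed

lemma Xmax_step:
  assumes \<omega>: "\<omega> \<in> space M"
  shows "Xmax (real (Suc N)) \<omega> \<le> Xmax (real N) \<omega>
    + (SUP r\<in>{0..1} \<inter> \<rat>. ennreal \<bar>X (real N + r) \<omega> - X (real N) \<omega>\<bar>)"
    (is "_ \<le> _ + ?S")
  unfolding Xmax_def
proof (subst runmax_rat)
  show "(SUP s\<in>insert (real (Suc N)) ({0..real (Suc N)} \<inter> \<rat>). ennreal \<bar>X s \<omega>\<bar>)
      \<le> runmax (\<lambda>s. \<bar>X s \<omega>\<bar>) (real N) + ?S"
  proof (rule SUP_least)
    fix s assume "s \<in> insert (real (Suc N)) ({0..real (Suc N)} \<inter> \<rat>)"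
    then have s: "0 \<le> s" "s \<le> real (Suc N)" "s \<in> \<rat>" by auto
    show "ennreal \<bar>X s \<omega>\<bar> \<le> runmax (\<lambda>s. \<bar>X s \<omega>\<bar>) (real N) + ?S"
    proof (cases "s \<le> real N")
      case True
      then have "ennreal \<bar>X s \<omega>\<bar> \<le> runmax (\<lambda>s. \<bar>X s \<omega>\<bar>) (real N)"
        using s runmax_upper[of s "real N" "\<lambda>s. \<bar>X s \<omega>\<bar>"] by simp
      then show ?thesis by (rule order_trans) simp
    next
      case False
      then have r: "s - real N \<in> {0..1} \<inter> \<rat>" using s by auto
      have "ennreal \<bar>X s \<omega>\<bar> \<le> ennreal (\<bar>X (real N) \<omega>\<bar> + \<bar>X (real N + (s - real N)) \<omega> - X (real N) \<omega>\<bar>)"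
        by (intro ennreal_leI) simp
      also have "\<dots> = ennreal \<bar>X (real N) \<omega>\<bar> + ennreal \<bar>X (real N + (s - real N)) \<omega> - X (real N) \<omega>\<bar>"
        by (rule ennreal_plus) auto
      also have "\<dots> \<le> runmax (\<lambda>s. \<bar>X s \<omega>\<bar>) (real N) + ?S"
        using r by (intro add_mono runmax_upper[of "real N" "real N" "\<lambda>s. \<bar>X s \<omega>\<bar>"] SUP_upper) auto
      finally show ?thesis .
    qed
  qed
qed (auto intro!: continuous_intros X_right_cont \<omega>)

text \<open>By homogeneity the expected maximal displacement over unit time has the same bound
  \<open>C\<close> from every starting point; by the Markov property each further unit of time adds
  at most \<open>C\<close>.\<close>

lemma Xmax_linear:
  obtains C :: real where "0 \<le> C"
    "\<And>x y N. (\<integral>\<^sup>+\<omega>. Xmax (real N) \<omega> \<partial>P (x, y)) \<le> ennreal (\<bar>x\<bar> + C * real N)"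
proof -
  obtain C' where C': "C' < \<top>" "\<And>y. (\<integral>\<^sup>+\<omega>. (SUP s\<in>{0..1}. ennreal \<bar>X s \<omega>\<bar>) \<partial>P (0, y)) \<le> C'"
    using sup_bound by blast
  define C where "C = enn2real C'"
  have CC: "ennreal C = C'" "0 \<le> C" using C' by (auto simp: C_def)
  \<comment> \<open>Rational times keep this measurable on the product space, and displacement from
    \<open>w 0\<close> makes it invariant under translation.\<close>
  define \<Phi> where "\<Phi> w = (SUP r\<in>{0..1} \<inter> \<rat>. ennreal \<bar>fst (w r) - fst (w 0)\<bar>)" for w :: "real \<Rightarrow> real \<times> 'e"
  have comp: "(\<lambda>w. fst (w r)) \<in> borel_measurable S" if "0 \<le> r" for r
    by (rule measurable_compose[OF coord_meas fst_borel]) (rule that)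
  have \<Phi>m: "\<Phi> \<in> borel_measurable S"
    unfolding \<Phi>_def
    by (intro borel_measurable_SUP) (auto intro!: countable_Int2 countable_rat measurable_compose[OF _ measurable_ennreal] borel_measurable_abs borel_measurable_diff comp)
  have \<Phi>C: "(\<integral>\<^sup>+\<omega>. \<Phi> (traj \<omega>) \<partial>P w) \<le> ennreal C" for w
  proof -
    obtain a b where w: "w = (a, b)" by (cases w)
    have "(\<integral>\<^sup>+\<omega>. \<Phi> (traj \<omega>) \<partial>P w) = (\<integral>\<^sup>+\<omega>. \<Phi> (shift a (traj \<omega>)) \<partial>P (0, b))"
      unfolding w by (rule traj_law[OF \<Phi>m])
    also have "\<dots> \<le> (\<integral>\<^sup>+\<omega>. (SUP s\<in>{0..1}. ennreal \<bar>X s \<omega>\<bar>) \<partial>P (0, b))"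
    proof (rule nn_integral_mono_AE, use Z_0 in eventually_elim)
      case (elim \<omega>)
      then have "X 0 \<omega> = 0" by simp
      then have "\<Phi> (shift a (traj \<omega>)) = (SUP r\<in>{0..1} \<inter> \<rat>. ennreal \<bar>X r \<omega>\<bar>)"
        unfolding \<Phi>_def by (intro SUP_cong) (auto simp: shift_def shift1_def)
      also have "\<dots> \<le> (SUP s\<in>{0..1}. ennreal \<bar>X s \<omega>\<bar>)" by (rule SUP_subset_mono) auto
      finally show ?case .
    qed
    also have "\<dots> \<le> ennreal C" using C'(2) CC by simp
    finally show ?thesis .
  qed
  have "(\<integral>\<^sup>+\<omega>. Xmax (real N) \<omega> \<partial>P (x, y)) \<le> ennreal (\<bar>x\<bar> + C * real N)" for x y N
  proof (induction N)
    case 0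
    have "(\<integral>\<^sup>+\<omega>. Xmax (real 0) \<omega> \<partial>P (x, y)) = (\<integral>\<^sup>+\<omega>. ennreal \<bar>x\<bar> \<partial>P (x, y))"
      by (rule nn_integral_cong_AE, use Z_0 in eventually_elim) (simp add: Xmax_def runmax_def)
    then show ?case using prob_space.emeasure_space_1[OF prob_space_P] by simp
  next
    case (Suc N)
    have inc: "(SUP r\<in>{0..1} \<inter> \<rat>. ennreal \<bar>X (real N + r) \<omega> - X (real N) \<omega>\<bar>)
        = \<Phi> (\<lambda>t\<in>{0..}. (X (real N + t) \<omega>, Y (real N + t) \<omega>))" for \<omega>
      unfolding \<Phi>_def by (intro SUP_cong) auto
    have m: "(\<lambda>\<omega>. \<Phi> (\<lambda>t\<in>{0..}. (X (real N + t) \<omega>, Y (real N + t) \<omega>))) \<in> borel_measurable (P (x, y))"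
      by (rule measurable_compose[OF M_measD[OF shifted_path_meas] \<Phi>m]) simp
    have "(\<integral>\<^sup>+\<omega>. Xmax (real (Suc N)) \<omega> \<partial>P (x, y))
        \<le> (\<integral>\<^sup>+\<omega>. Xmax (real N) \<omega> + \<Phi> (\<lambda>t\<in>{0..}. (X (real N + t) \<omega>, Y (real N + t) \<omega>)) \<partial>P (x, y))"
      by (rule nn_integral_mono) (use Xmax_step in \<open>simp add: inc[symmetric] del: of_nat_Suc\<close>)
    also have "\<dots> = (\<integral>\<^sup>+\<omega>. Xmax (real N) \<omega> \<partial>P (x, y))
        + (\<integral>\<^sup>+\<omega>. \<Phi> (\<lambda>t\<in>{0..}. (X (real N + t) \<omega>, Y (real N + t) \<omega>)) \<partial>P (x, y))"
      by (rule nn_integral_add[OF M_measD[OF Xmax_meas] m]) simp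
    also have "(\<integral>\<^sup>+\<omega>. \<Phi> (\<lambda>t\<in>{0..}. (X (real N + t) \<omega>, Y (real N + t) \<omega>)) \<partial>P (x, y))
        = (\<integral>\<^sup>+\<omega>. (\<integral>\<^sup>+\<omega>'. \<Phi> (traj \<omega>') \<partial>P (X (real N) \<omega>, Y (real N) \<omega>)) \<partial>P (x, y))"
      by (rule markov_path[OF _ \<Phi>m]) simp
    also have "\<dots> \<le> (\<integral>\<^sup>+\<omega>. ennreal C \<partial>P (x, y))" by (intro nn_integral_mono \<Phi>C)
    also have "\<dots> = ennreal C" using prob_space.emeasure_space_1[OF prob_space_P] by simp
    also have "(\<integral>\<^sup>+\<omega>. Xmax (real N) \<omega> \<partial>P (x, y)) + ennreal C \<le> ennreal (\<bar>x\<bar> + C * real N) + ennreal C"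
      by (intro add_mono Suc.IH order_refl)
    also have "\<dots> = ennreal (\<bar>x\<bar> + C * real N + C)" using CC(2) by (intro ennreal_plus[symmetric]) auto
    finally show ?case by (simp add: algebra_simps)
  qed
  with CC(2) show thesis by (rule that)
qed


lemma emeasure_P_space [simp]: "emeasure (P z) (space M) = 1"
  using prob_space.emeasure_space_1[OF prob_space_P, of z] by simp

section \<open>The natural filtration\<close>

text \<open>Generated by the path up to \<open>t\<close> and deliberately not completed: measurable
  functions are literally functionals of the path and can be evaluated at translated paths.\<close>

definition G :: "real \<Rightarrow> 'w measure" where
  "G t = vimage_algebra (space M) (\<lambda>\<omega>. \<lambda>s\<in>{0..t}. (X s \<omega>, Y s \<omega>)) (Pi\<^sub>M {0..t} (\<lambda>_. borel))"

definition Ginf :: "'w measure" where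
  "Ginf = vimage_algebra (space M) traj S"

lemma space_G [simp]: "space (G t) = space M" and space_Ginf [simp]: "space Ginf = space M"
  by (simp_all add: G_def Ginf_def)

lemma restr_space: "(\<lambda>\<omega>. \<lambda>s\<in>{0..t}. (X s \<omega>, Y s \<omega>)) \<in> space M \<rightarrow> space (Pi\<^sub>M {0..t} (\<lambda>_. borel))"
  by (auto simp: space_PiM)

lemma traj_space: "traj \<in> space M \<rightarrow> space S"
  by (auto simp: space_PiM traj_def)

lemma Z_meas_G: "0 \<le> s \<Longrightarrow> s \<le> t \<Longrightarrow> (\<lambda>\<omega>. (X s \<omega>, Y s \<omega>)) \<in> measurable (G t) borel"
proof -
  assume s: "0 \<le> s" "s \<le> t"
  have "(\<lambda>w. w s) \<in> measurable (Pi\<^sub>M {0..t} (\<lambda>_. borel :: (real \<times> 'e) measure)) borel"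
    using measurable_component_singleton[of s "{0..t}" "\<lambda>_. borel"] s by simp
  from measurable_compose[OF measurable_vimage_algebra1[OF restr_space] this]
  show ?thesis using s by (simp add: G_def)
qed

lemma Z_meas_Ginf: "0 \<le> s \<Longrightarrow> (\<lambda>\<omega>. (X s \<omega>, Y s \<omega>)) \<in> measurable Ginf borel"
  using measurable_compose[OF measurable_vimage_algebra1[OF traj_space] coord_meas, of s]
  by (simp add: Ginf_def)

lemma restr_meas:
  assumes "space N = space M" "\<And>s. 0 \<le> s \<Longrightarrow> s \<le> t \<Longrightarrow> (\<lambda>\<omega>. (X s \<omega>, Y s \<omega>)) \<in> measurable N borel"
  shows "(\<lambda>\<omega>. \<lambda>s\<in>{0..t}. (X s \<omega>, Y s \<omega>)) \<in> measurable N (Pi\<^sub>M {0..t} (\<lambda>_. borel))"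
  by (rule measurable_restrict) (use assms in auto)

lemma sets_G_le:
  assumes "space N = space M" "\<And>s. 0 \<le> s \<Longrightarrow> s \<le> t \<Longrightarrow> (\<lambda>\<omega>. (X s \<omega>, Y s \<omega>)) \<in> measurable N borel"
  shows "sets (G t) \<subseteq> sets N"
proof
  fix A assume "A \<in> sets (G t)"
  then obtain B where B: "B \<in> sets (Pi\<^sub>M {0..t} (\<lambda>_. borel :: (real \<times> 'e) measure))"
    "A = (\<lambda>\<omega>. \<lambda>s\<in>{0..t}. (X s \<omega>, Y s \<omega>)) -` B \<inter> space M"
    unfolding G_def sets_vimage_algebra2[OF restr_space] by blast
  show "A \<in> sets N"
    using measurable_sets[OF restr_meas[OF assms] B(1)] unfolding B(2) assms(1) .
qed

lemma sets_Ginf_le: "sets Ginf \<subseteq> sets M"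
proof
  fix A assume "A \<in> sets Ginf"
  then obtain B where B: "B \<in> sets S" "A = traj -` B \<inter> space M"
    unfolding Ginf_def sets_vimage_algebra2[OF traj_space] by blast
  show "A \<in> sets M" using measurable_sets[OF traj_meas B(1)] unfolding B(2) .
qed

lemma Ginf_measD: "f \<in> measurable Ginf N \<Longrightarrow> f \<in> measurable M N"
  using sets_Ginf_le by (auto simp: measurable_def)

lemma G_measD_F: "0 \<le> t \<Longrightarrow> f \<in> measurable (G t) N \<Longrightarrow> f \<in> measurable (F t) N"
proof -
  assume t: "0 \<le> t" and f: "f \<in> measurable (G t) N"
  have "sets (G t) \<subseteq> sets (F t)"
    by (rule sets_G_le) (use t in \<open>auto intro: F_meas_mono[OF _ _ Z_meas_F]\<close>)
  then show ?thesis using f t by (auto simp: measurable_def)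
qed

lemma G_measD_Ginf: "f \<in> measurable (G t) N \<Longrightarrow> f \<in> measurable Ginf N"
proof -
  assume f: "f \<in> measurable (G t) N"
  have "sets (G t) \<subseteq> sets Ginf"
    by (rule sets_G_le) (auto intro: Z_meas_Ginf)
  then show ?thesis using f by (auto simp: measurable_def)
qed

lemma G_meas_mono: "s \<le> t \<Longrightarrow> f \<in> measurable (G s) N \<Longrightarrow> f \<in> measurable (G t) N"
proof -
  assume st: "s \<le> t" and f: "f \<in> measurable (G s) N"
  have "sets (G s) \<subseteq> sets (G t)"
    by (rule sets_G_le) (use st in \<open>auto intro: Z_meas_G\<close>)
  then show ?thesis using f by (auto simp: measurable_def)
qed

lemma subalg_G: "subalgebra (P z) (G t)"
  using sets_G_le[OF refl Z_meas] by (simp add: subalgebra_def)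

lemma X_meas_G: "0 \<le> s \<Longrightarrow> s \<le> t \<Longrightarrow> X s \<in> borel_measurable (G t)"
  using measurable_compose[OF Z_meas_G fst_borel, of s t] by simp

lemma X_meas_Ginf: "0 \<le> s \<Longrightarrow> X s \<in> borel_measurable Ginf"
  using measurable_compose[OF Z_meas_Ginf fst_borel, of s] by simp

lemma D_meas_Ginf: "D t \<in> borel_measurable Ginf"
  by (rule D_measurable) (use measurable_compose[OF Z_meas_Ginf snd_borel] in simp_all)

lemma D_meas: "D t \<in> borel_measurable M"
  by (rule Ginf_measD[OF D_meas_Ginf])

lemma Ginf_factor:
  fixes H :: "'w \<Rightarrow> ennreal"
  assumes "H \<in> borel_measurable Ginf"
  obtains \<phi> where "\<phi> \<in> borel_measurable S" "\<And>\<omega>. \<omega> \<in> space M \<Longrightarrow> H \<omega> = \<phi> (traj \<omega>)"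
  using doob_dynkin_ennreal[OF assms[unfolded Ginf_def] traj_space] by blast

text \<open>By the Markov property the \<open>F t\<close>-measurable information is conditionally independent of the
  future path, given the past path.\<close>
lemma conditional_independence:
  fixes \<xi> H :: "'w \<Rightarrow> ennreal"
  assumes t: "0 \<le> t" and \<xi>: "\<xi> \<in> borel_measurable (F t)" and \<xi>K: "\<And>\<omega>. \<omega> \<in> space M \<Longrightarrow> \<xi> \<omega> \<le> ennreal K"
    and H: "H \<in> borel_measurable Ginf"
  shows "(\<integral>\<^sup>+\<omega>. \<xi> \<omega> * H \<omega> \<partial>P z) = (\<integral>\<^sup>+\<omega>. nn_cond_exp (P z) (G t) \<xi> \<omega> * H \<omega> \<partial>P z)"
proof -
  interpret Pz: prob_space "P z" by (rule prob_space_P)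
  interpret C: finite_measure_subalgebra "P z" "G t"
    by unfold_locales (rule subalg_G)
  let ?Z = "\<lambda>t \<omega>. (X t \<omega>, Y t \<omega>)"
  define e where "e = nn_cond_exp (P z) (G t) \<xi>"
  have eG: "e \<in> borel_measurable (G t)" unfolding e_def by (rule borel_measurable_nn_cond_exp)
  have eF: "e \<in> borel_measurable (F t)" by (rule G_measD_F[OF t eG])
  have eP: "e \<in> borel_measurable (P z)" by (rule M_measD[OF F_measD[OF t eF]])
  have \<xi>P: "\<xi> \<in> borel_measurable (P z)" by (rule M_measD[OF F_measD[OF t \<xi>]])
  have trajP: "traj \<in> measurable (P z) S" by (rule M_measD[OF traj_meas])
  have cond: "(\<integral>\<^sup>+\<omega>. f \<omega> * \<xi> \<omega> \<partial>P z) = (\<integral>\<^sup>+\<omega>. f \<omega> * e \<omega> \<partial>P z)" if "f \<in> borel_measurable (G t)" for f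
    unfolding e_def using C.nn_cond_exp_intg[OF that \<xi>P] by simp
  \<comment> \<open>Factors at times up to \<open>t\<close> are \<open>G t\<close>-measurable, and
    the Markov property turns the later ones into a Borel function of the state at \<open>t\<close>.
    What multiplies \<xi> is then \<open>G t\<close>-measurable, so the conditional expectation may
    replace \<xi>.\<close>
  have cyl: "(\<integral>\<^sup>+\<omega>. \<xi> \<omega> * (\<Prod>j\<in>J. f j (?Z j \<omega>)) \<partial>P z) = (\<integral>\<^sup>+\<omega>. e \<omega> * (\<Prod>j\<in>J. f j (?Z j \<omega>)) \<partial>P z)"
    if J: "finite J" "J \<subseteq> {0..}" and f: "\<And>j. j \<in> J \<Longrightarrow> f j \<in> borel_measurable borel"
    for J and f :: "real \<Rightarrow> real \<times> 'e \<Rightarrow> ennreal"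
  proof -
    define J1 where "J1 = {j\<in>J. j \<le> t}"
    define J2 where "J2 = (\<lambda>j. j - t) ` {j\<in>J. t < j}"
    have inj: "inj_on (\<lambda>j. j - t) {j\<in>J. t < j}" by (auto simp: inj_on_def)
    define \<eta> where "\<eta> \<omega> = (\<Prod>j\<in>J1. f j (?Z j \<omega>))" for \<omega>
    have J2: "finite J2" "J2 \<subseteq> {0..}" using J by (auto simp: J2_def)
    have f2: "f (j + t) \<in> borel_measurable borel" if "j \<in> J2" for j using f that by (auto simp: J2_def)
    have split: "(\<Prod>j\<in>J. f j (?Z j \<omega>)) = \<eta> \<omega> * (\<Prod>j\<in>J2. f (j + t) (?Z (t + j) \<omega>))" for \<omega>
    proof -
      have "J = J1 \<union> {j\<in>J. t < j}" "J1 \<inter> {j\<in>J. t < j} = {}" by (auto simp: J1_def)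
      then have "(\<Prod>j\<in>J. f j (?Z j \<omega>)) = \<eta> \<omega> * (\<Prod>j\<in>{j\<in>J. t < j}. f j (?Z j \<omega>))"
        using J(1) unfolding \<eta>_def by (subst (1) \<open>J = _\<close>, subst prod.union_disjoint) (auto simp: J1_def)
      also have "(\<Prod>j\<in>{j\<in>J. t < j}. f j (?Z j \<omega>)) = (\<Prod>j\<in>J2. f (j + t) (?Z (t + j) \<omega>))"
        unfolding J2_def prod.reindex[OF inj] by simp
      finally show ?thesis .
    qed
    have \<eta>G: "\<eta> \<in> borel_measurable (G t)"
      unfolding \<eta>_def
    proof (rule borel_measurable_prod_ennreal)
      fix j assume "j \<in> J1"
      then show "(\<lambda>\<omega>. f j (?Z j \<omega>)) \<in> borel_measurable (G t)"
        using J(2) by (intro measurable_compose[OF Z_meas_G f]) (auto simp: J1_def)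
    qed
    define g where "g w = (\<integral>\<^sup>+\<omega>'. (\<Prod>j\<in>J2. f (j + t) (?Z j \<omega>')) \<partial>P w)" for w
    have gu: "univ_measurable_fun g"
      unfolding g_def
      by (rule univ_expectation) (use Z_prod_meas[of J2 0 "\<lambda>j. f (j + t)"] J2 f2 in auto)
    obtain g' where g': "g' \<in> borel_measurable borel" and ae: "AE \<omega> in P z. g (?Z t \<omega>) = g' (?Z t \<omega>)"
      by (rule univ_fun_borel_version[OF gu prob_space_P M_measD[OF Z_meas[OF t]]])
    have g'G: "(\<lambda>\<omega>. g' (?Z t \<omega>)) \<in> borel_measurable (G t)"
      by (rule measurable_compose[OF Z_meas_G[OF t order_refl] g'])
    have fut: "(\<integral>\<^sup>+\<omega>. \<zeta> \<omega> * (\<Prod>j\<in>J. f j (?Z j \<omega>)) \<partial>P z) = (\<integral>\<^sup>+\<omega>. \<eta> \<omega> * g' (?Z t \<omega>) * \<zeta> \<omega> \<partial>P z)"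
      if \<zeta>: "\<zeta> \<in> borel_measurable (F t)" for \<zeta>
    proof -
      have "(\<integral>\<^sup>+\<omega>. \<zeta> \<omega> * (\<Prod>j\<in>J. f j (?Z j \<omega>)) \<partial>P z)
          = (\<integral>\<^sup>+\<omega>. (\<zeta> \<omega> * \<eta> \<omega>) * (\<Prod>j\<in>J2. f (j + t) (?Z (t + j) \<omega>)) \<partial>P z)"
        by (simp add: split mult.assoc)
      also have "\<dots> = (\<integral>\<^sup>+\<omega>. (\<zeta> \<omega> * \<eta> \<omega>) * g (?Z t \<omega>) \<partial>P z)"
        unfolding g_def
        by (rule markov_fin[where f = "\<lambda>j. f (j + t)", OF J2 _ t], erule f2)
           (intro borel_measurable_times_ennreal \<zeta> G_measD_F[OF t \<eta>G])
      also have "\<dots> = (\<integral>\<^sup>+\<omega>. \<eta> \<omega> * g' (?Z t \<omega>) * \<zeta> \<omega> \<partial>P z)"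
        by (rule nn_integral_cong_AE, use ae in eventually_elim) (simp add: ac_simps)
      finally show ?thesis .
    qed
    show ?thesis
      unfolding fut[OF \<xi>] fut[OF eF] by (rule cond) (intro borel_measurable_times_ennreal \<eta>G g'G)
  qed
  define N1 where "N1 = distr (density (P z) \<xi>) S traj"
  define N2 where "N2 = distr (density (P z) e) S traj"
  have emN: "emeasure (distr (density (P z) \<zeta>) S traj) (prod_emb {0..} (\<lambda>_. borel) J (Pi\<^sub>E J A))
      = (\<integral>\<^sup>+\<omega>. \<zeta> \<omega> * (\<Prod>j\<in>J. indicator (A j) (?Z j \<omega>)) \<partial>P z)"
    if \<zeta>: "\<zeta> \<in> borel_measurable (P z)" and J: "finite J" "J \<subseteq> {0..}" and A: "\<And>j. j \<in> J \<Longrightarrow> A j \<in> sets borel"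
    for \<zeta> J A
  proof -
    have "emeasure (distr (density (P z) \<zeta>) S traj) (prod_emb {0..} (\<lambda>_. borel) J (Pi\<^sub>E J A))
        = (\<integral>\<^sup>+\<omega>. (\<Prod>j\<in>J. indicator (A j) (?Z j \<omega>)) \<partial>density (P z) \<zeta>)"
      using emeasure_path_cylinder[of J A "density (P z) \<zeta>" 0] J A by (simp add: traj_def[abs_def])
    also have "\<dots> = (\<integral>\<^sup>+\<omega>. \<zeta> \<omega> * (\<Prod>j\<in>J. indicator (A j) (?Z j \<omega>)) \<partial>P z)"
    proof (rule nn_integral_density[OF \<zeta>])
      show "(\<lambda>\<omega>. \<Prod>j\<in>J. indicator (A j) (?Z j \<omega>) :: ennreal) \<in> borel_measurable (P z)"
        using Z_prod_meas[of J 0 "\<lambda>j. indicator (A j)"] J A by (auto intro!: M_measD)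
    qed
    finally show ?thesis .
  qed
  \<comment> \<open>Boundedness of \<xi> makes these measures finite, so agreement on cylinders
    determines them on all of \<open>S\<close>.\<close>
  have "N1 = N2"
  proof (rule measure_eqI_PiM_infinite)
    show "finite_measure N1"
    proof
      have tr: "traj \<in> measurable (density (P z) \<xi>) S" using trajP by simp
      have "emeasure N1 (space N1) = emeasure (density (P z) \<xi>) (traj -` space S \<inter> space (P z))"
        unfolding N1_def space_distr using emeasure_distr[OF tr sets.top] by simp
      also have "traj -` space S \<inter> space (P z) = space (P z)" using traj_space by auto
      also have "emeasure (density (P z) \<xi>) (space (P z)) = (\<integral>\<^sup>+\<omega>. \<xi> \<omega> * indicator (space (P z)) \<omega> \<partial>P z)"
        by (rule emeasure_density[OF \<xi>P sets.top])
      also have "\<dots> = (\<integral>\<^sup>+\<omega>. \<xi> \<omega> \<partial>P z)" by (rule nn_integral_cong) simp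
      also have "\<dots> \<le> (\<integral>\<^sup>+\<omega>. ennreal K \<partial>P z)" by (rule nn_integral_mono) (simp add: \<xi>K)
      also have "\<dots> < \<top>" by simp
      finally show "emeasure N1 (space N1) \<noteq> \<infinity>" by simp
    qed
    fix J :: "real set" and A
    assume J: "finite J" "J \<subseteq> {0..}" and A: "\<And>i. i \<in> J \<Longrightarrow> A i \<in> sets (borel :: (real \<times> 'e) measure)"
    show "emeasure N1 (prod_emb {0..} (\<lambda>_. borel) J (Pi\<^sub>E J A)) = emeasure N2 (prod_emb {0..} (\<lambda>_. borel) J (Pi\<^sub>E J A))"
      unfolding N1_def N2_def
      by (subst (1 2) emN) (use \<xi>P eP J A in \<open>auto intro!: cyl\<close>)
  qed (simp_all add: N1_def N2_def)
  obtain \<phi> where \<phi>: "\<phi> \<in> borel_measurable S" "\<And>\<omega>. \<omega> \<in> space M \<Longrightarrow> H \<omega> = \<phi> (traj \<omega>)"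
    using Ginf_factor[OF H] by blast
  have int: "(\<integral>\<^sup>+\<omega>. \<zeta> \<omega> * H \<omega> \<partial>P z) = (\<integral>\<^sup>+w. \<phi> w \<partial>distr (density (P z) \<zeta>) S traj)"
    if \<zeta>: "\<zeta> \<in> borel_measurable (P z)" for \<zeta>
  proof -
    have tr: "traj \<in> measurable (density (P z) \<zeta>) S" using trajP by simp
    have "(\<integral>\<^sup>+w. \<phi> w \<partial>distr (density (P z) \<zeta>) S traj) = (\<integral>\<^sup>+\<omega>. \<phi> (traj \<omega>) \<partial>density (P z) \<zeta>)"
      by (rule nn_integral_distr[OF tr]) (simp add: \<phi>(1))
    also have "\<dots> = (\<integral>\<^sup>+\<omega>. \<zeta> \<omega> * \<phi> (traj \<omega>) \<partial>P z)"
      by (rule nn_integral_density[OF \<zeta> measurable_compose[OF trajP \<phi>(1)]])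
    also have "\<dots> = (\<integral>\<^sup>+\<omega>. \<zeta> \<omega> * H \<omega> \<partial>P z)"
      by (rule nn_integral_cong) (simp add: \<phi>(2))
    finally show ?thesis by simp
  qed
  show ?thesis
    using \<open>N1 = N2\<close> unfolding N1_def N2_def e_def[symmetric] int[OF \<xi>P] int[OF eP] by simp
qed

text \<open>A conditional expectation respects bounds only almost surely; cutting it at
  \<open>K\<close> makes them hold everywhere without changing its class. It depends on
  \<open>z\<close>, so each starting point has its own projected strategy.\<close>

lemma projection_exists:
  fixes \<xi> :: "'w \<Rightarrow> real"
  assumes t: "0 \<le> t" and \<xi>: "\<xi> \<in> borel_measurable (F t)"
    and \<xi>K: "\<And>\<omega>. \<omega> \<in> space M \<Longrightarrow> 0 \<le> \<xi> \<omega> \<and> \<xi> \<omega> \<le> K"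
  obtains e :: "'w \<Rightarrow> real" where "e \<in> borel_measurable (G t)" "\<And>\<omega>. \<omega> \<in> space M \<Longrightarrow> 0 \<le> e \<omega> \<and> e \<omega> \<le> K"
    "\<And>H :: 'w \<Rightarrow> ennreal. H \<in> borel_measurable Ginf \<Longrightarrow>
       (\<integral>\<^sup>+\<omega>. ennreal (e \<omega>) * H \<omega> \<partial>P z) = (\<integral>\<^sup>+\<omega>. ennreal (\<xi> \<omega>) * H \<omega> \<partial>P z)"
proof -
  interpret Pz: prob_space "P z" by (rule prob_space_P)
  interpret C: finite_measure_subalgebra "P z" "G t"
    by unfold_locales (rule subalg_G)
  have "space M \<noteq> {}" using Pz.not_empty by simp
  then have K: "0 \<le> K" using \<xi>K by fastforce
  have \<xi>': "(\<lambda>\<omega>. ennreal (\<xi> \<omega>)) \<in> borel_measurable (F t)" using \<xi> by simp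
  have \<xi>P: "(\<lambda>\<omega>. ennreal (\<xi> \<omega>)) \<in> borel_measurable (P z)" by (rule M_measD[OF F_measD[OF t \<xi>']])
  define e0 where "e0 = nn_cond_exp (P z) (G t) (\<lambda>\<omega>. ennreal (\<xi> \<omega>))"
  define e where "e \<omega> = enn2real (min (e0 \<omega>) (ennreal K))" for \<omega>
  have e0G: "e0 \<in> borel_measurable (G t)" unfolding e0_def by (rule borel_measurable_nn_cond_exp)
  have "AE \<omega> in P z. e0 \<omega> \<le> nn_cond_exp (P z) (G t) (\<lambda>_. ennreal K) \<omega>"
    unfolding e0_def by (rule C.nn_cond_exp_mono) (use \<xi>K \<xi>P in \<open>auto intro!: AE_I2 ennreal_leI\<close>)
  moreover have "AE \<omega> in P z. ennreal K = nn_cond_exp (P z) (G t) (\<lambda>_. ennreal K) \<omega>"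
    by (rule C.nn_cond_exp_F_meas) simp
  ultimately have ae: "AE \<omega> in P z. ennreal (e \<omega>) = e0 \<omega>"
  proof eventually_elim
    case (elim \<omega>)
    then have "min (e0 \<omega>) (ennreal K) = e0 \<omega>" "e0 \<omega> < \<top>"
      by (auto simp: min_def intro: le_less_trans[of _ "ennreal K"])
    then show ?case by (simp add: e_def)
  qed
  show thesis
  proof (rule that[of e])
    show "e \<in> borel_measurable (G t)" unfolding e_def using e0G by measurable
    show "0 \<le> e \<omega> \<and> e \<omega> \<le> K" for \<omega>
      using enn2real_mono[of "min (e0 \<omega>) (ennreal K)" "ennreal K"] K by (simp add: e_def)
    fix H :: "'w \<Rightarrow> ennreal" assume H: "H \<in> borel_measurable Ginf"
    have "(\<integral>\<^sup>+\<omega>. ennreal (e \<omega>) * H \<omega> \<partial>P z) = (\<integral>\<^sup>+\<omega>. e0 \<omega> * H \<omega> \<partial>P z)"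
      by (rule nn_integral_cong_AE, use ae in eventually_elim) simp
    also have "\<dots> = (\<integral>\<^sup>+\<omega>. ennreal (\<xi> \<omega>) * H \<omega> \<partial>P z)"
      unfolding e0_def by (rule conditional_independence[OF t \<xi>' _ H, symmetric]) (use \<xi>K in \<open>auto intro: ennreal_leI\<close>)
    finally show "(\<integral>\<^sup>+\<omega>. ennreal (e \<omega>) * H \<omega> \<partial>P z) = (\<integral>\<^sup>+\<omega>. ennreal (\<xi> \<omega>) * H \<omega> \<partial>P z)" .
  qed
qed


section \<open>Dividend sequences and minimal injections\<close>

text \<open>Bounded dividends with a finite horizon, one \<open>K\<close> serving for both. Their
  gains are finite, and truncation shows later that they exhaust the value.\<close>

definition divs :: "nat \<Rightarrow> (real \<Rightarrow> 'w measure) \<Rightarrow> (nat \<Rightarrow> 'w \<Rightarrow> real) \<Rightarrow> bool" where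
  "divs n \<G> e \<longleftrightarrow> (\<forall>k. e k \<in> borel_measurable (\<G> (real k / 2 ^ n))) \<and>
     (\<exists>K::nat. \<forall>k. \<forall>\<omega>\<in>space M. 0 \<le> e k \<omega> \<and> e k \<omega> \<le> real K \<and> (K < k \<longrightarrow> e k \<omega> = 0))"

definition cumdiv :: "nat \<Rightarrow> (nat \<Rightarrow> 'w \<Rightarrow> real) \<Rightarrow> real \<Rightarrow> 'w \<Rightarrow> real" where
  "cumdiv n e t \<omega> = step n (\<lambda>k. e k \<omega>) t"

text \<open>Skorokhod reflection: the least injections keeping \<open>c + X\<close> minus the
  dividends non-negative. With the capital \<open>c\<close> as a parameter, different starting
  points can be studied under one measure.\<close>

definition injection :: "real \<Rightarrow> nat \<Rightarrow> (nat \<Rightarrow> 'w \<Rightarrow> real) \<Rightarrow> real \<Rightarrow> 'w \<Rightarrow> ennreal" where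
  "injection c n e t \<omega> = runmax (\<lambda>s. cumdiv n e s \<omega> - (c + X s \<omega>)) t"

definition gain :: "real \<times> 'e \<Rightarrow> nat \<Rightarrow> (nat \<Rightarrow> 'w \<Rightarrow> real) \<Rightarrow> ennreal" where
  "gain z n e = expected_disc z (cumdiv n e)"

definition cost :: "real \<times> 'e \<Rightarrow> real \<Rightarrow> nat \<Rightarrow> (nat \<Rightarrow> 'w \<Rightarrow> real) \<Rightarrow> ennreal" where
  "cost z c n e = (\<integral>\<^sup>+\<omega>. stieltjes (\<lambda>t. D t \<omega>) (\<lambda>t. injection c n e t \<omega>) \<partial>P z)"

lemma cumdiv_incr: "(\<And>k. 0 \<le> e k \<omega>) \<Longrightarrow> incr_path (\<lambda>t. cumdiv n e t \<omega>)"
  unfolding cumdiv_def by (rule step_incr_path)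

lemma cumdiv_bound:
  assumes e: "\<And>k. 0 \<le> e k \<omega> \<and> e k \<omega> \<le> real K \<and> (K < k \<longrightarrow> e k \<omega> = 0)"
  shows "cumdiv n e t \<omega> \<le> real K * real K"
proof -
  have "cumdiv n e t \<omega> = (\<Sum>k\<in>{1..grid_index n t} \<inter> {1..K}. e k \<omega>)"
    unfolding cumdiv_def step_eq by (rule sum.mono_neutral_right) (use e in \<open>auto simp: not_le\<close>)
  also have "\<dots> \<le> (\<Sum>k\<in>{1..K}. e k \<omega>)" by (rule sum_mono2) (use e in auto)
  also have "\<dots> \<le> (\<Sum>k\<in>{1..K}. real K)" by (rule sum_mono) (use e in auto)
  finally show ?thesis by simp
qed

lemma cumdiv_measurable:
  assumes "\<And>k. real k / 2 ^ n \<le> t \<Longrightarrow> e k \<in> borel_measurable N"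
  shows "cumdiv n e t \<in> borel_measurable N"
  unfolding cumdiv_def step_def by (rule borel_measurable_sum) (use assms in auto)

lemma net_right_cont: "\<omega> \<in> space M \<Longrightarrow> 0 \<le> s \<Longrightarrow> continuous (at_right s) (\<lambda>s. cumdiv n e s \<omega> - (c + X s \<omega>))"
  unfolding cumdiv_def by (intro continuous_intros step_right_cont X_right_cont)

lemma injection_rat:
  assumes "\<omega> \<in> space M" "0 \<le> t"
  shows "injection c n e t \<omega> = (SUP s\<in>insert t ({0..t} \<inter> \<rat>). ennreal (cumdiv n e s \<omega> - (c + X s \<omega>)))"
  unfolding injection_def by (rule runmax_rat[OF net_right_cont assms(2)]) (use assms in auto)

lemma injection_measurable:
  assumes N: "space N = space M" and t: "0 \<le> t"
    and X: "\<And>s. 0 \<le> s \<Longrightarrow> s \<le> t \<Longrightarrow> X s \<in> borel_measurable N"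
    and e: "\<And>k. real k / 2 ^ n \<le> t \<Longrightarrow> e k \<in> borel_measurable N"
  shows "injection c n e t \<in> borel_measurable N"
proof -
  have "(\<lambda>\<omega>. SUP s\<in>insert t ({0..t} \<inter> \<rat>). ennreal (cumdiv n e s \<omega> - (c + X s \<omega>))) \<in> borel_measurable N"
  proof (rule borel_measurable_SUP)
    show "countable (insert t ({0..t} \<inter> \<rat>))" by (intro countable_insert countable_Int2 countable_rat)
    fix s assume "s \<in> insert t ({0..t} \<inter> \<rat>)"
    then have s: "0 \<le> s" "s \<le> t" using t by auto
    have "(\<lambda>\<omega>. cumdiv n e s \<omega> - (c + X s \<omega>)) \<in> borel_measurable N"
      using s by (intro borel_measurable_diff borel_measurable_add X cumdiv_measurable e) auto
    then show "(\<lambda>\<omega>. ennreal (cumdiv n e s \<omega> - (c + X s \<omega>))) \<in> borel_measurable N" by simp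
  qed
  also have "?this \<longleftrightarrow> injection c n e t \<in> borel_measurable N"
    by (rule measurable_cong) (use N injection_rat t in auto)
  finally show ?thesis .
qed

lemma Xmax_finite: "\<omega> \<in> space M \<Longrightarrow> Xmax t \<omega> < \<top>"
proof -
  assume "\<omega> \<in> space M"
  then obtain B where "\<forall>s\<in>{0..t}. \<bar>X s \<omega>\<bar> \<le> B" using X_bdd by blast
  then show ?thesis unfolding Xmax_def by (intro runmax_finite[of t _ B]) simp
qed

lemma X_le_Xmax: "0 \<le> s \<Longrightarrow> s \<le> t \<Longrightarrow> ennreal \<bar>X s \<omega>\<bar> \<le> Xmax t \<omega>"
  unfolding Xmax_def by (rule runmax_upper)

lemma injection_le:
  assumes e: "\<And>s. cumdiv n e s \<omega> \<le> B"
  shows "injection c n e t \<omega> \<le> ennreal (\<bar>B\<bar> + \<bar>c\<bar>) + Xmax t \<omega>"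
  unfolding injection_def
proof (rule runmax_least)
  fix s assume s: "0 \<le> s" "s \<le> t"
  have "ennreal (cumdiv n e s \<omega> - (c + X s \<omega>)) \<le> ennreal ((\<bar>B\<bar> + \<bar>c\<bar>) + \<bar>X s \<omega>\<bar>)"
    using e[of s] by (intro ennreal_leI) linarith
  also have "\<dots> = ennreal (\<bar>B\<bar> + \<bar>c\<bar>) + ennreal \<bar>X s \<omega>\<bar>" by (rule ennreal_plus) auto
  also have "\<dots> \<le> ennreal (\<bar>B\<bar> + \<bar>c\<bar>) + Xmax t \<omega>" by (intro add_mono order_refl X_le_Xmax s)
  finally show "ennreal (cumdiv n e s \<omega> - (c + X s \<omega>)) \<le> ennreal (\<bar>B\<bar> + \<bar>c\<bar>) + Xmax t \<omega>" .
qed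

lemma injection_finite:
  assumes "\<omega> \<in> space M" "\<And>k. 0 \<le> e k \<omega>"
  shows "injection c n e t \<omega> < \<top>"
proof -
  have "injection c n e t \<omega> \<le> ennreal (\<bar>cumdiv n e t \<omega>\<bar> + \<bar>c\<bar>) + Xmax t \<omega>"
    unfolding injection_def
  proof (rule runmax_least)
    fix s assume s: "0 \<le> s" "s \<le> t"
    have "cumdiv n e s \<omega> \<le> cumdiv n e t \<omega>" by (rule incr_path_mono[OF cumdiv_incr s(2)]) (rule assms)
    then have "ennreal (cumdiv n e s \<omega> - (c + X s \<omega>)) \<le> ennreal ((\<bar>cumdiv n e t \<omega>\<bar> + \<bar>c\<bar>) + \<bar>X s \<omega>\<bar>)"
      by (intro ennreal_leI) linarith
    also have "\<dots> = ennreal (\<bar>cumdiv n e t \<omega>\<bar> + \<bar>c\<bar>) + ennreal \<bar>X s \<omega>\<bar>" by (rule ennreal_plus) auto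
    also have "\<dots> \<le> ennreal (\<bar>cumdiv n e t \<omega>\<bar> + \<bar>c\<bar>) + Xmax t \<omega>" by (intro add_mono order_refl X_le_Xmax s)
    finally show "ennreal (cumdiv n e s \<omega> - (c + X s \<omega>)) \<le> ennreal (\<bar>cumdiv n e t \<omega>\<bar> + \<bar>c\<bar>) + Xmax t \<omega>" .
  qed
  also have "\<dots> < \<top>" using Xmax_finite[OF assms(1)] by (simp add: ennreal_add_less_top)
  finally show ?thesis .
qed

lemma injection_incr:
  assumes "\<omega> \<in> space M" "\<And>k. 0 \<le> e k \<omega>"
  shows "incr_path (\<lambda>t. enn2real (injection c n e t \<omega>))"
  unfolding injection_def
  by (rule runmax_incr_path) (use net_right_cont injection_finite[of \<omega> e] assms in \<open>auto simp: injection_def\<close>)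

lemma stieltjes_cong: "(\<And>t. 0 \<le> t \<Longrightarrow> A t = B t) \<Longrightarrow> stieltjes d A = stieltjes d B"
  by (intro antisym stieltjes_mono) auto

lemma stieltjes_D_inj:
  assumes "\<omega> \<in> space M" "\<And>k. 0 \<le> e k \<omega>"
  shows "stieltjes d (\<lambda>t. injection c n e t \<omega>) = stieltjes d (\<lambda>t. ennreal (enn2real (injection c n e t \<omega>)))"
  by (rule stieltjes_cong) (use injection_finite[where e = e, OF assms] in simp)

section \<open>Expectations of Stieltjes integrals\<close>

lemma stieltjes_D_meas:
  assumes "\<And>t. 0 \<le> t \<Longrightarrow> A t \<in> borel_measurable M"
  shows "(\<lambda>\<omega>. stieltjes (\<lambda>t. D t \<omega>) (\<lambda>t. A t \<omega>)) \<in> borel_measurable M"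
  by (rule stieltjes_measurable) (use assms D_meas in auto)

text \<open>An arithmetic-geometric series, convergent because its ratio \<open>exp (- q)\<close> is
  below 1.\<close>

lemma suminf_linear_exp: "(\<Sum>i. ennreal ((a + b * real (Suc i)) * exp (- q * real i))) < \<top>"
proof -
  define r where "r = exp (- q)"
  have r: "0 < r" "r < 1" using q_pos by (auto simp: r_def)
  have e: "exp (- q * real i) = r ^ i" for i by (simp add: r_def exp_of_nat_mult[symmetric] mult.commute)
  have "summable (\<lambda>i. r ^ i)" using r by (intro summable_geometric) auto
  moreover have "summable (\<lambda>i. real (Suc i) * r ^ i)"
    using geometric_deriv_sums[of r] r by (auto simp: sums_iff)
  ultimately have "summable (\<lambda>i. \<bar>a\<bar> * r ^ i + \<bar>b\<bar> * (real (Suc i) * r ^ i))"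
    by (intro summable_add summable_mult)
  moreover have "0 \<le> \<bar>a\<bar> * r ^ i + \<bar>b\<bar> * (real (Suc i) * r ^ i)" for i using r by simp
  ultimately have "(\<Sum>i. ennreal (\<bar>a\<bar> * r ^ i + \<bar>b\<bar> * (real (Suc i) * r ^ i))) \<noteq> \<top>"
    by (intro ennreal_suminf_neq_top)
  moreover have "(\<Sum>i. ennreal ((a + b * real (Suc i)) * exp (- q * real i)))
      \<le> (\<Sum>i. ennreal (\<bar>a\<bar> * r ^ i + \<bar>b\<bar> * (real (Suc i) * r ^ i)))"
  proof (intro suminf_le summableI ennreal_leI)
    fix i
    have "(a + b * real (Suc i)) * r ^ i \<le> (\<bar>a\<bar> + \<bar>b\<bar> * real (Suc i)) * r ^ i"
      using r by (intro mult_right_mono add_mono) auto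
    then show "(a + b * real (Suc i)) * exp (- q * real i) \<le> \<bar>a\<bar> * r ^ i + \<bar>b\<bar> * (real (Suc i) * r ^ i)"
      unfolding e by (simp add: algebra_simps)
  qed
  ultimately show ?thesis by (simp add: less_top[symmetric] top_unique) (metis top_unique)
qed

lemma abel_sum_0_le: "abel_sum 0 (Suc N) (\<lambda>t. D t \<omega>) A \<le> (\<Sum>i<Suc N. A (real (Suc i)) * ennreal (exp (- q * real i)))"
proof -
  have "abel_sum 0 (Suc N) (\<lambda>t. D t \<omega>) A
      = (\<Sum>j\<in>{1..<Suc N}. A (real j) * (D (real (j - 1)) \<omega> - D (real j) \<omega>)) + A (real (Suc N)) * D (real N) \<omega>"
    by (simp add: abel_sum_def)
  also have "\<dots> \<le> (\<Sum>j\<in>{1..<Suc N}. A (real j) * ennreal (exp (- q * real (j - 1)))) + A (real (Suc N)) * ennreal (exp (- q * real N))"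
    by (intro add_mono sum_mono mult_left_mono D_le_exp order_trans[OF diff_le_self_ennreal D_le_exp]) auto
  also have "(\<Sum>j\<in>{1..<Suc N}. A (real j) * ennreal (exp (- q * real (j - 1))))
      = (\<Sum>i<N. A (real (Suc i)) * ennreal (exp (- q * real i)))"
    by (rule sum.reindex_bij_witness[of _ Suc "\<lambda>j. j - 1"]) auto
  finally show ?thesis by simp
qed

text \<open>Mesh-one Abel sums dominate the integral, and the discount factor decays at least like
  the exponential with rate \<open>q\<close>, against which linear growth is summable.\<close>

lemma stieltjes_growth:
  fixes A :: "real \<Rightarrow> 'w \<Rightarrow> real"
  assumes inc: "\<And>\<omega>. \<omega> \<in> space M \<Longrightarrow> incr_path (\<lambda>t. A t \<omega>)"
    and m: "\<And>t. 0 \<le> t \<Longrightarrow> A t \<in> borel_measurable M"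
    and g: "\<And>N. (\<integral>\<^sup>+\<omega>. ennreal (A (real N) \<omega>) \<partial>P z) \<le> ennreal (a + b * real N)"
  shows "expected_disc z A < \<top>"
proof -
  have "expected_disc z A
      \<le> (\<integral>\<^sup>+\<omega>. (\<Sum>i. ennreal (A (real (Suc i)) \<omega>) * ennreal (exp (- q * real i))) \<partial>P z)"
  proof (rule nn_integral_mono)
    fix \<omega> assume "\<omega> \<in> space (P z)"
    then have \<omega>: "\<omega> \<in> space M" by simp
    interpret stieltjes_integrand "\<lambda>t. D t \<omega>" by (rule D_integrand[OF \<omega>])
    have "disc_int A \<omega> \<le> (SUP N. abel_sum 0 (Suc N) (\<lambda>t. D t \<omega>) (\<lambda>t. ennreal (A t \<omega>)))"
      by (rule stieltjes_le_SUP_abel_sum[OF inc[OF \<omega>]])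
    also have "\<dots> \<le> (\<Sum>i. ennreal (A (real (Suc i)) \<omega>) * ennreal (exp (- q * real i)))"
      by (intro SUP_least order_trans[OF abel_sum_0_le] sum_le_suminf summableI) auto
    finally show "disc_int A \<omega>
      \<le> (\<Sum>i. ennreal (A (real (Suc i)) \<omega>) * ennreal (exp (- q * real i)))" .
  qed
  also have "\<dots> = (\<Sum>i. \<integral>\<^sup>+\<omega>. ennreal (A (real (Suc i)) \<omega>) * ennreal (exp (- q * real i)) \<partial>P z)"
    by (rule nn_integral_suminf) (use m in \<open>simp add: M_measD del: of_nat_Suc\<close>)
  also have "\<dots> = (\<Sum>i. (\<integral>\<^sup>+\<omega>. ennreal (A (real (Suc i)) \<omega>) \<partial>P z) * ennreal (exp (- q * real i)))"
    by (intro suminf_cong nn_integral_multc) (use m in \<open>simp add: M_measD del: of_nat_Suc\<close>)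
  also have "\<dots> \<le> (\<Sum>i. ennreal (a + b * real (Suc i)) * ennreal (exp (- q * real i)))"
    by (intro suminf_le summableI mult_right_mono g) auto
  also have "\<dots> = (\<Sum>i. ennreal ((a + b * real (Suc i)) * exp (- q * real i)))"
    by (intro suminf_cong ennreal_mult''[symmetric]) simp
  also have "\<dots> < \<top>" by (rule suminf_linear_exp)
  finally show ?thesis .
qed

lemma nn_integral_abel_sum:
  assumes A: "\<forall>t\<ge>0. A t \<in> borel_measurable M"
  shows "(\<integral>\<^sup>+\<omega>. abel_sum m N (\<lambda>t. D t \<omega>) (\<lambda>t. A t \<omega>) \<partial>P z)
     = (\<Sum>j\<in>{1..<N * 2 ^ m}. \<integral>\<^sup>+\<omega>. A (real j / 2 ^ m) \<omega> * (D (real (j - 1) / 2 ^ m) \<omega> - D (real j / 2 ^ m) \<omega>) \<partial>P z)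
       + (\<integral>\<^sup>+\<omega>. A (real N) \<omega> * D (real (N * 2 ^ m - 1) / 2 ^ m) \<omega> \<partial>P z)"
proof -
  have AP: "A t \<in> borel_measurable (P z)" if "0 \<le> t" for t using A that by (auto intro: M_measD)
  have DP: "D t \<in> borel_measurable (P z)" for t by (rule M_measD[OF D_meas])
  show ?thesis
    unfolding abel_sum_def
    by (subst nn_integral_add, (intro borel_measurable_sum borel_measurable_times_ennreal
          borel_measurable_minus_ennreal AP DP; simp)+, subst nn_integral_sum)
       (intro borel_measurable_times_ennreal borel_measurable_minus_ennreal AP DP, simp_all)
qed

text \<open>Testing against bounded functionals of the whole path suffices to compare expected
  discounted integrals, since the discount factor is such a functional.\<close>
lemma expected_stieltjes_mono:
  fixes A B :: "real \<Rightarrow> 'w \<Rightarrow> real"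
  assumes A: "\<And>\<omega>. \<omega> \<in> space M \<Longrightarrow> incr_path (\<lambda>t. A t \<omega>)" "\<And>t. 0 \<le> t \<Longrightarrow> A t \<in> borel_measurable M"
      "\<And>N. (\<integral>\<^sup>+\<omega>. ennreal (A (real N) \<omega>) \<partial>P z) < \<top>"
    and B: "\<And>\<omega>. \<omega> \<in> space M \<Longrightarrow> incr_path (\<lambda>t. B t \<omega>)" "\<And>t. 0 \<le> t \<Longrightarrow> B t \<in> borel_measurable M"
      "\<And>N. (\<integral>\<^sup>+\<omega>. ennreal (B (real N) \<omega>) \<partial>P z) < \<top>"
    and le: "\<And>t H. 0 \<le> t \<Longrightarrow> H \<in> borel_measurable Ginf \<Longrightarrow> (\<And>\<omega>. \<omega> \<in> space M \<Longrightarrow> H \<omega> \<le> 1) \<Longrightarrow>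
      (\<integral>\<^sup>+\<omega>. ennreal (A t \<omega>) * H \<omega> \<partial>P z) \<le> (\<integral>\<^sup>+\<omega>. ennreal (B t \<omega>) * H \<omega> \<partial>P z)"
  shows "expected_disc z A
      \<le> expected_disc z B"
proof -
  define I where "I C N \<omega> = (\<integral>\<^sup>+t\<in>{0..real (Suc N)}. D t \<omega> \<partial>interval_measure (\<lambda>t. C t \<omega>))"
    for C :: "real \<Rightarrow> 'w \<Rightarrow> real" and N \<omega>
  let ?S = "\<lambda>C m N \<omega>. abel_sum m (Suc N) (\<lambda>t. D t \<omega>) (\<lambda>t. ennreal (C t \<omega>))"
  have facts: "I C N \<in> borel_measurable (P z) \<and> (\<lambda>m. \<integral>\<^sup>+\<omega>. ?S C m N \<omega> \<partial>P z) \<longlonglongrightarrow> (\<integral>\<^sup>+\<omega>. I C N \<omega> \<partial>P z)"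
    if C: "\<And>\<omega>. \<omega> \<in> space M \<Longrightarrow> incr_path (\<lambda>t. C t \<omega>)" "\<And>t. 0 \<le> t \<Longrightarrow> C t \<in> borel_measurable M"
      "\<And>N. (\<integral>\<^sup>+\<omega>. ennreal (C (real N) \<omega>) \<partial>P z) < \<top>" for C N
  proof -
    have Sm: "?S C m N \<in> borel_measurable (P z)" for m
      by (rule abel_sum_measurable) (use M_measD[OF D_meas] M_measD[OF C(2)] in auto)
    have lim: "(\<lambda>m. ?S C m N \<omega>) \<longlonglongrightarrow> I C N \<omega>" if \<omega>: "\<omega> \<in> space M" for \<omega>
    proof -
      interpret stieltjes_integrand "\<lambda>t. D t \<omega>" by (rule D_integrand[OF \<omega>])
      show ?thesis unfolding I_def by (rule abel_sum_tendsto[OF C(1)[OF \<omega>]]) simp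
    qed
    have Im: "I C N \<in> borel_measurable (P z)"
      by (rule borel_measurable_LIMSEQ_order[OF _ Sm]) (use lim in simp)
    moreover have "(\<lambda>m. \<integral>\<^sup>+\<omega>. ?S C m N \<omega> \<partial>P z) \<longlonglongrightarrow> (\<integral>\<^sup>+\<omega>. I C N \<omega> \<partial>P z)"
    proof (rule nn_integral_dominated_convergence[where w = "\<lambda>\<omega>. ennreal (C (real (Suc N)) \<omega>)"])
      show "AE \<omega> in P z. ?S C m N \<omega> \<le> ennreal (C (real (Suc N)) \<omega>)" for m
      proof (rule AE_I2)
        fix \<omega> assume "\<omega> \<in> space (P z)"
        then have \<omega>: "\<omega> \<in> space M" by simp
        interpret stieltjes_integrand "\<lambda>t. D t \<omega>" by (rule D_integrand[OF \<omega>])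
        show "?S C m N \<omega> \<le> ennreal (C (real (Suc N)) \<omega>)" by (rule abel_sum_le[OF C(1)[OF \<omega>]]) simp
      qed
      show "(\<integral>\<^sup>+\<omega>. ennreal (C (real (Suc N)) \<omega>) \<partial>P z) < \<infinity>" using C(3)[of "Suc N"] by simp
      show "AE \<omega> in P z. (\<lambda>m. ?S C m N \<omega>) \<longlonglongrightarrow> I C N \<omega>" using lim by (intro AE_I2) simp
      show "(\<lambda>\<omega>. ennreal (C (real (Suc N)) \<omega>)) \<in> borel_measurable (P z)"
        using M_measD[OF C(2)[of "real (Suc N)"]] by simp
    qed (use Sm Im in auto)
    ultimately show ?thesis by blast
  qed
  have fA: "I A N \<in> borel_measurable (P z)" "(\<lambda>m. \<integral>\<^sup>+\<omega>. ?S A m N \<omega> \<partial>P z) \<longlonglongrightarrow> (\<integral>\<^sup>+\<omega>. I A N \<omega> \<partial>P z)" for N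
    using facts[of A N] A by simp_all
  have fB: "I B N \<in> borel_measurable (P z)" "(\<lambda>m. \<integral>\<^sup>+\<omega>. ?S B m N \<omega> \<partial>P z) \<longlonglongrightarrow> (\<integral>\<^sup>+\<omega>. I B N \<omega> \<partial>P z)" for N
    using facts[of B N] B by simp_all
  have SUP: "expected_disc z C = (SUP N. \<integral>\<^sup>+\<omega>. I C N \<omega> \<partial>P z)"
    if C: "\<And>\<omega>. \<omega> \<in> space M \<Longrightarrow> incr_path (\<lambda>t. C t \<omega>)" "\<And>N. I C N \<in> borel_measurable (P z)" for C
  proof -
    have "expected_disc z C = (\<integral>\<^sup>+\<omega>. (SUP N. I C N \<omega>) \<partial>P z)"
    proof (rule nn_integral_cong)
      fix \<omega> assume "\<omega> \<in> space (P z)"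
      then have \<omega>: "\<omega> \<in> space M" by simp
      interpret stieltjes_integrand "\<lambda>t. D t \<omega>" by (rule D_integrand[OF \<omega>])
      show "disc_int C \<omega> = (SUP N. I C N \<omega>)"
        unfolding stieltjes_eq[OF C(1)[OF \<omega>]] integral_Ici_SUP[OF C(1)[OF \<omega>]] I_def ..
    qed
    also have "\<dots> = (SUP N. \<integral>\<^sup>+\<omega>. I C N \<omega> \<partial>P z)"
      by (rule nn_integral_monotone_convergence_SUP[OF _ C(2)])
         (auto simp: incseq_def le_fun_def I_def indicator_def intro!: nn_integral_mono)
    finally show ?thesis .
  qed
  have "(\<integral>\<^sup>+\<omega>. I A N \<omega> \<partial>P z) \<le> (\<integral>\<^sup>+\<omega>. I B N \<omega> \<partial>P z)" for N
  proof (rule LIMSEQ_le[OF fA(2) fB(2)], intro exI allI impI)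
    fix m :: nat
    \<comment> \<open>An Abel sum pairs path values with \<open>D s - D t\<close> or with
      \<open>D t\<close>. These are at most 1 and functionals of the whole path, so
      \<open>le\<close> applies to each term.\<close>
    have D1: "D t \<omega> \<le> 1" for t \<omega> by (simp add: disc_eq discount_le_1)
    have D2: "D s \<omega> - D t \<omega> \<le> 1" for s t \<omega> by (rule order_trans[OF diff_le_self_ennreal D1])
    have Am: "\<forall>t\<ge>0. (\<lambda>\<omega>. ennreal (A t \<omega>)) \<in> borel_measurable M"
      "\<forall>t\<ge>0. (\<lambda>\<omega>. ennreal (B t \<omega>)) \<in> borel_measurable M"
      using A(2) B(2) by auto
    show "(\<integral>\<^sup>+\<omega>. ?S A m N \<omega> \<partial>P z) \<le> (\<integral>\<^sup>+\<omega>. ?S B m N \<omega> \<partial>P z)"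
      unfolding nn_integral_abel_sum[of "\<lambda>t \<omega>. ennreal (A t \<omega>)", OF Am(1)]
        nn_integral_abel_sum[of "\<lambda>t \<omega>. ennreal (B t \<omega>)", OF Am(2)]
      by (intro add_mono sum_mono le borel_measurable_minus_ennreal D_meas_Ginf D1 D2) auto
  qed
  then show ?thesis
    unfolding SUP[of A, OF A(1) fA(1), simplified] SUP[of B, OF B(1) fB(1), simplified] by (rule SUP_mono')
qed

end

lemma ennreal_add_right_le_cancel:
  fixes a b c :: ennreal
  assumes "a + c \<le> b + c" "c < \<top>"
  shows "a \<le> b"
proof -
  have "c + a \<le> c + b" using assms(1) by (simp only: add.commute[of c])
  then show ?thesis using assms(2) by (auto simp: ennreal_add_left_cancel_le)
qed

context bailout
begin

lemma divs_G_F: "divs n G e \<Longrightarrow> divs n F e"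
  unfolding divs_def by (auto intro: G_measD_F)

lemma divs_meas: "divs n F e \<Longrightarrow> e k \<in> borel_measurable M"
  unfolding divs_def by (auto intro: F_measD[of "real k / 2 ^ n"])

lemma divs_meas_F: "divs n F e \<Longrightarrow> real k / 2 ^ n \<le> t \<Longrightarrow> e k \<in> borel_measurable (F t)"
  unfolding divs_def by (auto intro: F_meas_mono[of "real k / 2 ^ n"])

lemma divs_meas_Ginf: "divs n G e \<Longrightarrow> e k \<in> borel_measurable Ginf"
  unfolding divs_def by (auto intro: G_measD_Ginf)

lemma divs_bounds:
  assumes "divs n \<G> e"
  obtains K :: nat where
    "\<And>k \<omega>. \<omega> \<in> space M \<Longrightarrow> 0 \<le> e k \<omega> \<and> e k \<omega> \<le> real K \<and> (K < k \<longrightarrow> e k \<omega> = 0)"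
  using assms unfolding divs_def by blast

lemma divs_nonneg: "divs n \<G> e \<Longrightarrow> \<omega> \<in> space M \<Longrightarrow> 0 \<le> e k \<omega>"
  unfolding divs_def by blast

lemma cumdiv_meas: "divs n F e \<Longrightarrow> cumdiv n e t \<in> borel_measurable M"
  by (rule cumdiv_measurable) (rule divs_meas)

lemma injection_meas: "divs n F e \<Longrightarrow> 0 \<le> t \<Longrightarrow> injection c n e t \<in> borel_measurable M"
  by (rule injection_measurable) (auto intro: X_meas divs_meas)

lemma injection_growth:
  assumes "divs n F e"
  obtains a b where "\<And>N. (\<integral>\<^sup>+\<omega>. injection c n e (real N) \<omega> \<partial>P z) \<le> ennreal (a + b * real N)"
proof -
  obtain K :: nat where K: "\<And>k \<omega>. \<omega> \<in> space M \<Longrightarrow> 0 \<le> e k \<omega> \<and> e k \<omega> \<le> real K \<and> (K < k \<longrightarrow> e k \<omega> = 0)"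
    using divs_bounds[OF assms] by blast
  obtain C where C: "0 \<le> C" "\<And>x y N. (\<integral>\<^sup>+\<omega>. Xmax (real N) \<omega> \<partial>P (x, y)) \<le> ennreal (\<bar>x\<bar> + C * real N)"
    using Xmax_linear by blast
  obtain x y where z: "z = (x, y)" by (cases z)
  define B where "B = \<bar>real K * real K\<bar> + \<bar>c\<bar>"
  have B: "0 \<le> B" by (simp add: B_def)
  have "(\<integral>\<^sup>+\<omega>. injection c n e (real N) \<omega> \<partial>P z) \<le> ennreal ((B + \<bar>x\<bar>) + C * real N)" for N
  proof -
    have "(\<integral>\<^sup>+\<omega>. injection c n e (real N) \<omega> \<partial>P z) \<le> (\<integral>\<^sup>+\<omega>. ennreal B + Xmax (real N) \<omega> \<partial>P z)"
      unfolding B_def by (intro nn_integral_mono injection_le cumdiv_bound K) simp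
    also have "\<dots> = (\<integral>\<^sup>+\<omega>. ennreal B \<partial>P z) + (\<integral>\<^sup>+\<omega>. Xmax (real N) \<omega> \<partial>P z)"
      by (intro nn_integral_add M_measD Xmax_meas) auto
    also have "\<dots> \<le> ennreal B + ennreal (\<bar>x\<bar> + C * real N)"
      using C(2)[where x = x and y = y and N = N] by (simp add: z add_left_mono)
    also have "\<dots> = ennreal ((B + \<bar>x\<bar>) + C * real N)"
      using B C(1) by (subst ennreal_plus[symmetric]) (auto simp: add.assoc)
    finally show ?thesis .
  qed
  then show thesis by (rule that)
qed

lemma cost_eq:
  assumes "divs n F e"
  shows "cost z c n e = (\<integral>\<^sup>+\<omega>. stieltjes (\<lambda>t. D t \<omega>) (\<lambda>t. ennreal (enn2real (injection c n e t \<omega>))) \<partial>P z)"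
  unfolding cost_def
  by (rule nn_integral_cong, rule stieltjes_D_inj) (use divs_nonneg[OF assms] in auto)

lemma injection_enn2real:
  assumes "divs n F e"
  shows "(\<integral>\<^sup>+\<omega>. ennreal (enn2real (injection c n e t \<omega>)) * H \<omega> \<partial>P z) = (\<integral>\<^sup>+\<omega>. injection c n e t \<omega> * H \<omega> \<partial>P z)"
  by (rule nn_integral_cong) (use injection_finite divs_nonneg[OF assms] in simp)

lemma cost_finite:
  assumes e: "divs n F e"
  shows "cost z c n e < \<top>"
proof -
  obtain a b where ab: "\<And>N. (\<integral>\<^sup>+\<omega>. injection c n e (real N) \<omega> \<partial>P z) \<le> ennreal (a + b * real N)"
    using injection_growth[OF e] by blast
  show ?thesis
    unfolding cost_eq[OF e]
  proof (rule stieltjes_growth)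
    show "incr_path (\<lambda>t. enn2real (injection c n e t \<omega>))" if "\<omega> \<in> space M" for \<omega>
      by (rule injection_incr[where e = e, OF that]) (rule divs_nonneg[OF e that])
    show "(\<lambda>\<omega>. enn2real (injection c n e t \<omega>)) \<in> borel_measurable M" if "0 \<le> t" for t
      using injection_meas[OF e that] by simp
    show "(\<integral>\<^sup>+\<omega>. ennreal (enn2real (injection c n e (real N) \<omega>)) \<partial>P z) \<le> ennreal (a + b * real N)" for N
      using ab[of N] injection_enn2real[OF e, where c = c and t = "real N" and H = "\<lambda>_. 1" and z = z] by simp
  qed
qed

lemma gain_finite:
  assumes e: "divs n F e"
  shows "gain z n e < \<top>"
proof -
  obtain K :: nat where K: "\<And>k \<omega>. \<omega> \<in> space M \<Longrightarrow> 0 \<le> e k \<omega> \<and> e k \<omega> \<le> real K \<and> (K < k \<longrightarrow> e k \<omega> = 0)"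
    using divs_bounds[OF e] by blast
  have "gain z n e \<le> (\<integral>\<^sup>+\<omega>. ennreal (real K * real K) \<partial>P z)"
    unfolding gain_def
  proof (rule nn_integral_mono)
    fix \<omega> assume "\<omega> \<in> space (P z)"
    then have \<omega>: "\<omega> \<in> space M" by simp
    interpret stieltjes_integrand "\<lambda>t. D t \<omega>" by (rule D_integrand[OF \<omega>])
    show "disc_int (cumdiv n e) \<omega> \<le> ennreal (real K * real K)"
      by (intro stieltjes_le_bound cumdiv_incr cumdiv_bound) (use K \<omega> in auto)
  qed
  also have "\<dots> < \<top>" by (simp add: ennreal_mult_less_top)
  finally show ?thesis .
qed

section \<open>Reduction to the natural filtration\<close>

text \<open>Where \<open>f s\<close> is the largest its own bound is used, elsewhere the induction
  hypothesis. The dividing event lies in \<open>Ginf\<close>, so \<open>H\<close> restricted to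
  either side is again a permitted test function.\<close>

lemma test_SUP_finite:
  fixes f :: "real \<Rightarrow> 'w \<Rightarrow> ennreal"
  assumes T: "finite T" and f: "\<And>s. s \<in> T \<Longrightarrow> f s \<in> borel_measurable Ginf"
    and R: "R \<in> borel_measurable M"
    and le: "\<And>s H. s \<in> T \<Longrightarrow> H \<in> borel_measurable Ginf \<Longrightarrow> (\<And>\<omega>. \<omega> \<in> space M \<Longrightarrow> H \<omega> \<le> 1) \<Longrightarrow>
       (\<integral>\<^sup>+\<omega>. f s \<omega> * H \<omega> \<partial>P z) \<le> (\<integral>\<^sup>+\<omega>. R \<omega> * H \<omega> \<partial>P z)"
    and H: "H \<in> borel_measurable Ginf" "\<And>\<omega>. \<omega> \<in> space M \<Longrightarrow> H \<omega> \<le> 1"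
  shows "(\<integral>\<^sup>+\<omega>. (SUP s\<in>T. f s \<omega>) * H \<omega> \<partial>P z) \<le> (\<integral>\<^sup>+\<omega>. R \<omega> * H \<omega> \<partial>P z)"
  using T f le H
proof (induction T arbitrary: H rule: finite_induct)
  case empty
  then show ?case by (simp add: bot_ennreal)
next
  case (insert s T)
  define g where "g \<omega> = (SUP s\<in>T. f s \<omega>)" for \<omega>
  have gm: "g \<in> borel_measurable Ginf"
    unfolding g_def using insert.prems(1) insert.hyps(1)
    by (intro borel_measurable_SUP) (auto intro: countable_finite)
  have fm: "f s \<in> borel_measurable Ginf" using insert.prems(1) by simp
  define A where "A = {\<omega> \<in> space Ginf. g \<omega> \<le> f s \<omega>}"
  have A: "A \<in> sets Ginf" unfolding A_def using gm fm by measurable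
  define H1 where "H1 \<omega> = H \<omega> * indicator A \<omega>" for \<omega>
  define H2 where "H2 \<omega> = H \<omega> * indicator (space Ginf - A) \<omega>" for \<omega>
  have Hm: "H1 \<in> borel_measurable Ginf" "H2 \<in> borel_measurable Ginf"
    unfolding H1_def H2_def
    by (intro borel_measurable_times_ennreal insert.prems(3) borel_measurable_indicator sets.compl_sets A)+
  have Hle: "H1 \<omega> \<le> 1" "H2 \<omega> \<le> 1" if "\<omega> \<in> space M" for \<omega>
    using insert.prems(4)[OF that] by (auto simp: H1_def H2_def indicator_def)
  have PM: "h \<in> borel_measurable (P z)" if "h \<in> borel_measurable Ginf" for h :: "'w \<Rightarrow> ennreal"
    by (rule M_measD[OF Ginf_measD[OF that]])
  have RP: "R \<in> borel_measurable (P z)" by (rule M_measD[OF R])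
  have "(\<integral>\<^sup>+\<omega>. (SUP s\<in>insert s T. f s \<omega>) * H \<omega> \<partial>P z) = (\<integral>\<^sup>+\<omega>. f s \<omega> * H1 \<omega> + g \<omega> * H2 \<omega> \<partial>P z)"
  proof (rule nn_integral_cong)
    fix \<omega> assume "\<omega> \<in> space (P z)"
    then have \<omega>: "\<omega> \<in> space M" by simp
    have "(SUP s\<in>insert s T. f s \<omega>) = max (f s \<omega>) (g \<omega>)" by (simp add: g_def sup_max)
    then show "(SUP s\<in>insert s T. f s \<omega>) * H \<omega> = f s \<omega> * H1 \<omega> + g \<omega> * H2 \<omega>"
      using \<omega> by (cases "g \<omega> \<le> f s \<omega>")
        (simp_all add: H1_def H2_def A_def max.absorb1 max.absorb2 not_le less_imp_le)
  qed
  also have "\<dots> = (\<integral>\<^sup>+\<omega>. f s \<omega> * H1 \<omega> \<partial>P z) + (\<integral>\<^sup>+\<omega>. g \<omega> * H2 \<omega> \<partial>P z)"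
    by (intro nn_integral_add borel_measurable_times_ennreal PM fm gm Hm)
  also have "\<dots> \<le> (\<integral>\<^sup>+\<omega>. R \<omega> * H1 \<omega> \<partial>P z) + (\<integral>\<^sup>+\<omega>. R \<omega> * H2 \<omega> \<partial>P z)"
  proof (rule add_mono)
    show "(\<integral>\<^sup>+\<omega>. f s \<omega> * H1 \<omega> \<partial>P z) \<le> (\<integral>\<^sup>+\<omega>. R \<omega> * H1 \<omega> \<partial>P z)"
      by (rule insert.prems(2)) (use Hm Hle in auto)
    show "(\<integral>\<^sup>+\<omega>. g \<omega> * H2 \<omega> \<partial>P z) \<le> (\<integral>\<^sup>+\<omega>. R \<omega> * H2 \<omega> \<partial>P z)"
      unfolding g_def by (rule insert.IH) (use insert.prems(1,2) Hm Hle in auto)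
  qed
  also have "\<dots> = (\<integral>\<^sup>+\<omega>. R \<omega> * H1 \<omega> + R \<omega> * H2 \<omega> \<partial>P z)"
    by (intro nn_integral_add[symmetric] borel_measurable_times_ennreal PM RP Hm)
  also have "\<dots> = (\<integral>\<^sup>+\<omega>. R \<omega> * H \<omega> \<partial>P z)"
  proof (rule nn_integral_cong)
    fix \<omega> assume "\<omega> \<in> space (P z)"
    then show "R \<omega> * H1 \<omega> + R \<omega> * H2 \<omega> = R \<omega> * H \<omega>"
      by (cases "\<omega> \<in> A") (simp_all add: H1_def H2_def)
  qed
  finally show ?case .
qed

text \<open>Monotone convergence along the finite parts of an enumeration.\<close>

lemma test_SUP_countable:
  fixes f :: "real \<Rightarrow> 'w \<Rightarrow> ennreal"
  assumes T: "countable T" "T \<noteq> {}" and f: "\<And>s. s \<in> T \<Longrightarrow> f s \<in> borel_measurable Ginf"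
    and R: "R \<in> borel_measurable M"
    and le: "\<And>s H. s \<in> T \<Longrightarrow> H \<in> borel_measurable Ginf \<Longrightarrow> (\<And>\<omega>. \<omega> \<in> space M \<Longrightarrow> H \<omega> \<le> 1) \<Longrightarrow>
       (\<integral>\<^sup>+\<omega>. f s \<omega> * H \<omega> \<partial>P z) \<le> (\<integral>\<^sup>+\<omega>. R \<omega> * H \<omega> \<partial>P z)"
    and H: "H \<in> borel_measurable Ginf" "\<And>\<omega>. \<omega> \<in> space M \<Longrightarrow> H \<omega> \<le> 1"
  shows "(\<integral>\<^sup>+\<omega>. (SUP s\<in>T. f s \<omega>) * H \<omega> \<partial>P z) \<le> (\<integral>\<^sup>+\<omega>. R \<omega> * H \<omega> \<partial>P z)"
proof -
  define T' where "T' i = from_nat_into T ` {..i}" for i :: nat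
  have T'T: "T' i \<subseteq> T" "finite (T' i)" for i using from_nat_into[OF T(2)] by (auto simp: T'_def)
  have "(\<Union>i. T' i) = range (from_nat_into T)" unfolding T'_def by blast
  then have UN: "T = (\<Union>i. T' i)" using range_from_nat_into[OF T(2,1)] by simp
  define g where "g i \<omega> = (SUP s\<in>T' i. f s \<omega>) * H \<omega>" for i \<omega>
  have gm: "g i \<in> borel_measurable (P z)" for i
    unfolding g_def using T'T[of i] f H(1)
    by (intro M_measD Ginf_measD borel_measurable_times_ennreal borel_measurable_SUP) (auto intro: countable_finite)
  have "(SUP s\<in>T. f s \<omega>) * H \<omega> = (SUP i. g i \<omega>)" for \<omega>
  proof -
    have "(SUP s\<in>T. f s \<omega>) = (SUP i. SUP s\<in>T' i. f s \<omega>)" unfolding UN by (rule SUP_UNION)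
    then show ?thesis by (simp add: g_def SUP_mult_right_ennreal)
  qed
  then have "(\<integral>\<^sup>+\<omega>. (SUP s\<in>T. f s \<omega>) * H \<omega> \<partial>P z) = (\<integral>\<^sup>+\<omega>. (SUP i. g i \<omega>) \<partial>P z)" by simp
  also have "\<dots> = (SUP i. \<integral>\<^sup>+\<omega>. g i \<omega> \<partial>P z)"
  proof (rule nn_integral_monotone_convergence_SUP[OF _ gm])
    show "incseq g"
      unfolding incseq_def le_fun_def g_def T'_def by (auto intro!: mult_right_mono SUP_subset_mono)
  qed
  also have "\<dots> \<le> (\<integral>\<^sup>+\<omega>. R \<omega> * H \<omega> \<partial>P z)"
    unfolding g_def
    by (intro SUP_least test_SUP_finite[OF T'T(2) _ R] f le H subsetD[OF T'T(1)])
  finally show ?thesis .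
qed

lemma X_integrable: "0 \<le> s \<Longrightarrow> (\<integral>\<^sup>+\<omega>. ennreal \<bar>X s \<omega>\<bar> \<partial>P z) < \<top>"
proof -
  assume s: "0 \<le> s"
  obtain x y where z: "z = (x, y)" by (cases z)
  obtain C where "0 \<le> C" and C: "\<And>x y N. (\<integral>\<^sup>+\<omega>. Xmax (real N) \<omega> \<partial>P (x, y)) \<le> ennreal (\<bar>x\<bar> + C * real N)"
    using Xmax_linear by blast
  obtain N where N: "s \<le> real N" using real_arch_simple by blast
  have "(\<integral>\<^sup>+\<omega>. ennreal \<bar>X s \<omega>\<bar> \<partial>P z) \<le> (\<integral>\<^sup>+\<omega>. Xmax (real N) \<omega> \<partial>P z)"
    by (intro nn_integral_mono X_le_Xmax s N)
  also have "\<dots> \<le> ennreal (\<bar>x\<bar> + C * real N)" unfolding z by (rule C)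
  also have "\<dots> < \<top>" by simp
  finally show ?thesis .
qed

text \<open>Jensen's inequality in tested form: each time \<open>s\<close> is treated separately,
  and \<open>test_SUP_countable\<close> assembles the running supremum. This works because
  \<open>X\<close> and the projected dividends are \<open>Ginf\<close>-measurable.\<close>

lemma injection_jensen:
  assumes e': "\<And>k. e' k \<in> borel_measurable Ginf" "\<And>k \<omega>. \<omega> \<in> space M \<Longrightarrow> 0 \<le> e' k \<omega>"
    and e: "\<And>k. e k \<in> borel_measurable M" "\<And>k \<omega>. \<omega> \<in> space M \<Longrightarrow> 0 \<le> e k \<omega>"
    and eq: "\<And>s H. H \<in> borel_measurable Ginf \<Longrightarrow>
      (\<integral>\<^sup>+\<omega>. ennreal (cumdiv n e' s \<omega>) * H \<omega> \<partial>P z) = (\<integral>\<^sup>+\<omega>. ennreal (cumdiv n e s \<omega>) * H \<omega> \<partial>P z)"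
    and t: "0 \<le> t"
    and H: "H \<in> borel_measurable Ginf" "\<And>\<omega>. \<omega> \<in> space M \<Longrightarrow> H \<omega> \<le> 1"
  shows "(\<integral>\<^sup>+\<omega>. injection c n e' t \<omega> * H \<omega> \<partial>P z) \<le> (\<integral>\<^sup>+\<omega>. injection c n e t \<omega> * H \<omega> \<partial>P z)"
proof -
  have PM: "h \<in> borel_measurable (P z)" if "h \<in> borel_measurable Ginf" for h :: "'w \<Rightarrow> ennreal"
    by (rule M_measD[OF Ginf_measD[OF that]])
  have Rm: "injection c n e t \<in> borel_measurable M"
    by (rule injection_measurable) (use t e(1) X_meas in auto)
  have cm': "cumdiv n e' s \<in> borel_measurable Ginf" for s by (rule cumdiv_measurable) (rule e')
  have cm: "cumdiv n e s \<in> borel_measurable M" for s by (rule cumdiv_measurable) (rule e)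
  have nn: "0 \<le> cumdiv n e s \<omega>" "0 \<le> cumdiv n e' s \<omega>" if "\<omega> \<in> space M" for s \<omega>
    using incr_path_nonneg[OF cumdiv_incr] e(2) e'(2) that by blast+
  have W: "(\<lambda>\<omega>. c + X s \<omega>) \<in> borel_measurable Ginf" if "0 \<le> s" for s
    using X_meas_Ginf[OF that] by simp
  have single: "(\<integral>\<^sup>+\<omega>. ennreal (cumdiv n e' s \<omega> - (c + X s \<omega>)) * H \<omega> \<partial>P z) \<le> (\<integral>\<^sup>+\<omega>. injection c n e t \<omega> * H \<omega> \<partial>P z)"
    if s: "0 \<le> s" "s \<le> t" and H: "H \<in> borel_measurable Ginf" "\<And>\<omega>. \<omega> \<in> space M \<Longrightarrow> H \<omega> \<le> 1" for s H
  proof -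
    define w where "w \<omega> = c + X s \<omega>" for \<omega>
    have wm: "w \<in> borel_measurable Ginf" unfolding w_def[abs_def] by (rule W[OF s(1)])
    \<comment> \<open>On \<open>A\<close> the positive part equals the difference itself, which is
      linear in the dividends, so that \<open>eq\<close> becomes applicable.\<close>
    define A where "A = {\<omega> \<in> space Ginf. w \<omega> \<le> cumdiv n e' s \<omega>}"
    have A: "A \<in> sets Ginf" unfolding A_def using wm cm'[of s] by measurable
    define H' where "H' \<omega> = H \<omega> * indicator A \<omega>" for \<omega>
    have H'm: "H' \<in> borel_measurable Ginf" unfolding H'_def using A H(1) by (auto intro!: borel_measurable_times_ennreal)
    have H'le: "H' \<omega> \<le> H \<omega>" for \<omega> by (simp add: H'_def indicator_def)
    \<comment> \<open>Positive and negative parts of the uncontrolled capital: in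
      \<open>ennreal\<close> the difference has to be expressed through sums.\<close>
    define wp where "wp \<omega> = ennreal (w \<omega>)" for \<omega>
    define wn where "wn \<omega> = ennreal (- w \<omega>)" for \<omega>
    have wpm: "wp \<in> borel_measurable Ginf" "wn \<in> borel_measurable Ginf"
      unfolding wp_def wn_def using wm by measurable
    have dm: "(\<lambda>\<omega>. ennreal (cumdiv n e' s \<omega> - w \<omega>)) \<in> borel_measurable (P z)"
      "(\<lambda>\<omega>. ennreal (cumdiv n e' s \<omega>)) \<in> borel_measurable (P z)"
      "(\<lambda>\<omega>. ennreal (cumdiv n e s \<omega>)) \<in> borel_measurable (P z)"
    proof -
      show "(\<lambda>\<omega>. ennreal (cumdiv n e' s \<omega> - w \<omega>)) \<in> borel_measurable (P z)"
        using wm cm'[of s] by (intro PM) simp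
      show "(\<lambda>\<omega>. ennreal (cumdiv n e' s \<omega>)) \<in> borel_measurable (P z)"
        using cm'[of s] by (intro PM) simp
      show "(\<lambda>\<omega>. ennreal (cumdiv n e s \<omega>)) \<in> borel_measurable (P z)"
        using cm[of s] by (intro M_measD) simp
    qed
    note meas = dm PM[OF wpm(1)] PM[OF wpm(2)] PM[OF H'm] M_measD[OF Rm]
    \<comment> \<open>\<open>wp\<close> is added to both sides and cancelled at the end, which
      requires a finite integral.\<close>
    have fin: "(\<integral>\<^sup>+\<omega>. wp \<omega> * H' \<omega> \<partial>P z) < \<top>"
    proof -
      have "(\<integral>\<^sup>+\<omega>. wp \<omega> * H' \<omega> \<partial>P z) \<le> (\<integral>\<^sup>+\<omega>. ennreal \<bar>c\<bar> + ennreal \<bar>X s \<omega>\<bar> \<partial>P z)"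
      proof (rule nn_integral_mono)
        fix \<omega> assume "\<omega> \<in> space (P z)"
        then have "H' \<omega> \<le> 1" using H'le[of \<omega>] H(2)[of \<omega>] by (simp add: order_trans)
        then have "wp \<omega> * H' \<omega> \<le> wp \<omega> * 1" by (rule mult_left_mono) simp
        also have "wp \<omega> \<le> ennreal (\<bar>c\<bar> + \<bar>X s \<omega>\<bar>)" unfolding wp_def w_def by (intro ennreal_leI) linarith
        finally show "wp \<omega> * H' \<omega> \<le> ennreal \<bar>c\<bar> + ennreal \<bar>X s \<omega>\<bar>" by simp
      qed
      also have "\<dots> = ennreal \<bar>c\<bar> + (\<integral>\<^sup>+\<omega>. ennreal \<bar>X s \<omega>\<bar> \<partial>P z)"
        using M_measD[OF X_meas[OF s(1)]] by (subst nn_integral_add) auto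
      also have "\<dots> < \<top>" using X_integrable[OF s(1)] by (simp add: ennreal_add_less_top)
      finally show ?thesis .
    qed
    have "(\<integral>\<^sup>+\<omega>. ennreal (cumdiv n e' s \<omega> - w \<omega>) * H' \<omega> \<partial>P z) + (\<integral>\<^sup>+\<omega>. wp \<omega> * H' \<omega> \<partial>P z)
        = (\<integral>\<^sup>+\<omega>. ennreal (cumdiv n e' s \<omega> - w \<omega>) * H' \<omega> + wp \<omega> * H' \<omega> \<partial>P z)"
      by (intro nn_integral_add[symmetric] borel_measurable_times_ennreal meas)
    also have "\<dots> = (\<integral>\<^sup>+\<omega>. ennreal (cumdiv n e' s \<omega>) * H' \<omega> + wn \<omega> * H' \<omega> \<partial>P z)"
    proof (rule nn_integral_cong)
      fix \<omega> assume \<omega>: "\<omega> \<in> space (P z)"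
      show "ennreal (cumdiv n e' s \<omega> - w \<omega>) * H' \<omega> + wp \<omega> * H' \<omega>
          = ennreal (cumdiv n e' s \<omega>) * H' \<omega> + wn \<omega> * H' \<omega>"
      proof (cases "\<omega> \<in> A")
        case True
        then have le: "w \<omega> \<le> cumdiv n e' s \<omega>" by (simp add: A_def)
        have "ennreal (cumdiv n e' s \<omega> - w \<omega>) + wp \<omega> = ennreal (cumdiv n e' s \<omega>) + wn \<omega>"
        proof (cases "0 \<le> w \<omega>")
          case True
          then show ?thesis using le by (simp add: wp_def wn_def ennreal_neg ennreal_plus[symmetric] del: ennreal_plus)
        next
          case False
          then show ?thesis using le nn(2)[of \<omega> s] \<omega>
            by (simp add: wp_def wn_def ennreal_neg ennreal_plus[symmetric] del: ennreal_plus)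
        qed
        then show ?thesis by (simp add: distrib_right[symmetric])
      qed (simp add: H'_def)
    qed
    also have "\<dots> = (\<integral>\<^sup>+\<omega>. ennreal (cumdiv n e' s \<omega>) * H' \<omega> \<partial>P z) + (\<integral>\<^sup>+\<omega>. wn \<omega> * H' \<omega> \<partial>P z)"
      by (intro nn_integral_add borel_measurable_times_ennreal meas)
    also have "\<dots> = (\<integral>\<^sup>+\<omega>. ennreal (cumdiv n e s \<omega>) * H' \<omega> \<partial>P z) + (\<integral>\<^sup>+\<omega>. wn \<omega> * H' \<omega> \<partial>P z)"
      by (simp only: eq[OF H'm])
    also have "\<dots> = (\<integral>\<^sup>+\<omega>. ennreal (cumdiv n e s \<omega>) * H' \<omega> + wn \<omega> * H' \<omega> \<partial>P z)"
      by (intro nn_integral_add[symmetric] borel_measurable_times_ennreal meas)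
    also have "\<dots> \<le> (\<integral>\<^sup>+\<omega>. injection c n e t \<omega> * H' \<omega> + wp \<omega> * H' \<omega> \<partial>P z)"
    proof (rule nn_integral_mono)
      fix \<omega> assume \<omega>: "\<omega> \<in> space (P z)"
      have i: "ennreal (cumdiv n e s \<omega> - w \<omega>) \<le> injection c n e t \<omega>"
        unfolding injection_def w_def using runmax_upper[OF s, of "\<lambda>s. cumdiv n e s \<omega> - (c + X s \<omega>)"] by simp
      have "ennreal (cumdiv n e s \<omega>) + wn \<omega> \<le> ennreal (cumdiv n e s \<omega> - w \<omega>) + wp \<omega>"
      proof (cases "0 \<le> w \<omega>")
        case True
        then have "ennreal (cumdiv n e s \<omega>) \<le> ennreal (max 0 (cumdiv n e s \<omega> - w \<omega>) + w \<omega>)"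
          by (intro ennreal_leI) simp
        also have "\<dots> = ennreal (cumdiv n e s \<omega> - w \<omega>) + ennreal (w \<omega>)"
          using True by (subst ennreal_plus) (auto simp: max_def ennreal_neg)
        finally show ?thesis using True by (simp add: wp_def wn_def ennreal_neg)
      next
        case False
        then show ?thesis using nn(1)[of \<omega> s] \<omega>
          by (simp add: wp_def wn_def ennreal_neg ennreal_plus[symmetric] del: ennreal_plus)
      qed
      also have "\<dots> \<le> injection c n e t \<omega> + wp \<omega>" by (intro add_mono i order_refl)
      finally have "(ennreal (cumdiv n e s \<omega>) + wn \<omega>) * H' \<omega> \<le> (injection c n e t \<omega> + wp \<omega>) * H' \<omega>"
        by (rule mult_right_mono) simp
      then show "ennreal (cumdiv n e s \<omega>) * H' \<omega> + wn \<omega> * H' \<omega> \<le> injection c n e t \<omega> * H' \<omega> + wp \<omega> * H' \<omega>"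
        by (simp add: distrib_right)
    qed
    also have "\<dots> = (\<integral>\<^sup>+\<omega>. injection c n e t \<omega> * H' \<omega> \<partial>P z) + (\<integral>\<^sup>+\<omega>. wp \<omega> * H' \<omega> \<partial>P z)"
      by (intro nn_integral_add borel_measurable_times_ennreal meas)
    finally have "(\<integral>\<^sup>+\<omega>. ennreal (cumdiv n e' s \<omega> - w \<omega>) * H' \<omega> \<partial>P z) \<le> (\<integral>\<^sup>+\<omega>. injection c n e t \<omega> * H' \<omega> \<partial>P z)"
      using fin by (rule ennreal_add_right_le_cancel)
    also have "\<dots> \<le> (\<integral>\<^sup>+\<omega>. injection c n e t \<omega> * H \<omega> \<partial>P z)"
      by (intro nn_integral_mono mult_left_mono H'le) simp
    also have "(\<integral>\<^sup>+\<omega>. ennreal (cumdiv n e' s \<omega> - w \<omega>) * H' \<omega> \<partial>P z)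
        = (\<integral>\<^sup>+\<omega>. ennreal (cumdiv n e' s \<omega> - (c + X s \<omega>)) * H \<omega> \<partial>P z)"
      by (rule nn_integral_cong) (auto simp: H'_def A_def indicator_def ennreal_neg w_def)
    finally show ?thesis .
  qed
  have "(\<integral>\<^sup>+\<omega>. injection c n e' t \<omega> * H \<omega> \<partial>P z)
      = (\<integral>\<^sup>+\<omega>. (SUP s\<in>insert t ({0..t} \<inter> \<rat>). ennreal (cumdiv n e' s \<omega> - (c + X s \<omega>))) * H \<omega> \<partial>P z)"
    by (rule nn_integral_cong) (simp add: injection_rat[OF _ t])
  also have "\<dots> \<le> (\<integral>\<^sup>+\<omega>. injection c n e t \<omega> * H \<omega> \<partial>P z)"
  proof (rule test_SUP_countable[OF _ _ _ Rm])
    show "countable (insert t ({0..t} \<inter> \<rat>))" by (intro countable_insert countable_Int2 countable_rat)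
    show "(\<lambda>\<omega>. ennreal (cumdiv n e' s \<omega> - (c + X s \<omega>))) \<in> borel_measurable Ginf"
      if "s \<in> insert t ({0..t} \<inter> \<rat>)" for s
      using W[of s] cm'[of s] that t by auto
    show "(\<integral>\<^sup>+\<omega>. ennreal (cumdiv n e' s \<omega> - (c + X s \<omega>)) * H \<omega> \<partial>P z) \<le> (\<integral>\<^sup>+\<omega>. injection c n e t \<omega> * H \<omega> \<partial>P z)"
      if "s \<in> insert t ({0..t} \<inter> \<rat>)" "H \<in> borel_measurable Ginf" "\<And>\<omega>. \<omega> \<in> space M \<Longrightarrow> H \<omega> \<le> 1" for s H
      by (rule single) (use that t in auto)
  qed (use H in auto)
  finally show ?thesis .
qed

lemma projection:
  assumes e: "divs n F e"
  obtains e' where "divs n G e'" "gain z n e' = gain z n e" "cost z c n e' \<le> cost z c n e"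
proof -
  obtain K :: nat where K: "\<And>k \<omega>. \<omega> \<in> space M \<Longrightarrow> 0 \<le> e k \<omega> \<and> e k \<omega> \<le> real K \<and> (K < k \<longrightarrow> e k \<omega> = 0)"
    using divs_bounds[OF e] by blast
  \<comment> \<open>Each dividend is projected at its own date. The bound is 0 beyond the horizon
    \<open>K\<close>, which forces the projected dividends to vanish there.\<close>
  define proj where "proj k e' \<longleftrightarrow> e' \<in> borel_measurable (G (real k / 2 ^ n)) \<and>
      (\<forall>\<omega>\<in>space M. 0 \<le> e' \<omega> \<and> e' \<omega> \<le> (if K < k then 0 else real K)) \<and>
      (\<forall>H. H \<in> borel_measurable Ginf \<longrightarrow>
         (\<integral>\<^sup>+\<omega>. ennreal (e' \<omega>) * H \<omega> \<partial>P z) = (\<integral>\<^sup>+\<omega>. ennreal (e k \<omega>) * H \<omega> \<partial>P z))" for k e'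
  have "\<exists>e'. proj k e'" for k
  proof -
    show ?thesis
    proof (rule projection_exists[where t = "real k / 2 ^ n" and \<xi> = "e k"
          and K = "if K < k then 0 else real K" and z = z])
      show "e k \<in> borel_measurable (F (real k / 2 ^ n))" using e by (simp add: divs_def)
      show "0 \<le> e k \<omega> \<and> e k \<omega> \<le> (if K < k then 0 else real K)" if "\<omega> \<in> space M" for \<omega>
        using K[OF that, of k] by simp
      fix e'' assume a: "e'' \<in> borel_measurable (G (real k / 2 ^ n))"
        "\<And>\<omega>. \<omega> \<in> space M \<Longrightarrow> 0 \<le> e'' \<omega> \<and> e'' \<omega> \<le> (if K < k then 0 else real K)"
        "\<And>H :: 'w \<Rightarrow> ennreal. H \<in> borel_measurable Ginf \<Longrightarrow>
           (\<integral>\<^sup>+\<omega>. ennreal (e'' \<omega>) * H \<omega> \<partial>P z) = (\<integral>\<^sup>+\<omega>. ennreal (e k \<omega>) * H \<omega> \<partial>P z)"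
      show ?thesis
        unfolding proj_def
      proof (rule exI[of _ e''], intro conjI ballI allI impI)
        show "0 \<le> e'' \<omega>" "e'' \<omega> \<le> (if K < k then 0 else real K)" if "\<omega> \<in> space M" for \<omega>
          using a(2)[OF that] by simp_all
      qed (rule a, (rule a, assumption)?)+
    qed simp
  qed
  then have "\<forall>k. \<exists>e'. proj k e'" ..
  from choice[OF this] obtain e' where "\<forall>k. proj k (e' k)" ..
  then have e': "\<And>k. e' k \<in> borel_measurable (G (real k / 2 ^ n))"
    "\<And>k \<omega>. \<omega> \<in> space M \<Longrightarrow> 0 \<le> e' k \<omega> \<and> e' k \<omega> \<le> (if K < k then 0 else real K)"
    "\<And>k H. H \<in> borel_measurable Ginf \<Longrightarrow>
       (\<integral>\<^sup>+\<omega>. ennreal (e' k \<omega>) * H \<omega> \<partial>P z) = (\<integral>\<^sup>+\<omega>. ennreal (e k \<omega>) * H \<omega> \<partial>P z)"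
    unfolding proj_def by blast+
  have divs': "divs n G e'"
    unfolding divs_def
  proof (intro conjI allI exI[of _ K] ballI)
    show "e' k \<in> borel_measurable (G (real k / 2 ^ n))" for k by (rule e')
    fix k \<omega> assume "\<omega> \<in> space M"
    from e'(2)[OF this, of k] show "0 \<le> e' k \<omega>" "e' k \<omega> \<le> real K" "K < k \<longrightarrow> e' k \<omega> = 0"
      by (auto split: if_splits)
  qed
  note divsF' = divs_G_F[OF divs']
  have eM: "e k \<in> borel_measurable (P z)" "e' k \<in> borel_measurable (P z)" for k
    using M_measD[OF divs_meas[OF e]] M_measD[OF divs_meas[OF divsF']] by auto
  have eq: "(\<integral>\<^sup>+\<omega>. ennreal (cumdiv n e' s \<omega>) * H \<omega> \<partial>P z) = (\<integral>\<^sup>+\<omega>. ennreal (cumdiv n e s \<omega>) * H \<omega> \<partial>P z)"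
    if H: "H \<in> borel_measurable Ginf" for s H
  proof -
    have HP: "H \<in> borel_measurable (P z)" by (rule M_measD[OF Ginf_measD[OF H]])
    have "(\<integral>\<^sup>+\<omega>. ennreal (cumdiv n f s \<omega>) * H \<omega> \<partial>P z) = (\<Sum>k\<in>{1..grid_index n s}. \<integral>\<^sup>+\<omega>. ennreal (f k \<omega>) * H \<omega> \<partial>P z)"
      if f: "\<And>k \<omega>. \<omega> \<in> space M \<Longrightarrow> 0 \<le> f k \<omega>" "\<And>k. f k \<in> borel_measurable (P z)" for f
    proof -
      have "(\<integral>\<^sup>+\<omega>. ennreal (cumdiv n f s \<omega>) * H \<omega> \<partial>P z) = (\<integral>\<^sup>+\<omega>. (\<Sum>k\<in>{1..grid_index n s}. ennreal (f k \<omega>) * H \<omega>) \<partial>P z)"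
        by (rule nn_integral_cong) (simp add: cumdiv_def step_eq sum_ennreal f(1) sum_distrib_right[symmetric])
      also have "\<dots> = (\<Sum>k\<in>{1..grid_index n s}. \<integral>\<^sup>+\<omega>. ennreal (f k \<omega>) * H \<omega> \<partial>P z)"
        by (rule nn_integral_sum) (use f(2) HP in simp)
      finally show ?thesis .
    qed
    from this[of e'] this[of e] show ?thesis using e' K H eM by (simp cong: sum.cong)
  qed
  have cfin: "(\<integral>\<^sup>+\<omega>. ennreal (cumdiv n f t \<omega>) \<partial>P z) < \<top>" if f: "divs n F f" for f t
  proof -
    obtain K' :: nat where K': "\<And>k \<omega>. \<omega> \<in> space M \<Longrightarrow> 0 \<le> f k \<omega> \<and> f k \<omega> \<le> real K' \<and> (K' < k \<longrightarrow> f k \<omega> = 0)"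
      using divs_bounds[OF f] by blast
    have "(\<integral>\<^sup>+\<omega>. ennreal (cumdiv n f t \<omega>) \<partial>P z) \<le> (\<integral>\<^sup>+\<omega>. ennreal (real K' * real K') \<partial>P z)"
      by (intro nn_integral_mono ennreal_leI cumdiv_bound K') simp
    also have "\<dots> < \<top>" by (simp add: ennreal_mult_less_top)
    finally show ?thesis .
  qed
  have cinc: "incr_path (\<lambda>t. cumdiv n f t \<omega>)" if "divs n F f" "\<omega> \<in> space M" for f \<omega>
    by (rule cumdiv_incr) (rule divs_nonneg[OF that])
  \<comment> \<open>Equal pairings with all path functionals give the comparison in both
    directions.\<close>
  have "gain z n e' = gain z n e"
    unfolding gain_def
    by (intro antisym expected_stieltjes_mono cinc cumdiv_meas cfin e divsF') (simp_all add: eq)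
  moreover have "cost z c n e' \<le> cost z c n e"
    unfolding cost_eq[OF e] cost_eq[OF divsF']
  proof (rule expected_stieltjes_mono)
    have inc: "incr_path (\<lambda>t. enn2real (injection c n f t \<omega>))" if "divs n F f" "\<omega> \<in> space M" for f \<omega>
      by (rule injection_incr[where e = f, OF that(2)]) (rule divs_nonneg[OF that])
    have m: "(\<lambda>\<omega>. enn2real (injection c n f t \<omega>)) \<in> borel_measurable M" if "divs n F f" "0 \<le> t" for f t
      using injection_meas[OF that] by simp
    have fin: "(\<integral>\<^sup>+\<omega>. ennreal (enn2real (injection c n f (real N) \<omega>)) \<partial>P z) < \<top>" if f: "divs n F f" for f N
    proof -
      obtain a b where "\<And>N. (\<integral>\<^sup>+\<omega>. injection c n f (real N) \<omega> \<partial>P z) \<le> ennreal (a + b * real N)"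
        using injection_growth[OF f] by blast
      from le_less_trans[OF this[of N]] show ?thesis
        using injection_enn2real[OF f, where c = c and t = "real N" and H = "\<lambda>_. 1" and z = z] by simp
    qed
    show "\<And>\<omega>. \<omega> \<in> space M \<Longrightarrow> incr_path (\<lambda>t. enn2real (injection c n e' t \<omega>))" by (rule inc[OF divsF'])
    show "\<And>\<omega>. \<omega> \<in> space M \<Longrightarrow> incr_path (\<lambda>t. enn2real (injection c n e t \<omega>))" by (rule inc[OF e])
    show "\<And>t. 0 \<le> t \<Longrightarrow> (\<lambda>\<omega>. enn2real (injection c n e' t \<omega>)) \<in> borel_measurable M" by (rule m[OF divsF'])
    show "\<And>t. 0 \<le> t \<Longrightarrow> (\<lambda>\<omega>. enn2real (injection c n e t \<omega>)) \<in> borel_measurable M" by (rule m[OF e])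
    show "\<And>N. (\<integral>\<^sup>+\<omega>. ennreal (enn2real (injection c n e' (real N) \<omega>)) \<partial>P z) < \<top>" by (rule fin[OF divsF'])
    show "\<And>N. (\<integral>\<^sup>+\<omega>. ennreal (enn2real (injection c n e (real N) \<omega>)) \<partial>P z) < \<top>" by (rule fin[OF e])
    fix t :: real and H :: "'w \<Rightarrow> ennreal"
    assume "0 \<le> t" "H \<in> borel_measurable Ginf" "\<And>\<omega>. \<omega> \<in> space M \<Longrightarrow> H \<omega> \<le> 1"
    then show "(\<integral>\<^sup>+\<omega>. ennreal (enn2real (injection c n e' t \<omega>)) * H \<omega> \<partial>P z)
        \<le> (\<integral>\<^sup>+\<omega>. ennreal (enn2real (injection c n e t \<omega>)) * H \<omega> \<partial>P z)"
      unfolding injection_enn2real[OF e] injection_enn2real[OF divsF']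
      by (intro injection_jensen eq divs_meas_Ginf[OF divs'] divs_meas[OF e] divs_nonneg[OF e] divs_nonneg[OF divs'])
  qed
  ultimately show thesis using divs' by (rule that[rotated])
qed


section \<open>Transfer between starting points\<close>

lemma gain_cong: "(\<And>k \<omega>. \<omega> \<in> space M \<Longrightarrow> e k \<omega> = e' k \<omega>) \<Longrightarrow> gain z n e = gain z n e'"
  and cost_cong: "(\<And>k \<omega>. \<omega> \<in> space M \<Longrightarrow> e k \<omega> = e' k \<omega>) \<Longrightarrow> cost z c n e = cost z c n e'"
  unfolding gain_def cost_def injection_def cumdiv_def by (rule nn_integral_cong, simp)+

text \<open>Gain and cost are integrals of functionals \<Psi> of the path, so
  \<open>traj_law\<close> applies. For the injections, translating the path by \<open>x\<close>
  amounts to raising the capital from \<open>c\<close> to \<open>c + x\<close>; the discount factor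
  reads only \<open>Y\<close> and does not move.\<close>

lemma law_transfer:
  assumes \<psi>: "\<And>k. \<psi> k \<in> borel_measurable S"
  shows "gain (x, y) n (\<lambda>k \<omega>. \<psi> k (traj \<omega>)) = gain (0, y) n (\<lambda>k \<omega>. \<psi> k (shift x (traj \<omega>)))"
    and "cost (x, y) c n (\<lambda>k \<omega>. \<psi> k (traj \<omega>)) = cost (0, y) (c + x) n (\<lambda>k \<omega>. \<psi> k (shift x (traj \<omega>)))"
proof -
  define Lw where "Lw w t = step n (\<lambda>k. \<psi> k w) t" for w t
  define Rw where "Rw w t = (SUP s\<in>insert t ({0..t} \<inter> \<rat>). ennreal (Lw w s - (c + fst (w s))))" for w :: "real \<Rightarrow> real \<times> 'e" and t
  define \<Psi> where "\<Psi> A w = stieltjes (\<lambda>t. Dfun t (Ypart w)) (A w)" for A :: "(real \<Rightarrow> real \<times> 'e) \<Rightarrow> real \<Rightarrow> ennreal" and w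
  have Lm: "(\<lambda>w. Lw w t) \<in> borel_measurable S" for t
    unfolding Lw_def step_def by (rule borel_measurable_sum) (rule \<psi>)
  have Rm: "(\<lambda>w. Rw w t) \<in> borel_measurable S" if t: "0 \<le> t" for t
    unfolding Rw_def
  proof (rule borel_measurable_SUP)
    show "countable (insert t ({0..t} \<inter> \<rat>))" by (intro countable_insert countable_Int2 countable_rat)
    fix s assume "s \<in> insert t ({0..t} \<inter> \<rat>)"
    then have "(\<lambda>w. fst (w s)) \<in> borel_measurable S"
      using t by (intro measurable_compose[OF coord_meas fst_borel]) auto
    then show "(\<lambda>w. ennreal (Lw w s - (c + fst (w s)))) \<in> borel_measurable S"
      using Lm[of s] by simp
  qed
  have dm: "(\<lambda>w. Dfun t (Ypart w)) \<in> borel_measurable S" for t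
    by (rule measurable_compose[OF Ypart_meas Dfun_meas])
  have \<Psi>L: "\<Psi> (\<lambda>w t. ennreal (Lw w t)) \<in> borel_measurable S"
    unfolding \<Psi>_def by (rule stieltjes_measurable) (use dm Lm in simp_all)
  have \<Psi>R: "\<Psi> Rw \<in> borel_measurable S"
    unfolding \<Psi>_def by (rule stieltjes_measurable) (use dm Rm in simp_all)
  have D1: "(\<lambda>t. D t \<omega>) = (\<lambda>t. Dfun t (Ypart (traj \<omega>)))"
    and D2: "(\<lambda>t. D t \<omega>) = (\<lambda>t. Dfun t (Ypart (shift x (traj \<omega>))))" if "\<omega> \<in> space M" for \<omega>
    using that by (simp_all add: Ypart_traj Ypart_shift Dfun_eq)
  have "gain (x, y) n (\<lambda>k \<omega>. \<psi> k (traj \<omega>)) = (\<integral>\<^sup>+\<omega>. \<Psi> (\<lambda>w t. ennreal (Lw w t)) (traj \<omega>) \<partial>P (x, y))"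
    unfolding gain_def by (rule nn_integral_cong) (simp add: D1 \<Psi>_def Lw_def cumdiv_def)
  also have "\<dots> = (\<integral>\<^sup>+\<omega>. \<Psi> (\<lambda>w t. ennreal (Lw w t)) (shift x (traj \<omega>)) \<partial>P (0, y))"
    by (rule traj_law[OF \<Psi>L])
  also have "\<dots> = gain (0, y) n (\<lambda>k \<omega>. \<psi> k (shift x (traj \<omega>)))"
    unfolding gain_def by (rule nn_integral_cong) (simp add: D2 \<Psi>_def Lw_def cumdiv_def)
  finally show "gain (x, y) n (\<lambda>k \<omega>. \<psi> k (traj \<omega>)) = gain (0, y) n (\<lambda>k \<omega>. \<psi> k (shift x (traj \<omega>)))" .
  have R1: "stieltjes (\<lambda>t. D t \<omega>) (\<lambda>t. injection c n (\<lambda>k \<omega>. \<psi> k (traj \<omega>)) t \<omega>) = \<Psi> Rw (traj \<omega>)"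
    if \<omega>: "\<omega> \<in> space M" for \<omega>
    unfolding \<Psi>_def D1[OF \<omega>]
  proof (rule stieltjes_cong)
    fix t :: real assume t: "0 \<le> t"
    show "injection c n (\<lambda>k \<omega>. \<psi> k (traj \<omega>)) t \<omega> = Rw (traj \<omega>) t"
      unfolding injection_rat[OF \<omega> t] Rw_def
      by (rule SUP_cong) (use t in \<open>auto simp: cumdiv_def Lw_def\<close>)
  qed
  have R2: "stieltjes (\<lambda>t. D t \<omega>) (\<lambda>t. injection (c + x) n (\<lambda>k \<omega>. \<psi> k (shift x (traj \<omega>))) t \<omega>) = \<Psi> Rw (shift x (traj \<omega>))"
    if \<omega>: "\<omega> \<in> space M" for \<omega>
    unfolding \<Psi>_def D2[OF \<omega>]
  proof (rule stieltjes_cong)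
    fix t :: real assume t: "0 \<le> t"
    show "injection (c + x) n (\<lambda>k \<omega>. \<psi> k (shift x (traj \<omega>))) t \<omega> = Rw (shift x (traj \<omega>)) t"
      unfolding injection_rat[OF \<omega> t] Rw_def
      by (rule SUP_cong) (use t in \<open>auto simp: cumdiv_def Lw_def shift_def shift1_def algebra_simps\<close>)
  qed
  have "cost (x, y) c n (\<lambda>k \<omega>. \<psi> k (traj \<omega>)) = (\<integral>\<^sup>+\<omega>. \<Psi> Rw (traj \<omega>) \<partial>P (x, y))"
    unfolding cost_def by (rule nn_integral_cong) (simp add: R1)
  also have "\<dots> = (\<integral>\<^sup>+\<omega>. \<Psi> Rw (shift x (traj \<omega>)) \<partial>P (0, y))" by (rule traj_law[OF \<Psi>R])
  also have "\<dots> = cost (0, y) (c + x) n (\<lambda>k \<omega>. \<psi> k (shift x (traj \<omega>)))"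
    unfolding cost_def by (rule nn_integral_cong) (simp add: R2)
  finally show "cost (x, y) c n (\<lambda>k \<omega>. \<psi> k (traj \<omega>)) = cost (0, y) (c + x) n (\<lambda>k \<omega>. \<psi> k (shift x (traj \<omega>)))" .
qed

text \<open>Factoring through the path up to the payment date, and no further, is what keeps the
  translated dividends adapted.\<close>

lemma divs_factor:
  assumes e: "divs n G e"
  obtains \<psi> where "\<And>k. \<psi> k \<in> borel_measurable S" "\<And>k \<omega>. \<omega> \<in> space M \<Longrightarrow> e k \<omega> = \<psi> k (traj \<omega>)"
    "\<And>x. divs n G (\<lambda>k \<omega>. \<psi> k (shift x (traj \<omega>)))"
proof -
  obtain K :: nat where K: "\<And>k \<omega>. \<omega> \<in> space M \<Longrightarrow> 0 \<le> e k \<omega> \<and> e k \<omega> \<le> real K \<and> (K < k \<longrightarrow> e k \<omega> = 0)"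
    using divs_bounds[OF e] by blast
  define T where "T k = real k / 2 ^ n" for k :: nat
  define S' where "S' k = Pi\<^sub>M {0..T k} (\<lambda>_. borel :: (real \<times> 'e) measure)" for k
  have "\<exists>\<phi>\<in>borel_measurable (S' k). \<forall>\<omega>\<in>space M. ennreal (e k \<omega>) = \<phi> (\<lambda>s\<in>{0..T k}. (X s \<omega>, Y s \<omega>))" for k
  proof -
    have "e k \<in> borel_measurable (G (T k))" using e by (simp add: divs_def T_def)
    then have "(\<lambda>\<omega>. ennreal (e k \<omega>)) \<in> borel_measurable (G (T k))" by simp
    from doob_dynkin_ennreal[OF this[unfolded G_def] restr_space] show ?thesis unfolding S'_def .
  qed
  then have "\<forall>k. \<exists>\<phi>. \<phi> \<in> borel_measurable (S' k) \<and> (\<forall>\<omega>\<in>space M. ennreal (e k \<omega>) = \<phi> (\<lambda>s\<in>{0..T k}. (X s \<omega>, Y s \<omega>)))"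
    by blast
  from choice[OF this] obtain \<phi> where \<phi>': "\<forall>k. \<phi> k \<in> borel_measurable (S' k) \<and>
     (\<forall>\<omega>\<in>space M. ennreal (e k \<omega>) = \<phi> k (\<lambda>s\<in>{0..T k}. (X s \<omega>, Y s \<omega>)))" ..
  then have \<phi>: "\<phi> k \<in> borel_measurable (S' k)" for k by blast
  have \<phi>e: "ennreal (e k \<omega>) = \<phi> k (\<lambda>s\<in>{0..T k}. (X s \<omega>, Y s \<omega>))" if "\<omega> \<in> space M" for k \<omega>
    using \<phi>' that by blast
  \<comment> \<open>A translated path need not be a path of the process, and there \<phi> is
    unconstrained; clipping enforces bound and horizon on it as well.\<close>
  define \<psi> where "\<psi> k w = (if K < k then 0 else min (real K) (enn2real (\<phi> k (restrict w {0..T k}))))" for k w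
  have restr: "(\<lambda>w. restrict w {0..T k}) \<in> measurable S (S' k)" for k
    unfolding S'_def by (rule measurable_restrict_subset) auto
  have "\<psi> k \<in> borel_measurable S" for k
  proof -
    have "(\<lambda>w. \<phi> k (restrict w {0..T k})) \<in> borel_measurable S" by (rule measurable_compose[OF restr \<phi>])
    then show ?thesis unfolding \<psi>_def by measurable
  qed
  moreover have "e k \<omega> = \<psi> k (traj \<omega>)" if \<omega>: "\<omega> \<in> space M" for k \<omega>
  proof -
    have r: "restrict (traj \<omega>) {0..T k} = (\<lambda>s\<in>{0..T k}. (X s \<omega>, Y s \<omega>))"
      by (auto simp: restrict_def fun_eq_iff)
    show ?thesis unfolding \<psi>_def r \<phi>e[OF \<omega>, symmetric] using K[OF \<omega>, of k] by simp
  qed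
  moreover have "divs n G (\<lambda>k \<omega>. \<psi> k (shift x (traj \<omega>)))" for x
    unfolding divs_def
  proof (intro conjI allI exI[of _ K] ballI)
    fix k
    have r: "restrict (shift x (traj \<omega>)) {0..T k} = (\<lambda>s\<in>{0..T k}. shift1 x (X s \<omega>, Y s \<omega>))" for \<omega>
      by (auto simp: restrict_def fun_eq_iff shift_def)
    have "(\<lambda>\<omega>. \<lambda>s\<in>{0..T k}. shift1 x (X s \<omega>, Y s \<omega>)) \<in> measurable (G (T k)) (S' k)"
      unfolding S'_def
      by (rule measurable_restrict) (rule measurable_compose[OF Z_meas_G shift1_meas], auto)
    from measurable_compose[OF this \<phi>]
    have "(\<lambda>\<omega>. \<phi> k (restrict (shift x (traj \<omega>)) {0..T k})) \<in> borel_measurable (G (T k))" unfolding r .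
    then show "(\<lambda>\<omega>. \<psi> k (shift x (traj \<omega>))) \<in> borel_measurable (G (real k / 2 ^ n))"
      unfolding \<psi>_def T_def[symmetric] by measurable
  qed (auto simp: \<psi>_def)
  ultimately show thesis by (rule that)
qed

section \<open>The value function as a supremum over natural strategies\<close>

definition payoff :: "real \<times> 'e \<Rightarrow> real \<Rightarrow> nat \<Rightarrow> (nat \<Rightarrow> 'w \<Rightarrow> real) \<Rightarrow> real" where
  "payoff z c n e = enn2real (gain z n e) - \<beta> * enn2real (cost z c n e)"

text \<open>\<open>x\<close> enters as capital under the common measure \<open>P (0, y)\<close>, so
  strategies for different \<open>x\<close> can be combined path by path.
  \<open>payoff_bounded\<close> makes the real supremum meaningful.\<close>

definition W :: "nat \<Rightarrow> real \<Rightarrow> 'e \<Rightarrow> real" where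
  "W n x y = (SUP e\<in>{e. divs n G e}. payoff (0, y) x n e)"

text \<open>Translation of paths by \<open>x\<close> and its inverse carry path strategies for one
  measure to those for the other.\<close>

lemma payoff_transfer:
  assumes e: "divs n G e"
  shows "\<exists>e'. divs n G e' \<and> payoff (0, y) (c + x) n e' = payoff (x, y) c n e"
    and "\<exists>e'. divs n G e' \<and> payoff (x, y) c n e' = payoff (0, y) (c + x) n e"
proof -
  obtain \<psi> where \<psi>: "\<And>k. \<psi> k \<in> borel_measurable S" "\<And>k \<omega>. \<omega> \<in> space M \<Longrightarrow> e k \<omega> = \<psi> k (traj \<omega>)"
    "\<And>x. divs n G (\<lambda>k \<omega>. \<psi> k (shift x (traj \<omega>)))"
    using divs_factor[OF e] by blast
  have "gain (x, y) n e = gain (x, y) n (\<lambda>k \<omega>. \<psi> k (traj \<omega>))"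
    "cost (x, y) c n e = cost (x, y) c n (\<lambda>k \<omega>. \<psi> k (traj \<omega>))"
    by (rule gain_cong cost_cong, rule \<psi>(2), assumption)+
  then have "payoff (0, y) (c + x) n (\<lambda>k \<omega>. \<psi> k (shift x (traj \<omega>))) = payoff (x, y) c n e"
    unfolding payoff_def by (simp only: law_transfer[OF \<psi>(1)])
  then show "\<exists>e'. divs n G e' \<and> payoff (0, y) (c + x) n e' = payoff (x, y) c n e"
    by (intro exI[of _ "\<lambda>k \<omega>. \<psi> k (shift x (traj \<omega>))"] conjI \<psi>(3))
  have unshift: "shift (- x) (shift x (traj \<omega>)) = traj \<omega>" for \<omega>
    by (auto simp: shift_def shift1_def traj_def fun_eq_iff restrict_def)
  define \<psi>' where "\<psi>' k w = \<psi> k (shift (- x) w)" for k w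
  have \<psi>': "\<psi>' k \<in> borel_measurable S" for k
    unfolding \<psi>'_def by (rule measurable_compose[OF shift_meas \<psi>(1)])
  have "gain (0, y) n e = gain (0, y) n (\<lambda>k \<omega>. \<psi>' k (shift x (traj \<omega>)))"
    "cost (0, y) (c + x) n e = cost (0, y) (c + x) n (\<lambda>k \<omega>. \<psi>' k (shift x (traj \<omega>)))"
    by (rule gain_cong cost_cong, simp add: \<psi>'_def unshift \<psi>(2))+
  then have "payoff (x, y) c n (\<lambda>k \<omega>. \<psi>' k (traj \<omega>)) = payoff (0, y) (c + x) n e"
    unfolding payoff_def by (simp only: law_transfer[OF \<psi>'])
  moreover have "divs n G (\<lambda>k \<omega>. \<psi>' k (traj \<omega>))" unfolding \<psi>'_def by (rule \<psi>(3))
  ultimately show "\<exists>e'. divs n G e' \<and> payoff (x, y) c n e' = payoff (0, y) (c + x) n e"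
    by (intro exI[of _ "\<lambda>k \<omega>. \<psi>' k (traj \<omega>)"] conjI)
qed

text \<open>Non-negativity of the controlled capital bounds dividends by injections plus
  \<open>A\<close>, the running maximum of \<open>\<bar>c\<bar> + \<bar>X\<bar>\<close>. As \<beta>
  exceeds 1, the cost absorbs the injections, and what remains is the discounted integral of
  \<open>A\<close>, finite by linear growth.\<close>

lemma payoff_bounded: "\<exists>B. \<forall>e. divs n F e \<longrightarrow> payoff z c n e \<le> B"
proof -
  define A where "A t \<omega> = enn2real (runmax (\<lambda>s. \<bar>c\<bar> + \<bar>X s \<omega>\<bar>) t)" for t \<omega>
  obtain C where C: "0 \<le> C" "\<And>x y N. (\<integral>\<^sup>+\<omega>. Xmax (real N) \<omega> \<partial>P (x, y)) \<le> ennreal (\<bar>x\<bar> + C * real N)"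
    using Xmax_linear by blast
  obtain x y where z: "z = (x, y)" by (cases z)
  have rle: "runmax (\<lambda>s. \<bar>c\<bar> + \<bar>X s \<omega>\<bar>) t \<le> ennreal \<bar>c\<bar> + Xmax t \<omega>" for t \<omega>
  proof (rule runmax_least)
    fix s assume s: "0 \<le> s" "s \<le> t"
    have "ennreal (\<bar>c\<bar> + \<bar>X s \<omega>\<bar>) = ennreal \<bar>c\<bar> + ennreal \<bar>X s \<omega>\<bar>" by (rule ennreal_plus) auto
    also have "\<dots> \<le> ennreal \<bar>c\<bar> + Xmax t \<omega>" by (intro add_mono order_refl X_le_Xmax s)
    finally show "ennreal (\<bar>c\<bar> + \<bar>X s \<omega>\<bar>) \<le> ennreal \<bar>c\<bar> + Xmax t \<omega>" .
  qed
  have rfin: "runmax (\<lambda>s. \<bar>c\<bar> + \<bar>X s \<omega>\<bar>) t < \<top>" if "\<omega> \<in> space M" for t \<omega>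
    by (rule le_less_trans[OF rle]) (simp add: Xmax_finite[OF that] ennreal_add_less_top)
  have Ainc: "incr_path (\<lambda>t. A t \<omega>)" if "\<omega> \<in> space M" for \<omega>
    unfolding A_def
    by (rule runmax_incr_path) (intro continuous_intros X_right_cont that, assumption, rule rfin[OF that])
  have Ale: "ennreal (A t \<omega>) \<le> ennreal \<bar>c\<bar> + Xmax t \<omega>" if "\<omega> \<in> space M" for t \<omega>
    unfolding A_def using rle[of \<omega> t] rfin[OF that] by simp
  have Am: "A t \<in> borel_measurable M" if t: "0 \<le> t" for t
  proof -
    have "(\<lambda>\<omega>. SUP s\<in>insert t ({0..t} \<inter> \<rat>). ennreal (\<bar>c\<bar> + \<bar>X s \<omega>\<bar>)) \<in> borel_measurable M"
    proof (rule borel_measurable_SUP)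
      show "countable (insert t ({0..t} \<inter> \<rat>))" by (intro countable_insert countable_Int2 countable_rat)
      fix s assume "s \<in> insert t ({0..t} \<inter> \<rat>)"
      then have "X s \<in> borel_measurable M" using t by (intro X_meas) auto
      then show "(\<lambda>\<omega>. ennreal (\<bar>c\<bar> + \<bar>X s \<omega>\<bar>)) \<in> borel_measurable M" by simp
    qed
    then have "(\<lambda>\<omega>. enn2real (SUP s\<in>insert t ({0..t} \<inter> \<rat>). ennreal (\<bar>c\<bar> + \<bar>X s \<omega>\<bar>))) \<in> borel_measurable M"
      by simp
    moreover have "A t \<omega> = enn2real (SUP s\<in>insert t ({0..t} \<inter> \<rat>). ennreal (\<bar>c\<bar> + \<bar>X s \<omega>\<bar>))"
      if "\<omega> \<in> space M" for \<omega>
      unfolding A_def by (subst runmax_rat[OF _ t]) (intro continuous_intros X_right_cont that, assumption, rule refl)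
    ultimately show ?thesis by (simp cong: measurable_cong)
  qed
  define B where "B = expected_disc z A"
  have Bfin: "B < \<top>"
    unfolding B_def
  proof (rule stieltjes_growth[OF Ainc Am])
    fix N :: nat
    have "(\<integral>\<^sup>+\<omega>. ennreal (A (real N) \<omega>) \<partial>P z) \<le> (\<integral>\<^sup>+\<omega>. ennreal \<bar>c\<bar> + Xmax (real N) \<omega> \<partial>P z)"
      by (intro nn_integral_mono Ale) simp
    also have "\<dots> = (\<integral>\<^sup>+\<omega>. ennreal \<bar>c\<bar> \<partial>P z) + (\<integral>\<^sup>+\<omega>. Xmax (real N) \<omega> \<partial>P z)"
      by (intro nn_integral_add M_measD Xmax_meas) auto
    also have "\<dots> \<le> ennreal \<bar>c\<bar> + ennreal (\<bar>x\<bar> + C * real N)"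
      using C(2)[where x = x and y = y and N = N] by (simp add: z add_left_mono)
    also have "\<dots> = ennreal ((\<bar>c\<bar> + \<bar>x\<bar>) + C * real N)"
      using C(1) by (subst ennreal_plus[symmetric]) (auto simp: add.assoc)
    finally show "(\<integral>\<^sup>+\<omega>. ennreal (A (real N) \<omega>) \<partial>P z) \<le> ennreal ((\<bar>c\<bar> + \<bar>x\<bar>) + C * real N)" .
  qed
  have "payoff z c n e \<le> enn2real B" if e: "divs n F e" for e
  proof -
    define R where "R t \<omega> = enn2real (injection c n e t \<omega>)" for t \<omega>
    have Rinc: "incr_path (\<lambda>t. R t \<omega>)" if "\<omega> \<in> space M" for \<omega>
      unfolding R_def by (rule injection_incr[where e = e, OF that]) (rule divs_nonneg[OF e that])
    have Rm: "R t \<in> borel_measurable M" if "0 \<le> t" for t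
      unfolding R_def using injection_meas[OF e that] by simp
    have "gain z n e \<le> (\<integral>\<^sup>+\<omega>. disc_int R \<omega> + disc_int A \<omega> \<partial>P z)"
      unfolding gain_def
    proof (rule nn_integral_mono)
      fix \<omega> assume "\<omega> \<in> space (P z)"
      then have \<omega>: "\<omega> \<in> space M" by simp
      interpret stieltjes_integrand "\<lambda>t. D t \<omega>" by (rule D_integrand[OF \<omega>])
      have "disc_int (cumdiv n e) \<omega> \<le> stieltjes (\<lambda>t. D t \<omega>) (\<lambda>t. ennreal (R t \<omega> + A t \<omega>))"
      proof (rule stieltjes_mono)
        fix t :: real assume t: "0 \<le> t"
        have "ennreal (cumdiv n e t \<omega> - (c + X t \<omega>)) \<le> injection c n e t \<omega>"
          unfolding injection_def using runmax_upper[OF t order_refl, of "\<lambda>s. cumdiv n e s \<omega> - (c + X s \<omega>)"] by simp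
        also have "\<dots> = ennreal (R t \<omega>)" unfolding R_def using injection_finite[OF \<omega>, of e c n t] divs_nonneg[OF e \<omega>] by simp
        finally have 1: "cumdiv n e t \<omega> - (c + X t \<omega>) \<le> R t \<omega>"
          by (simp only: ennreal_le_iff[OF incr_path_nonneg[OF Rinc[OF \<omega>]]])
        have "ennreal (\<bar>c\<bar> + \<bar>X t \<omega>\<bar>) \<le> ennreal (A t \<omega>)"
          unfolding A_def using runmax_upper[OF t order_refl, of "\<lambda>s. \<bar>c\<bar> + \<bar>X s \<omega>\<bar>"] rfin[OF \<omega>, of t] by simp
        then have "\<bar>c\<bar> + \<bar>X t \<omega>\<bar> \<le> A t \<omega>" by (simp only: ennreal_le_iff[OF incr_path_nonneg[OF Ainc[OF \<omega>]]])
        with 1 show "ennreal (cumdiv n e t \<omega>) \<le> ennreal (R t \<omega> + A t \<omega>)" by (intro ennreal_leI) linarith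
      qed
      also have "\<dots> = disc_int R \<omega> + disc_int A \<omega>"
        by (rule stieltjes_add[OF Rinc[OF \<omega>] Ainc[OF \<omega>]])
      finally show "disc_int (cumdiv n e) \<omega>
        \<le> disc_int R \<omega> + disc_int A \<omega>" .
    qed
    also have "\<dots> = expected_disc z R + B"
      unfolding B_def
      by (rule nn_integral_add) (rule M_measD[OF stieltjes_D_meas], use Rm Am in simp)+
    also have "expected_disc z R = cost z c n e"
      unfolding cost_eq[OF e] R_def ..
    finally have "enn2real (gain z n e) \<le> enn2real (cost z c n e + B)"
      using cost_finite[OF e, of z c] Bfin by (intro enn2real_mono) (simp_all add: ennreal_add_less_top)
    also have "\<dots> = enn2real (cost z c n e) + enn2real B"
      using cost_finite[OF e, of z c] Bfin by (intro enn2real_plus) auto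
    also have "\<dots> \<le> \<beta> * enn2real (cost z c n e) + enn2real B"
      using beta mult_right_mono[of 1 \<beta> "enn2real (cost z c n e)"] by simp
    finally show ?thesis by (simp add: payoff_def)
  qed
  then show ?thesis by blast
qed

lemma payoff_le_W: "divs n G e \<Longrightarrow> payoff (0, y) x n e \<le> W n x y"
proof -
  assume e: "divs n G e"
  obtain B where B: "\<And>e. divs n F e \<Longrightarrow> payoff (0, y) x n e \<le> B" using payoff_bounded by blast
  show ?thesis
    unfolding W_def by (rule cSUP_upper) (use e B divs_G_F in \<open>auto intro!: bdd_aboveI[of _ B]\<close>)
qed

lemma divs_zero: "divs n \<G> (\<lambda>k \<omega>. 0)"
  unfolding divs_def by auto

lemma W_le: "(\<And>e. divs n G e \<Longrightarrow> payoff (0, y) x n e \<le> B) \<Longrightarrow> W n x y \<le> B"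
  unfolding W_def by (rule cSUP_least) (use divs_zero in auto)

text \<open>The projection comes first, under \<open>P (x, y)\<close> itself: only its result is a
  path functional and can be moved to \<open>P (0, y)\<close>.\<close>

lemma payoff_F_le_W:
  assumes e: "divs n F e"
  shows "payoff (x, y) 0 n e \<le> W n x y"
proof -
  obtain e' where e': "divs n G e'" "gain (x, y) n e' = gain (x, y) n e" "cost (x, y) 0 n e' \<le> cost (x, y) 0 n e"
    using projection[OF e] by blast
  have "enn2real (cost (x, y) 0 n e') \<le> enn2real (cost (x, y) 0 n e)"
    using e'(3) cost_finite[OF e] by (rule enn2real_mono)
  then have "payoff (x, y) 0 n e \<le> payoff (x, y) 0 n e'"
    unfolding payoff_def e'(2) using beta by simp
  moreover obtain e'' where "divs n G e''" "payoff (0, y) (0 + x) n e'' = payoff (x, y) 0 n e'"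
    using payoff_transfer(1)[OF e'(1)] by blast
  ultimately show ?thesis using payoff_le_W[of n e'' y x] by simp
qed

lemma disc_exp_eq:
  assumes "\<And>\<omega>. \<omega> \<in> space M \<Longrightarrow> incr_path (\<lambda>t. A t \<omega>)"
  shows "disc_exp P qf Y A z = expected_disc z A"
  unfolding disc_exp_def
proof (rule nn_integral_cong)
  fix \<omega> assume "\<omega> \<in> space (P z)"
  then have \<omega>: "\<omega> \<in> space M" by simp
  interpret stieltjes_integrand "\<lambda>t. D t \<omega>" by (rule D_integrand[OF \<omega>])
  show "(\<integral>\<^sup>+t\<in>{0..}. D t \<omega> \<partial>interval_measure (\<lambda>s. A s \<omega>)) = disc_int A \<omega>"
    by (rule stieltjes_eq[OF assms[OF \<omega>], symmetric])
qed

lemma disc_exp_divs: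
  assumes e: "divs n F e"
  shows "disc_exp P qf Y (cumdiv n e) z = gain z n e"
    and "disc_exp P qf Y (\<lambda>t \<omega>. enn2real (injection c n e t \<omega>)) z = cost z c n e"
  unfolding gain_def cost_eq[OF e]
  by (rule disc_exp_eq, rule cumdiv_incr injection_incr[where e = e], assumption?, rule divs_nonneg[OF e], assumption)+

lemma divs_admissible:
  assumes e: "divs n F e"
  shows "(cumdiv n e, \<lambda>t \<omega>. enn2real (injection 0 n e t \<omega>)) \<in> admissible n M F P X Y qf"
proof -
  have nn: "0 \<le> e k \<omega>" if "\<omega> \<in> space M" for k \<omega> by (rule divs_nonneg[OF e that])
  have Linc: "incr_path (\<lambda>t. cumdiv n e t \<omega>)" if "\<omega> \<in> space M" for \<omega>
    by (rule cumdiv_incr) (rule nn[OF that])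
  have Rinc: "incr_path (\<lambda>t. enn2real (injection 0 n e t \<omega>))" if "\<omega> \<in> space M" for \<omega>
    by (rule injection_incr[where e = e, OF that]) (rule nn[OF that])
  have U: "0 \<le> X t \<omega> - cumdiv n e t \<omega> + enn2real (injection 0 n e t \<omega>)" if \<omega>: "\<omega> \<in> space M" and t: "0 \<le> t" for \<omega> t
  proof -
    have "ennreal (cumdiv n e t \<omega> - (0 + X t \<omega>)) \<le> injection 0 n e t \<omega>"
      unfolding injection_def using runmax_upper[OF t order_refl, of "\<lambda>s. cumdiv n e s \<omega> - (0 + X s \<omega>)"] by simp
    also have "\<dots> = ennreal (enn2real (injection 0 n e t \<omega>))"
      using injection_finite[OF \<omega>, of e 0 n t] nn[OF \<omega>] by simp
    finally have "cumdiv n e t \<omega> - (0 + X t \<omega>) \<le> enn2real (injection 0 n e t \<omega>)"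
      by (simp only: ennreal_le_iff[OF enn2real_nonneg])
    then show ?thesis by simp
  qed
  have Rm: "(\<lambda>\<omega>. enn2real (injection 0 n e t \<omega>)) \<in> borel_measurable (F t)" if t: "0 \<le> t" for t
  proof -
    have "injection 0 n e t \<in> borel_measurable (F t)"
      by (rule injection_measurable[OF space_F[OF t] t])
         (auto intro: F_meas_mono[OF _ _ X_meas_F] divs_meas_F[OF e])
    then show ?thesis by simp
  qed
  show ?thesis
    unfolding admissible_def
  proof (intro CollectI case_prodI conjI ballI allI impI)
    fix \<omega> assume \<omega>: "\<omega> \<in> space M"
    note L = Linc[OF \<omega>] and R = Rinc[OF \<omega>]
    show "mono (\<lambda>t. cumdiv n e t \<omega>)" "mono (\<lambda>t. enn2real (injection 0 n e t \<omega>))"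
      using L R by (simp_all add: incr_path_def)
    show "cadlag_path (\<lambda>t. cumdiv n e t \<omega>)" "cadlag_path (\<lambda>t. enn2real (injection 0 n e t \<omega>))"
      using L R by (simp_all add: incr_path_cadlag)
    show "cumdiv n e t \<omega> = 0" "enn2real (injection 0 n e t \<omega>) = 0" if "t < 0" for t
      using L R that by (simp_all add: incr_path_def)
    show "0 \<le> cumdiv n e t \<omega>" for t by (rule incr_path_nonneg[OF L])
    show "0 \<le> enn2real (injection 0 n e t \<omega>)" for t by simp
  next
    fix t :: real assume t: "0 \<le> t"
    show "cumdiv n e t \<in> borel_measurable (F t)"
      by (rule cumdiv_measurable) (rule divs_meas_F[OF e])
    show "(\<lambda>\<omega>. enn2real (injection 0 n e t \<omega>)) \<in> borel_measurable (F t)" by (rule Rm[OF t])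
  next
    fix z show "AE \<omega> in P z. \<forall>t\<ge>0. 0 \<le> X t \<omega> - cumdiv n e t \<omega> + enn2real (injection 0 n e t \<omega>)"
      using U by (intro AE_I2) simp
  next
    show "\<exists>ell. (\<forall>k. ell k \<in> borel_measurable (F (real k / 2 ^ n))) \<and> (\<forall>k. \<forall>\<omega>\<in>space M. 0 \<le> ell k \<omega>) \<and>
        (\<forall>t. \<forall>\<omega>\<in>space M. cumdiv n e t \<omega> = (\<Sum>k\<in>{k. 1 \<le> k \<and> real k / 2 ^ n \<le> t}. ell k \<omega>))"
      using e nn by (intro exI[of _ e]) (auto simp: divs_def cumdiv_def step_def)
  next
    fix z show "disc_exp P qf Y (\<lambda>t \<omega>. enn2real (injection 0 n e t \<omega>)) z < \<top>"
      unfolding disc_exp_divs[OF e] by (rule cost_finite[OF e])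
  qed
qed

lemma ereal_payoff:
  assumes e: "divs n F e"
  shows "enn2ereal (gain z n e) - ereal \<beta> * enn2ereal (cost z c n e) = ereal (payoff z c n e)"
proof -
  obtain a where a: "gain z n e = ennreal a" "0 \<le> a" using gain_finite[OF e, of z] by (cases "gain z n e") auto
  obtain b where b: "cost z c n e = ennreal b" "0 \<le> b" using cost_finite[OF e, of z c] by (cases "cost z c n e") auto
  show ?thesis by (simp add: payoff_def a b enn2ereal_ennreal)
qed

text \<open>Truncating the dividends lowers them, so the given injections still suffice and the
  minimal ones cost no more. The truncated gains increase to the full gain, and their common bound
  shows that it is finite.\<close>

lemma vpi_le_W:
  assumes adm: "(L, R) \<in> admissible n M F P X Y qf"
  shows "vpi P Y qf \<beta> (L, R) (x, y) \<le> ereal (W n x y)"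
proof -
  let ?z = "(x, y)"
  note a = adm[unfolded admissible_def mem_Collect_eq prod.case]
  have path: "(\<forall>t<0. L t \<omega> = 0 \<and> R t \<omega> = 0)" "(\<forall>t. 0 \<le> L t \<omega> \<and> 0 \<le> R t \<omega>)"
     "mono (\<lambda>t. L t \<omega>)" "mono (\<lambda>t. R t \<omega>)" "cadlag_path (\<lambda>t. L t \<omega>)" "cadlag_path (\<lambda>t. R t \<omega>)"
    if "\<omega> \<in> space M" for \<omega>
    using a that by blast+
  have U: "AE \<omega> in P z. \<forall>t\<ge>0. 0 \<le> X t \<omega> - L t \<omega> + R t \<omega>" for z using a by blast
  have Rfin: "disc_exp P qf Y R z < \<top>" for z using a by blast
  obtain ell where ell: "\<And>k. ell k \<in> borel_measurable (F (real k / 2 ^ n))"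
    "\<And>k \<omega>. \<omega> \<in> space M \<Longrightarrow> 0 \<le> ell k \<omega>"
    "\<And>t \<omega>. \<omega> \<in> space M \<Longrightarrow> L t \<omega> = step n (\<lambda>k. ell k \<omega>) t"
    using a unfolding step_def by blast
  have Linc: "incr_path (\<lambda>t. L t \<omega>)" and Rinc: "incr_path (\<lambda>t. R t \<omega>)" if "\<omega> \<in> space M" for \<omega>
    using path[OF that] by (auto simp: incr_path_def cadlag_path_def)
  \<comment> \<open>Size and horizon are cut at the same \<open>N\<close>, as \<open>divs\<close>
    asks.\<close>
  define e where "e N k \<omega> = (if N < k then 0 else min (ell k \<omega>) (real N))" for N k :: nat and \<omega>
  have e: "divs n F (e N)" for N
    unfolding divs_def
  proof (intro conjI allI exI[of _ N] ballI)
    show "e N k \<in> borel_measurable (F (real k / 2 ^ n))" for k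
      unfolding e_def using ell(1)[of k] by measurable
  qed (use ell(2) in \<open>auto simp: e_def\<close>)
  have eL: "cumdiv n (e N) t \<omega> \<le> L t \<omega>" if "\<omega> \<in> space M" for N t \<omega>
    unfolding cumdiv_def ell(3)[OF that] step_def by (rule sum_mono) (use ell(2)[OF that] in \<open>auto simp: e_def\<close>)
  have einc: "cumdiv n (e N) t \<omega> \<le> cumdiv n (e N') t \<omega>" if "\<omega> \<in> space M" "N \<le> N'" for N N' t \<omega>
    unfolding cumdiv_def step_def by (rule sum_mono) (use ell(2)[OF that(1)] that(2) in \<open>auto simp: e_def\<close>)
  have DR: "disc_exp P qf Y R ?z = expected_disc ?z R"
    by (rule disc_exp_eq) (rule Rinc)
  have cost_le: "cost ?z 0 n (e N) \<le> disc_exp P qf Y R ?z" for N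
  proof -
    have "AE \<omega> in P ?z. stieltjes (\<lambda>t. D t \<omega>) (\<lambda>t. injection 0 n (e N) t \<omega>) \<le> disc_int R \<omega>"
      using U AE_space
    proof eventually_elim
      case (elim \<omega>)
      then have \<omega>: "\<omega> \<in> space M" by simp
      show ?case
      proof (rule stieltjes_mono)
        fix t :: real assume t: "0 \<le> t"
        show "injection 0 n (e N) t \<omega> \<le> ennreal (R t \<omega>)"
          unfolding injection_def
        proof (rule runmax_least)
          fix s assume s: "0 \<le> s" "s \<le> t"
          have "0 \<le> X s \<omega> - L s \<omega> + R s \<omega>" using elim(1) s by blast
          moreover have "R s \<omega> \<le> R t \<omega>" by (rule incr_path_mono[OF Rinc[OF \<omega>] s(2)])
          ultimately show "ennreal (cumdiv n (e N) s \<omega> - (0 + X s \<omega>)) \<le> ennreal (R t \<omega>)"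
            using eL[OF \<omega>, of N s] by (intro ennreal_leI) linarith
        qed
      qed
    qed
    then show ?thesis
      unfolding cost_def DR by (rule nn_integral_mono_AE)
  qed
  have gain_SUP: "disc_exp P qf Y L ?z = (SUP N. gain ?z n (e N))"
  proof -
    have pt: "disc_int L \<omega> = (SUP N. disc_int (cumdiv n (e N)) \<omega>)"
      if \<omega>: "\<omega> \<in> space M" for \<omega>
    proof (rule antisym)
      show "(SUP N. disc_int (cumdiv n (e N)) \<omega>) \<le> disc_int L \<omega>"
        by (intro SUP_least stieltjes_mono ennreal_leI eL \<omega>)
      show "disc_int L \<omega> \<le> (SUP N. disc_int (cumdiv n (e N)) \<omega>)"
        unfolding stieltjes_def[of _ "\<lambda>t. ennreal (L t \<omega>)"]
      proof (rule SUP_least)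
        fix m
        \<comment> \<open>Only finitely many dividends fall into a bounded time interval, so
          truncation is exact there from some \<open>N\<close> on, depending on \<omega>.\<close>
        define I where "I = grid_index n (real (Suc m))"
        obtain N0 :: nat where N0: "(\<Sum>k\<in>{1..I}. ell k \<omega>) \<le> real N0" using real_arch_simple by blast
        define N where "N = max I N0"
        have LN: "L t \<omega> = cumdiv n (e N) t \<omega>" if t: "0 \<le> t" "t \<le> real (Suc m)" for t
        proof -
          have le: "grid_index n t \<le> I" unfolding I_def by (rule grid_index_mono[OF t(2)])
          show ?thesis
            unfolding ell(3)[OF \<omega>] cumdiv_def step_eq
          proof (rule sum.cong[OF refl])
            fix k assume "k \<in> {1..grid_index n t}"
            then have k: "k \<in> {1..I}" using le by auto
            have "ell k \<omega> \<le> (\<Sum>k\<in>{1..I}. ell k \<omega>)"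
              by (rule member_le_sum[OF k]) (use ell(2)[OF \<omega>] in auto)
            then have "ell k \<omega> \<le> real N" using N0 by (simp add: N_def)
            then show "ell k \<omega> = e N k \<omega>" using k by (simp add: e_def N_def)
          qed
        qed
        have "liminf (\<lambda>j. abel_sum j (Suc m) (\<lambda>t. D t \<omega>) (\<lambda>t. ennreal (L t \<omega>)))
            = liminf (\<lambda>j. abel_sum j (Suc m) (\<lambda>t. D t \<omega>) (\<lambda>t. ennreal (cumdiv n (e N) t \<omega>)))"
          by (intro arg_cong[where f = liminf] ext abel_sum_cong) (use LN in simp)
        also have "\<dots> \<le> disc_int (cumdiv n (e N)) \<omega>"
          unfolding stieltjes_def by (rule SUP_upper) simp
        also have "\<dots> \<le> (SUP N. disc_int (cumdiv n (e N)) \<omega>)"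
          by (rule SUP_upper) simp
        finally show "liminf (\<lambda>j. abel_sum j (Suc m) (\<lambda>t. D t \<omega>) (\<lambda>t. ennreal (L t \<omega>)))
            \<le> (SUP N. disc_int (cumdiv n (e N)) \<omega>)" .
      qed
    qed
    have "disc_exp P qf Y L ?z = expected_disc ?z L"
      by (rule disc_exp_eq) (rule Linc)
    \<comment> \<open>The indicator makes monotonicity in \<open>N\<close> hold at every \<omega>,
      also outside \<open>space M\<close>.\<close>
    also have "\<dots> = (\<integral>\<^sup>+\<omega>. (SUP N. disc_int (cumdiv n (e N)) \<omega> * indicator (space M) \<omega>) \<partial>P ?z)"
      by (rule nn_integral_cong) (simp add: pt)
    also have "\<dots> = (SUP N. \<integral>\<^sup>+\<omega>. disc_int (cumdiv n (e N)) \<omega> * indicator (space M) \<omega> \<partial>P ?z)"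
    proof (rule nn_integral_monotone_convergence_SUP)
      show "incseq (\<lambda>N \<omega>. disc_int (cumdiv n (e N)) \<omega> * indicator (space M) \<omega>)"
        unfolding incseq_def le_fun_def
        by (auto simp: indicator_def intro!: stieltjes_mono ennreal_leI einc)
      show "(\<lambda>\<omega>. disc_int (cumdiv n (e N)) \<omega> * indicator (space M) \<omega>) \<in> borel_measurable (P ?z)" for N
        using cumdiv_meas[OF e, of N] by (intro M_measD borel_measurable_times_ennreal stieltjes_D_meas) auto
    qed
    also have "\<dots> = (SUP N. gain ?z n (e N))"
      unfolding gain_def by (intro SUP_cong refl nn_integral_cong) simp
    finally show ?thesis .
  qed
  obtain r where r: "disc_exp P qf Y R ?z = ennreal r" "0 \<le> r"
    using Rfin[of ?z] by (cases "disc_exp P qf Y R ?z") auto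
  have bnd: "gain ?z n (e N) \<le> ennreal (W n x y + \<beta> * r)" for N
  proof -
    have "payoff ?z 0 n (e N) \<le> W n x y" by (rule payoff_F_le_W[OF e])
    moreover have "enn2real (cost ?z 0 n (e N)) \<le> r"
      using enn2real_mono[OF cost_le[of N]] r by simp
    then have "\<beta> * enn2real (cost ?z 0 n (e N)) \<le> \<beta> * r" using beta by (intro mult_left_mono) auto
    ultimately have "enn2real (gain ?z n (e N)) \<le> W n x y + \<beta> * r" by (simp add: payoff_def)
    then have "ennreal (enn2real (gain ?z n (e N))) \<le> ennreal (W n x y + \<beta> * r)" by (rule ennreal_leI)
    then show ?thesis using gain_finite[OF e[of N], of ?z] by simp
  qed
  \<comment> \<open>Without this the bound in \<open>ennreal\<close> would not translate into one
    for reals, since \<open>ennreal\<close> of a negative number is 0.\<close>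
  have nonneg: "0 \<le> W n x y + \<beta> * r"
  proof -
    have "payoff ?z 0 n (e 0) \<le> W n x y" by (rule payoff_F_le_W[OF e])
    moreover have "enn2real (cost ?z 0 n (e 0)) \<le> r"
      using enn2real_mono[OF cost_le[of 0]] r by simp
    then have "\<beta> * enn2real (cost ?z 0 n (e 0)) \<le> \<beta> * r" using beta by (intro mult_left_mono) auto
    ultimately show ?thesis using enn2real_nonneg[of "gain ?z n (e 0)"] unfolding payoff_def by linarith
  qed
  have "disc_exp P qf Y L ?z \<le> ennreal (W n x y + \<beta> * r)"
    unfolding gain_SUP by (rule SUP_least) (rule bnd)
  then obtain l where l: "disc_exp P qf Y L ?z = ennreal l" "0 \<le> l" "l \<le> W n x y + \<beta> * r"
    using nonneg by (cases "disc_exp P qf Y L ?z") (auto simp: top_unique)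
  show ?thesis
    unfolding vpi_def fst_conv snd_conv using l r by (simp add: enn2ereal_ennreal)
qed

text \<open>In particular the value is finite, so \<open>real_of_ereal\<close> in the right
  derivative loses nothing.\<close>

lemma Vn_eq: "Vn n M F P X Y qf \<beta> (x, y) = ereal (W n x y)"
proof (rule antisym)
  show "Vn n M F P X Y qf \<beta> (x, y) \<le> ereal (W n x y)"
    unfolding Vn_def by (rule SUP_least) (use vpi_le_W in auto)
  show "ereal (W n x y) \<le> Vn n M F P X Y qf \<beta> (x, y)"
  proof (rule ereal_le_real)
    fix B assume B: "Vn n M F P X Y qf \<beta> (x, y) \<le> ereal B"
    have "W n x y \<le> B"
    proof (rule W_le)
      fix e assume "divs n G e"
      from payoff_transfer(2)[OF this, of x y 0] obtain e' where
        e': "divs n G e'" "payoff (x, y) 0 n e' = payoff (0, y) x n e" by auto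
      note eF = divs_G_F[OF e'(1)]
      have "ereal (payoff (x, y) 0 n e') = vpi P Y qf \<beta> (cumdiv n e', \<lambda>t \<omega>. enn2real (injection 0 n e' t \<omega>)) (x, y)"
        unfolding vpi_def fst_conv snd_conv disc_exp_divs[OF eF] by (rule ereal_payoff[OF eF, symmetric])
      also have "\<dots> \<le> Vn n M F P X Y qf \<beta> (x, y)"
        unfolding Vn_def by (rule SUP_upper[OF divs_admissible[OF eF]])
      also note B
      finally show "payoff (0, y) x n e \<le> B" using e'(2) by simp
    qed
    then show "ereal (W n x y) \<le> ereal B" by simp
  qed
qed

end

section \<open>Increments, concavity and right derivatives of the value function\<close>

lemma (in stieltjes_integrand) stieltjes_scale:
  assumes A: "incr_path A" and c: "0 \<le> c"
  shows "stieltjes d (\<lambda>t. ennreal (c * A t)) = ennreal c * stieltjes d (\<lambda>t. ennreal (A t))"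
proof -
  have cA: "incr_path (\<lambda>t. c * A t)"
    using A c unfolding incr_path_def by (auto simp: mono_def mult_left_mono intro!: continuous_intros)
  have eq: "abel_sum m N d (\<lambda>t. ennreal (c * A t)) = ennreal c * abel_sum m N d (\<lambda>t. ennreal (A t))" for m N
    unfolding abel_sum_def using c
    by (simp add: ennreal_mult' sum_distrib_left distrib_left mult.assoc)
  have "(\<integral>\<^sup>+t\<in>{0..real (Suc N)}. d t \<partial>interval_measure (\<lambda>t. c * A t))
      = ennreal c * (\<integral>\<^sup>+t\<in>{0..real (Suc N)}. d t \<partial>interval_measure A)" for N
  proof (rule LIMSEQ_unique)
    show "(\<lambda>m. abel_sum m (Suc N) d (\<lambda>t. ennreal (c * A t))) \<longlonglongrightarrow>
      (\<integral>\<^sup>+t\<in>{0..real (Suc N)}. d t \<partial>interval_measure (\<lambda>t. c * A t))"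
      by (rule abel_sum_tendsto[OF cA]) simp
    show "(\<lambda>m. abel_sum m (Suc N) d (\<lambda>t. ennreal (c * A t))) \<longlonglongrightarrow>
      ennreal c * (\<integral>\<^sup>+t\<in>{0..real (Suc N)}. d t \<partial>interval_measure A)"
      unfolding eq by (intro ennreal_tendsto_cmult abel_sum_tendsto[OF A]) auto
  qed
  then show ?thesis
    unfolding stieltjes_eq[OF A] stieltjes_eq[OF cA] integral_Ici_SUP[OF A] integral_Ici_SUP[OF cA]
    by (simp add: SUP_mult_left_ennreal)
qed

lemma antimono_right_limit:
  fixes g :: "real \<Rightarrow> real"
  assumes anti: "\<And>s t. x < s \<Longrightarrow> s \<le> t \<Longrightarrow> g t \<le> g s" and bdd: "\<And>s. x < s \<Longrightarrow> g s \<le> B"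
  shows "(g \<longlongrightarrow> Sup (g ` {x<..})) (at_right x)"
proof (rule order_tendstoI)
  have bd: "bdd_above (g ` {x<..})" using bdd by (intro bdd_aboveI[of _ B]) auto
  show "\<forall>\<^sub>F s in at_right x. a < g s" if "a < Sup (g ` {x<..})" for a
  proof -
    have "g ` {x<..} \<noteq> {}" by auto
    from less_cSup_iff[OF this bd] that obtain t where t: "x < t" "a < g t" by auto
    then have "a < g s" if "x < s" "s < t" for s using anti[of s t] that by simp
    then show ?thesis unfolding eventually_at_right_field using t(1) by blast
  qed
  show "\<forall>\<^sub>F s in at_right x. g s < a" if "Sup (g ` {x<..}) < a" for a
  proof -
    have "g s < a" if "x < s" for s
      using cSup_upper[OF imageI bd, of s] that \<open>Sup (g ` {x<..}) < a\<close> by simp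
    then show ?thesis unfolding eventually_at_right_field by (intro exI[of _ "x + 1"]) simp
  qed
qed

context bailout
begin

text \<open>The coupling controls only the sum over the two strategies; the additive form also
  avoids subtraction in \<open>ennreal\<close>.\<close>

lemma expected_stieltjes_sum_mono:
  fixes A B C E :: "real \<Rightarrow> 'w \<Rightarrow> real"
  assumes inc: "\<And>\<omega>. \<omega> \<in> space M \<Longrightarrow> incr_path (\<lambda>t. A t \<omega>)" "\<And>\<omega>. \<omega> \<in> space M \<Longrightarrow> incr_path (\<lambda>t. B t \<omega>)"
      "\<And>\<omega>. \<omega> \<in> space M \<Longrightarrow> incr_path (\<lambda>t. C t \<omega>)" "\<And>\<omega>. \<omega> \<in> space M \<Longrightarrow> incr_path (\<lambda>t. E t \<omega>)"
    and m: "\<And>t. 0 \<le> t \<Longrightarrow> A t \<in> borel_measurable M" "\<And>t. 0 \<le> t \<Longrightarrow> B t \<in> borel_measurable M"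
      "\<And>t. 0 \<le> t \<Longrightarrow> C t \<in> borel_measurable M" "\<And>t. 0 \<le> t \<Longrightarrow> E t \<in> borel_measurable M"
    and le: "\<And>t \<omega>. 0 \<le> t \<Longrightarrow> \<omega> \<in> space M \<Longrightarrow> A t \<omega> + B t \<omega> \<le> C t \<omega> + E t \<omega>"
  shows "expected_disc z A + expected_disc z B
      \<le> expected_disc z C + expected_disc z E"
proof -
  have sm: "(\<lambda>\<omega>. disc_int f \<omega>) \<in> borel_measurable (P z)"
    if "\<And>t. 0 \<le> t \<Longrightarrow> f t \<in> borel_measurable M" for f :: "real \<Rightarrow> 'w \<Rightarrow> real"
    by (rule M_measD[OF stieltjes_D_meas]) (use that in simp)
  have add: "expected_disc z f + expected_disc z g
      = (\<integral>\<^sup>+\<omega>. stieltjes (\<lambda>t. D t \<omega>) (\<lambda>t. ennreal (f t \<omega> + g t \<omega>)) \<partial>P z)"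
    if "\<And>t. 0 \<le> t \<Longrightarrow> f t \<in> borel_measurable M" "\<And>t. 0 \<le> t \<Longrightarrow> g t \<in> borel_measurable M"
      "\<And>\<omega>. \<omega> \<in> space M \<Longrightarrow> incr_path (\<lambda>t. f t \<omega>)" "\<And>\<omega>. \<omega> \<in> space M \<Longrightarrow> incr_path (\<lambda>t. g t \<omega>)"
    for f g :: "real \<Rightarrow> 'w \<Rightarrow> real"
  proof -
    have "(\<integral>\<^sup>+\<omega>. stieltjes (\<lambda>t. D t \<omega>) (\<lambda>t. ennreal (f t \<omega> + g t \<omega>)) \<partial>P z)
        = (\<integral>\<^sup>+\<omega>. disc_int f \<omega> + disc_int g \<omega> \<partial>P z)"
    proof (rule nn_integral_cong)
      fix \<omega> assume "\<omega> \<in> space (P z)"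
      then have \<omega>: "\<omega> \<in> space M" by simp
      interpret stieltjes_integrand "\<lambda>t. D t \<omega>" by (rule D_integrand[OF \<omega>])
      show "stieltjes (\<lambda>t. D t \<omega>) (\<lambda>t. ennreal (f t \<omega> + g t \<omega>))
        = disc_int f \<omega> + disc_int g \<omega>"
        by (rule stieltjes_add[OF that(3)[OF \<omega>] that(4)[OF \<omega>]])
    qed
    also have "\<dots> = expected_disc z f + expected_disc z g"
      by (rule nn_integral_add[OF sm[OF that(1)] sm[OF that(2)]])
    finally show ?thesis by simp
  qed
  have "expected_disc z A + expected_disc z B
      = (\<integral>\<^sup>+\<omega>. stieltjes (\<lambda>t. D t \<omega>) (\<lambda>t. ennreal (A t \<omega> + B t \<omega>)) \<partial>P z)"
    by (rule add) (fact m inc)+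
  also have "\<dots> \<le> (\<integral>\<^sup>+\<omega>. stieltjes (\<lambda>t. D t \<omega>) (\<lambda>t. ennreal (C t \<omega> + E t \<omega>)) \<partial>P z)"
    by (intro nn_integral_mono stieltjes_mono ennreal_leI le) simp_all
  also have "\<dots> = expected_disc z C + expected_disc z E"
    by (rule add[symmetric]) (fact m inc)+
  finally show ?thesis .
qed

definition inject :: "real \<Rightarrow> nat \<Rightarrow> (nat \<Rightarrow> 'w \<Rightarrow> real) \<Rightarrow> real \<Rightarrow> 'w \<Rightarrow> real" where
  "inject c n e t \<omega> = enn2real (injection c n e t \<omega>)"

lemma cumdiv_regular:
  assumes "divs n F e"
  shows "\<omega> \<in> space M \<Longrightarrow> incr_path (\<lambda>t. cumdiv n e t \<omega>)" "0 \<le> t \<Longrightarrow> cumdiv n e t \<in> borel_measurable M"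
  by (rule cumdiv_incr, rule divs_nonneg[OF assms], assumption) (rule cumdiv_meas[OF assms])

lemma inject_regular:
  assumes e: "divs n F e"
  shows "\<omega> \<in> space M \<Longrightarrow> incr_path (\<lambda>t. inject c n e t \<omega>)" "0 \<le> t \<Longrightarrow> inject c n e t \<in> borel_measurable M"
proof -
  show "incr_path (\<lambda>t. inject c n e t \<omega>)" if "\<omega> \<in> space M"
    unfolding inject_def by (rule injection_incr[where e = e, OF that]) (rule divs_nonneg[OF e that])
  show "inject c n e t \<in> borel_measurable M" if "0 \<le> t"
    unfolding inject_def using injection_meas[OF e that] by simp
qed

lemma inject_least:
  assumes "\<And>s. 0 \<le> s \<Longrightarrow> s \<le> t \<Longrightarrow> cumdiv n e s \<omega> - (c + X s \<omega>) \<le> B" "0 \<le> B"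
  shows "inject c n e t \<omega> \<le> B"
proof -
  have "injection c n e t \<omega> \<le> ennreal B"
    unfolding injection_def by (rule runmax_least) (intro ennreal_leI assms)
  then have "inject c n e t \<omega> \<le> enn2real (ennreal B)" unfolding inject_def by (rule enn2real_mono) simp
  then show ?thesis using assms(2) by simp
qed

lemma inject_upper:
  assumes e: "divs n F e" and \<omega>: "\<omega> \<in> space M" and s: "0 \<le> s" "s \<le> t"
  shows "cumdiv n e s \<omega> - (c + X s \<omega>) \<le> inject c n e t \<omega>"
proof -
  have "ennreal (cumdiv n e s \<omega> - (c + X s \<omega>)) \<le> injection c n e t \<omega>"
    unfolding injection_def using runmax_upper[OF s, of "\<lambda>s. cumdiv n e s \<omega> - (c + X s \<omega>)"] by simp
  also have "\<dots> = ennreal (inject c n e t \<omega>)"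
    unfolding inject_def using injection_finite[OF \<omega>, of e c n t] divs_nonneg[OF e \<omega>] by simp
  finally show ?thesis by (simp add: inject_def ennreal_le_iff)
qed

lemma inject_nonneg: "0 \<le> inject c n e t \<omega>"
  by (simp add: inject_def)

lemma cost_inject:
  assumes "divs n F e"
  shows "cost z c n e = expected_disc z (inject c n e)"
  unfolding cost_eq[OF assms] inject_def ..

lemma divs_meas_G: "divs n G e \<Longrightarrow> real k / 2 ^ n \<le> t \<Longrightarrow> e k \<in> borel_measurable (G t)"
  unfolding divs_def by (auto intro: G_meas_mono[of "real k / 2 ^ n"])

lemma inject_meas_G:
  assumes e: "divs n G e" and t: "0 \<le> t"
  shows "inject c n e t \<in> borel_measurable (G t)"
proof -
  have "injection c n e t \<in> borel_measurable (G t)"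
    by (rule injection_measurable[OF space_G t X_meas_G divs_meas_G[OF e]])
  then show ?thesis unfolding inject_def by simp
qed

lemma enn2real_sum_mono:
  fixes a b c d :: ennreal
  assumes "a + b \<le> c + d" "c < \<top>" "d < \<top>"
  shows "enn2real a + enn2real b \<le> enn2real c + enn2real d"
proof -
  have ab: "a + b < \<top>"
    by (rule le_less_trans[OF assms(1)]) (simp add: ennreal_add_less_top assms)
  then have "a < \<top>" "b < \<top>" by (simp_all add: ennreal_add_less_top)
  then have "enn2real a + enn2real b = enn2real (a + b)" by (simp add: enn2real_plus)
  also have "\<dots> \<le> enn2real (c + d)" using assms by (intro enn2real_mono) (simp_all add: ennreal_add_less_top)
  also have "\<dots> = enn2real c + enn2real d" using assms by (simp add: enn2real_plus)
  finally show ?thesis .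
qed

text \<open>\<open>f\<close> is the new coarse strategy from \<open>x\<close> and \<open>g\<close>
  the new fine one from \<open>h + x\<close>. \<open>coupling\<close> supplies injections that
  suffice for them, and minimality bounds their actual cost.\<close>

lemma payoff_coupling:
  assumes h: "0 \<le> h" and e': "divs n G e'" and e: "divs (Suc n) G e"
  shows "payoff (0, y) (h + x) n e' + payoff (0, y) x (Suc n) e \<le> W (Suc n) (h + x) y + W n x y"
proof -
  note eF = divs_G_F[OF e] and e'F = divs_G_F[OF e']
  \<comment> \<open>Injections of the fine strategy, sampled at the coarse dates, when alone coarse
    dividends can be moved. They are known at those dates, so the transfer is adapted.\<close>
  define r where "r k \<omega> = inject x (Suc n) e (real k / 2 ^ n) \<omega>" for k \<omega>
  define al where "al k \<omega> = alloc h (\<lambda>k. e' k \<omega>) (\<lambda>k. r k \<omega>) k" for k \<omega>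
  define ai where "ai k \<omega> = alloc_inc h (\<lambda>k. e' k \<omega>) (\<lambda>k. r k \<omega>) k" for k \<omega>
  have rm: "r k \<in> borel_measurable (G (real k / 2 ^ n))" for k
    unfolding r_def by (rule inject_meas_G[OF e]) simp
  have alm: "al k \<in> borel_measurable (G (real k / 2 ^ n))" for k
  proof (induction k)
    case 0
    then show ?case by (simp add: al_def)
  next
    case (Suc k)
    have "al k \<in> borel_measurable (G (real (Suc k) / 2 ^ n))"
      by (rule G_meas_mono[OF _ Suc]) (simp add: divide_right_mono)
    moreover have "e' (Suc k) \<in> borel_measurable (G (real (Suc k) / 2 ^ n))"
      using e' unfolding divs_def by blast
    moreover note rm[of "Suc k"]
    ultimately have "(\<lambda>\<omega>. al k \<omega> + min (e' (Suc k) \<omega>) (max 0 (h - al k \<omega> - r (Suc k) \<omega>)))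
        \<in> borel_measurable (G (real (Suc k) / 2 ^ n))" by measurable
    then show ?case by (simp add: al_def)
  qed
  have aim: "ai k \<in> borel_measurable (G (real k / 2 ^ n))" for k
  proof -
    have "al (k - 1) \<in> borel_measurable (G (real k / 2 ^ n))"
      by (rule G_meas_mono[OF _ alm]) (simp add: divide_right_mono)
    then have "(\<lambda>\<omega>. al k \<omega> - al (k - 1) \<omega>) \<in> borel_measurable (G (real k / 2 ^ n))" using alm[of k] by measurable
    moreover have "ai k = (\<lambda>\<omega>. al k \<omega> - al (k - 1) \<omega>)"
      by (rule ext) (simp add: ai_def al_def alloc_inc_def)
    ultimately show ?thesis by simp
  qed
  have r_mono: "mono (\<lambda>k. r k \<omega>)" and r_nn: "0 \<le> r k \<omega>" if \<omega>: "\<omega> \<in> space M" for \<omega> k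
  proof -
    show "mono (\<lambda>k. r k \<omega>)"
      unfolding r_def by (intro monoI incr_path_mono[OF inject_regular(1)[OF eF \<omega>]]) (simp add: divide_right_mono)
    show "0 \<le> r k \<omega>" by (simp add: r_def inject_nonneg)
  qed
  have ai: "0 \<le> ai k \<omega>" "ai k \<omega> \<le> e' k \<omega>" if \<omega>: "\<omega> \<in> space M" for k \<omega>
    unfolding ai_def
    using alloc_inc_bounds[of h "\<lambda>k. e' k \<omega>" "\<lambda>k. r k \<omega>", OF h divs_nonneg[OF e' \<omega>] r_mono[OF \<omega>] r_nn[OF \<omega>]]
    by blast+
  define f where "f k \<omega> = e' k \<omega> - ai k \<omega>" for k \<omega>
  \<comment> \<open>The transferred dividend with coarse index \<open>k div 2\<close> is paid at the
    even fine index \<open>k\<close>, which is the same date.\<close>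
  define g where "g k \<omega> = e k \<omega> + (if even k then ai (k div 2) \<omega> else 0)" for k \<omega>
  obtain K :: nat where K: "\<And>k \<omega>. \<omega> \<in> space M \<Longrightarrow> 0 \<le> e k \<omega> \<and> e k \<omega> \<le> real K \<and> (K < k \<longrightarrow> e k \<omega> = 0)"
    using divs_bounds[OF e] by blast
  obtain K' :: nat where K': "\<And>k \<omega>. \<omega> \<in> space M \<Longrightarrow> 0 \<le> e' k \<omega> \<and> e' k \<omega> \<le> real K' \<and> (K' < k \<longrightarrow> e' k \<omega> = 0)"
    using divs_bounds[OF e'] by blast
  have f: "divs n G f"
    unfolding divs_def
  proof (intro conjI allI exI[of _ K'] ballI)
    show "f k \<in> borel_measurable (G (real k / 2 ^ n))" for k
      unfolding f_def using aim[of k] e' unfolding divs_def by (intro borel_measurable_diff) blast+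
    fix k \<omega> assume \<omega>: "\<omega> \<in> space M"
    show "0 \<le> f k \<omega>" "f k \<omega> \<le> real K'" "K' < k \<longrightarrow> f k \<omega> = 0"
      using ai[OF \<omega>, of k] K'[OF \<omega>, of k] by (auto simp: f_def)
  qed
  \<comment> \<open>One number must serve twice: sizes add up to at most \<open>K + K'\<close>,
    while the horizon needs \<open>k div 2\<close> beyond \<open>K'\<close>, guaranteed once
    \<open>k\<close> exceeds \<open>2 * K' + 1\<close>.\<close>
  have g: "divs (Suc n) G g"
    unfolding divs_def
  proof (intro conjI allI exI[of _ "K + 2 * K' + 1"] ballI)
    fix k
    have "e k \<in> borel_measurable (G (real k / 2 ^ Suc n))" using e unfolding divs_def by blast
    moreover have "(\<lambda>\<omega>. if even k then ai (k div 2) \<omega> else 0) \<in> borel_measurable (G (real k / 2 ^ Suc n))"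
    proof (cases "even k")
      case True
      then have "real (k div 2) / 2 ^ n = real k / 2 ^ Suc n" by (auto elim!: evenE)
      then show ?thesis using aim[of "k div 2"] True by simp
    qed simp
    ultimately show "g k \<in> borel_measurable (G (real k / 2 ^ Suc n))"
      unfolding g_def by (rule borel_measurable_add)
    fix \<omega> assume \<omega>: "\<omega> \<in> space M"
    note b = ai[OF \<omega>, of "k div 2"] K'[OF \<omega>, of "k div 2"] K[OF \<omega>, of k]
    show "0 \<le> g k \<omega>" using b by (simp add: g_def)
    show "g k \<omega> \<le> real (K + 2 * K' + 1)" using b by (auto simp: g_def)
    show "K + 2 * K' + 1 < k \<longrightarrow> g k \<omega> = 0"
    proof
      assume "K + 2 * K' + 1 < k"
      then have "K < k" "K' < k div 2" by auto
      then show "g k \<omega> = 0" using b by (auto simp: g_def)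
    qed
  qed
  note fF = divs_G_F[OF f] and gF = divs_G_F[OF g]
  define a where "a t \<omega> = step n (\<lambda>k. ai k \<omega>) t" for t \<omega>
  have cf: "cumdiv n f t \<omega> = cumdiv n e' t \<omega> - a t \<omega>" for t \<omega>
    unfolding cumdiv_def f_def a_def by (rule step_diff[symmetric])
  have cg: "cumdiv (Suc n) g t \<omega> = cumdiv (Suc n) e t \<omega> + a t \<omega>" for t \<omega>
    unfolding cumdiv_def g_def a_def step_Suc[of n] by (rule step_add[symmetric])
  \<comment> \<open>Minimality bounds the two new injections by \<open>max 0 (R + a - h)\<close> and
    \<open>R' + min R (h - a)\<close>, and these add up to exactly \<open>R + R'\<close>.\<close>
  have pathwise: "inject (h + x) (Suc n) g t \<omega> + inject x n f t \<omega> \<le> inject (h + x) n e' t \<omega> + inject x (Suc n) e t \<omega>"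
    if t: "0 \<le> t" and \<omega>: "\<omega> \<in> space M" for t \<omega>
  proof -
    let ?R = "\<lambda>t. inject x (Suc n) e t \<omega>" and ?R' = "\<lambda>t. inject (h + x) n e' t \<omega>"
    have aeq: "a = (\<lambda>t \<omega>. step n (alloc_inc h (\<lambda>k. e' k \<omega>) (\<lambda>k. inject x (Suc n) e (real k / 2 ^ n) \<omega>)) t)"
      by (simp add: a_def ai_def r_def fun_eq_iff)
    have c: "cumdiv (Suc n) e s \<omega> + a s \<omega> - (h + (x + X s \<omega>)) \<le> max 0 (?R t + a t \<omega> - h) \<and>
        cumdiv n e' s \<omega> - a s \<omega> - (x + X s \<omega>) \<le> ?R' t + min (?R t) (h - a t \<omega>) \<and> a t \<omega> \<le> h"
      if s: "0 \<le> s" "s \<le> t" for s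
      unfolding aeq
      by (intro conjI coupling[where L' = "\<lambda>s. cumdiv n e' s \<omega>" and L = "\<lambda>s. cumdiv (Suc n) e s \<omega>"
            and R = ?R and R' = ?R' and c = "\<lambda>s. x + X s \<omega>" and s = s])
         (use h s divs_nonneg[OF e' \<omega>] in \<open>auto simp: cumdiv_def[abs_def] inject_nonneg
            intro: incr_path_nonneg[OF cumdiv_regular(1)[OF eF \<omega>, unfolded cumdiv_def]]
              incr_path_mono[OF inject_regular(1)[OF eF \<omega>]] incr_path_mono[OF inject_regular(1)[OF e'F \<omega>]]
              inject_upper[OF eF \<omega>, unfolded cumdiv_def] inject_upper[OF e'F \<omega>, where c = "h + x", unfolded cumdiv_def add.assoc]\<close>)
    have ah: "a t \<omega> \<le> h" using c[OF t order_refl] by blast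
    have "inject (h + x) (Suc n) g t \<omega> \<le> max 0 (?R t + a t \<omega> - h)"
      by (rule inject_least) (use c in \<open>auto simp: cg add.assoc\<close>)
    moreover have "inject x n f t \<omega> \<le> ?R' t + min (?R t) (h - a t \<omega>)"
      by (rule inject_least) (use c ah inject_nonneg[of "h + x" n e' t \<omega>] inject_nonneg[of x "Suc n" e t \<omega>] in \<open>auto simp: cf\<close>)
    ultimately show ?thesis by linarith
  qed
  have cost: "cost (0, y) (h + x) (Suc n) g + cost (0, y) x n f \<le> cost (0, y) (h + x) n e' + cost (0, y) x (Suc n) e"
    unfolding cost_inject[OF gF] cost_inject[OF fF] cost_inject[OF eF] cost_inject[OF e'F]
    by (rule expected_stieltjes_sum_mono) (fact inject_regular(1)[OF gF] inject_regular(1)[OF fF]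
        inject_regular(1)[OF e'F] inject_regular(1)[OF eF] inject_regular(2)[OF gF] inject_regular(2)[OF fF]
        inject_regular(2)[OF e'F] inject_regular(2)[OF eF] pathwise)+
  \<comment> \<open>Dividends merely change hands: pathwise the two sums are equal.\<close>
  have gain: "gain (0, y) n e' + gain (0, y) (Suc n) e \<le> gain (0, y) (Suc n) g + gain (0, y) n f"
    unfolding gain_def
    by (rule expected_stieltjes_sum_mono; (fact cumdiv_regular[OF e'F] cumdiv_regular[OF eF]
        cumdiv_regular[OF gF] cumdiv_regular[OF fF])?) (simp add: cf cg)
  have "enn2real (cost (0, y) (h + x) (Suc n) g) + enn2real (cost (0, y) x n f)
      \<le> enn2real (cost (0, y) (h + x) n e') + enn2real (cost (0, y) x (Suc n) e)"
    by (rule enn2real_sum_mono[OF cost cost_finite[OF e'F] cost_finite[OF eF]])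
  then have "\<beta> * (enn2real (cost (0, y) (h + x) (Suc n) g) + enn2real (cost (0, y) x n f))
      \<le> \<beta> * (enn2real (cost (0, y) (h + x) n e') + enn2real (cost (0, y) x (Suc n) e))"
    using beta by (intro mult_left_mono) auto
  moreover have "enn2real (gain (0, y) n e') + enn2real (gain (0, y) (Suc n) e)
      \<le> enn2real (gain (0, y) (Suc n) g) + enn2real (gain (0, y) n f)"
    by (rule enn2real_sum_mono[OF gain gain_finite[OF gF] gain_finite[OF fF]])
  ultimately have "payoff (0, y) (h + x) n e' + payoff (0, y) x (Suc n) e
      \<le> payoff (0, y) (h + x) (Suc n) g + payoff (0, y) x n f"
    unfolding payoff_def by (simp add: algebra_simps)
  also have "\<dots> \<le> W (Suc n) (h + x) y + W n x y"
    by (intro add_mono payoff_le_W f g)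
  finally show ?thesis .
qed

text \<open>The suprema over the two strategies in \<open>payoff_coupling\<close> are taken one
  after the other.\<close>

lemma W_increment_mono:
  assumes h: "0 \<le> h"
  shows "W n (h + x) y - W n x y \<le> W (Suc n) (h + x) y - W (Suc n) x y"
proof -
  have "W n (h + x) y \<le> W (Suc n) (h + x) y + W n x y - W (Suc n) x y"
  proof (rule W_le)
    fix e' assume e': "divs n G e'"
    have "W (Suc n) x y \<le> W (Suc n) (h + x) y + W n x y - payoff (0, y) (h + x) n e'"
    proof (rule W_le)
      fix e assume "divs (Suc n) G e"
      from payoff_coupling[OF h e' this, where x = x and y = y]
      show "payoff (0, y) x (Suc n) e \<le> W (Suc n) (h + x) y + W n x y - payoff (0, y) (h + x) n e'"
        by linarith
    qed
    then show "payoff (0, y) (h + x) n e' \<le> W (Suc n) (h + x) y + W n x y - W (Suc n) x y" by simp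
  qed
  then show ?thesis by simp
qed

text \<open>Capital lower by \<open>h\<close> can be made up by injecting \<open>h\<close> at time
  0, the path \<open>J\<close>; its discounted cost is at most \<beta> times
  \<open>h\<close>.\<close>

lemma W_lipschitz:
  assumes h: "0 \<le> h"
  shows "W n (h + x) y - W n x y \<le> \<beta> * h"
proof -
  have "W n (h + x) y \<le> W n x y + \<beta> * h"
  proof (rule W_le)
    fix e assume e: "divs n G e"
    note eF = divs_G_F[OF e]
    define J where "J t = (if t < 0 then 0 else h)" for t :: real
    have J: "incr_path J"
      unfolding incr_path_def
    proof (intro conjI allI impI)
      show "mono J" using h by (auto simp: mono_def J_def)
      show "continuous (at_right t) J" for t
      proof -
        have "\<forall>\<^sub>F s in at_right t. J s = J t"
        proof (cases "t < 0")
          case True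
          then show ?thesis unfolding eventually_at_right_field by (intro exI[of _ 0]) (auto simp: J_def)
        next
          case False
          then show ?thesis unfolding eventually_at_right_field by (intro exI[of _ "t + 1"]) (auto simp: J_def)
        qed
        then show ?thesis unfolding continuous_within by (rule tendsto_eventually)
      qed
    qed (simp add: J_def)
    have zero: "incr_path (\<lambda>t. 0 :: real)" by (simp add: incr_path_def mono_def)
    have "cost (0, y) x n e + 0 \<le> cost (0, y) x n e + (\<integral>\<^sup>+\<omega>. stieltjes (\<lambda>t. D t \<omega>) (\<lambda>t. ennreal 0) \<partial>P (0, y))"
      by (rule add_left_mono) simp
    also have "\<dots> \<le> cost (0, y) (h + x) n e + (\<integral>\<^sup>+\<omega>. stieltjes (\<lambda>t. D t \<omega>) (\<lambda>t. ennreal (J t)) \<partial>P (0, y))"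
      unfolding cost_inject[OF eF]
    proof (rule expected_stieltjes_sum_mono[where B = "\<lambda>t \<omega>. 0" and E = "\<lambda>t \<omega>. J t"])
      show "inject x n e t \<omega> + 0 \<le> inject (h + x) n e t \<omega> + J t" if t: "0 \<le> t" and \<omega>: "\<omega> \<in> space M" for t \<omega>
      proof -
        have "inject x n e t \<omega> \<le> inject (h + x) n e t \<omega> + h"
          by (rule inject_least)
             (use inject_upper[OF eF \<omega>, of _ t "h + x"] inject_nonneg[of "h + x" n e t \<omega>] h in fastforce)+
        then show ?thesis using t by (simp add: J_def)
      qed
    qed (use J zero inject_regular[OF eF] in simp_all)
    also have "(\<integral>\<^sup>+\<omega>. stieltjes (\<lambda>t. D t \<omega>) (\<lambda>t. ennreal (J t)) \<partial>P (0, y)) \<le> (\<integral>\<^sup>+\<omega>. ennreal h \<partial>P (0, y))"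
    proof (rule nn_integral_mono)
      fix \<omega> assume "\<omega> \<in> space (P (0, y))"
      then have \<omega>: "\<omega> \<in> space M" by simp
      interpret stieltjes_integrand "\<lambda>t. D t \<omega>" by (rule D_integrand[OF \<omega>])
      show "stieltjes (\<lambda>t. D t \<omega>) (\<lambda>t. ennreal (J t)) \<le> ennreal h"
        by (rule stieltjes_le_bound[OF J]) (use h in \<open>simp add: J_def\<close>)
    qed
    also have "\<dots> = ennreal h" by simp
    finally have "cost (0, y) x n e + 0 \<le> cost (0, y) (h + x) n e + ennreal h"
      by (simp add: add_left_mono)
    from enn2real_sum_mono[OF this cost_finite[OF eF]]
    have "enn2real (cost (0, y) x n e) \<le> enn2real (cost (0, y) (h + x) n e) + h" using h by simp
    then have "\<beta> * enn2real (cost (0, y) x n e) \<le> \<beta> * (enn2real (cost (0, y) (h + x) n e) + h)"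
      using beta by (intro mult_left_mono) auto
    then have "payoff (0, y) (h + x) n e \<le> payoff (0, y) x n e + \<beta> * h"
      by (simp add: payoff_def algebra_simps)
    also have "\<dots> \<le> W n x y + \<beta> * h" using payoff_le_W[OF e] by simp
    finally show "payoff (0, y) (h + x) n e \<le> W n x y + \<beta> * h" .
  qed
  then show ?thesis by simp
qed

text \<open>Dividends are linear in the strategy, and minimal injections are convex in capital and
  strategy jointly. Mixing strategies with the weights of the capitals therefore loses
  nothing.\<close>

lemma W_concave:
  assumes u: "0 \<le> u" "0 \<le> v" "u + v = 1"
  shows "u * W n x1 y + v * W n x2 y \<le> W n (u * x1 + v * x2) y"
proof -
  let ?x = "u * x1 + v * x2"
  have pay: "u * payoff (0, y) x1 n e1 + v * payoff (0, y) x2 n e2 \<le> W n ?x y"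
    if e1: "divs n G e1" and e2: "divs n G e2" for e1 e2
  proof -
    note F1 = divs_G_F[OF e1] and F2 = divs_G_F[OF e2]
    define e where "e k \<omega> = u * e1 k \<omega> + v * e2 k \<omega>" for k \<omega>
    obtain K1 :: nat where K1: "\<And>k \<omega>. \<omega> \<in> space M \<Longrightarrow> 0 \<le> e1 k \<omega> \<and> e1 k \<omega> \<le> real K1 \<and> (K1 < k \<longrightarrow> e1 k \<omega> = 0)"
      using divs_bounds[OF e1] by blast
    obtain K2 :: nat where K2: "\<And>k \<omega>. \<omega> \<in> space M \<Longrightarrow> 0 \<le> e2 k \<omega> \<and> e2 k \<omega> \<le> real K2 \<and> (K2 < k \<longrightarrow> e2 k \<omega> = 0)"
      using divs_bounds[OF e2] by blast
    have u1: "u \<le> 1" "v \<le> 1" using u by auto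
    have e: "divs n G e"
      unfolding divs_def
    proof (intro conjI allI exI[of _ "K1 + K2"] ballI)
      show "e k \<in> borel_measurable (G (real k / 2 ^ n))" for k
        using e1 e2 unfolding e_def divs_def by (intro borel_measurable_add borel_measurable_times borel_measurable_const) blast+
      fix k \<omega> assume \<omega>: "\<omega> \<in> space M"
      note b = K1[OF \<omega>, of k] K2[OF \<omega>, of k]
      show "0 \<le> e k \<omega>" using b u by (simp add: e_def)
      have "u * e1 k \<omega> \<le> 1 * e1 k \<omega>" "v * e2 k \<omega> \<le> 1 * e2 k \<omega>" using u1 b by (intro mult_right_mono; simp)+
      then show "e k \<omega> \<le> real (K1 + K2)" using b by (simp add: e_def)
      show "K1 + K2 < k \<longrightarrow> e k \<omega> = 0" using b by (simp add: e_def)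
    qed
    note eF = divs_G_F[OF e]
    have ce: "cumdiv n e t \<omega> = u * cumdiv n e1 t \<omega> + v * cumdiv n e2 t \<omega>" for t \<omega>
      unfolding cumdiv_def e_def step_scale step_add ..
    have scale_inc: "incr_path (\<lambda>t. c * A t)" if "incr_path A" "0 \<le> c" for c and A :: "real \<Rightarrow> real"
      using that unfolding incr_path_def by (auto simp: mono_def mult_left_mono intro!: continuous_intros)
    have scale: "(\<integral>\<^sup>+\<omega>. stieltjes (\<lambda>t. D t \<omega>) (\<lambda>t. ennreal (c * A t \<omega>)) \<partial>P z)
        = ennreal c * expected_disc z A"
      if c: "0 \<le> c" and A: "\<And>\<omega>. \<omega> \<in> space M \<Longrightarrow> incr_path (\<lambda>t. A t \<omega>)" "\<And>t. 0 \<le> t \<Longrightarrow> A t \<in> borel_measurable M"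
      for c z and A :: "real \<Rightarrow> 'w \<Rightarrow> real"
    proof -
      have "(\<integral>\<^sup>+\<omega>. stieltjes (\<lambda>t. D t \<omega>) (\<lambda>t. ennreal (c * A t \<omega>)) \<partial>P z)
          = (\<integral>\<^sup>+\<omega>. ennreal c * disc_int A \<omega> \<partial>P z)"
      proof (rule nn_integral_cong)
        fix \<omega> assume "\<omega> \<in> space (P z)"
        then have \<omega>: "\<omega> \<in> space M" by simp
        interpret stieltjes_integrand "\<lambda>t. D t \<omega>" by (rule D_integrand[OF \<omega>])
        show "stieltjes (\<lambda>t. D t \<omega>) (\<lambda>t. ennreal (c * A t \<omega>)) = ennreal c * disc_int A \<omega>"
          by (rule stieltjes_scale[OF A(1)[OF \<omega>] c])
      qed
      also have "\<dots> = ennreal c * expected_disc z A"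
        by (rule nn_integral_cmult, rule M_measD[OF stieltjes_D_meas]) (use A(2) in simp)
      finally show ?thesis .
    qed
    have zero: "incr_path (\<lambda>t. 0 :: real)" by (simp add: incr_path_def mono_def)
    have gu: "ennreal u * gain (0, y) n e1 = (\<integral>\<^sup>+\<omega>. stieltjes (\<lambda>t. D t \<omega>) (\<lambda>t. ennreal (u * cumdiv n e1 t \<omega>)) \<partial>P (0, y))"
      unfolding gain_def by (rule scale[symmetric]) (fact u cumdiv_regular[OF F1])+
    have gv: "ennreal v * gain (0, y) n e2 = (\<integral>\<^sup>+\<omega>. stieltjes (\<lambda>t. D t \<omega>) (\<lambda>t. ennreal (v * cumdiv n e2 t \<omega>)) \<partial>P (0, y))"
      unfolding gain_def by (rule scale[symmetric]) (fact u cumdiv_regular[OF F2])+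
    have cu: "ennreal u * cost (0, y) x1 n e1 = (\<integral>\<^sup>+\<omega>. stieltjes (\<lambda>t. D t \<omega>) (\<lambda>t. ennreal (u * inject x1 n e1 t \<omega>)) \<partial>P (0, y))"
      unfolding cost_inject[OF F1] by (rule scale[symmetric]) (fact u inject_regular[OF F1])+
    have cv: "ennreal v * cost (0, y) x2 n e2 = (\<integral>\<^sup>+\<omega>. stieltjes (\<lambda>t. D t \<omega>) (\<lambda>t. ennreal (v * inject x2 n e2 t \<omega>)) \<partial>P (0, y))"
      unfolding cost_inject[OF F2] by (rule scale[symmetric]) (fact u inject_regular[OF F2])+
    have "ennreal u * gain (0, y) n e1 + ennreal v * gain (0, y) n e2
        \<le> gain (0, y) n e + (\<integral>\<^sup>+\<omega>. stieltjes (\<lambda>t. D t \<omega>) (\<lambda>t. ennreal 0) \<partial>P (0, y))"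
      unfolding gu gv unfolding gain_def
      by (rule expected_stieltjes_sum_mono[where E = "\<lambda>t \<omega>. 0"])
         (use zero cumdiv_regular[OF F1] cumdiv_regular[OF F2] cumdiv_regular[OF eF] u in \<open>simp_all add: scale_inc ce\<close>)
    moreover have st0: "(\<integral>\<^sup>+\<omega>. stieltjes (\<lambda>t. D t \<omega>) (\<lambda>t. ennreal 0) \<partial>P (0, y)) = 0"
      by (simp add: stieltjes_def abel_sum_def Liminf_const)
    ultimately have g: "ennreal u * gain (0, y) n e1 + ennreal v * gain (0, y) n e2 \<le> gain (0, y) n e + 0" by simp
    have "cost (0, y) ?x n e + (\<integral>\<^sup>+\<omega>. stieltjes (\<lambda>t. D t \<omega>) (\<lambda>t. ennreal 0) \<partial>P (0, y))
        \<le> ennreal u * cost (0, y) x1 n e1 + ennreal v * cost (0, y) x2 n e2"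
      unfolding cu cv cost_inject[OF eF]
    proof (rule expected_stieltjes_sum_mono[where B = "\<lambda>t \<omega>. 0"])
      show "inject ?x n e t \<omega> + 0 \<le> u * inject x1 n e1 t \<omega> + v * inject x2 n e2 t \<omega>"
        if t: "0 \<le> t" and \<omega>: "\<omega> \<in> space M" for t \<omega>
      proof -
        have "inject ?x n e t \<omega> \<le> u * inject x1 n e1 t \<omega> + v * inject x2 n e2 t \<omega>"
        proof (rule inject_least)
          fix s assume s: "0 \<le> s" "s \<le> t"
          \<comment> \<open>As the weights sum to 1, the path \<open>X\<close> can be split in the
            same proportion as the capitals.\<close>
          have "cumdiv n e s \<omega> - (?x + X s \<omega>)
              = cumdiv n e s \<omega> - (?x + (u + v) * X s \<omega>)" using u by simp
          also have "\<dots> = u * (cumdiv n e1 s \<omega> - (x1 + X s \<omega>)) + v * (cumdiv n e2 s \<omega> - (x2 + X s \<omega>))"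
            unfolding ce by (simp add: algebra_simps)
          also have "\<dots> \<le> u * inject x1 n e1 t \<omega> + v * inject x2 n e2 t \<omega>"
            by (intro add_mono mult_left_mono inject_upper[OF F1 \<omega> s] inject_upper[OF F2 \<omega> s] u)
          finally show "cumdiv n e s \<omega> - (?x + X s \<omega>) \<le> u * inject x1 n e1 t \<omega> + v * inject x2 n e2 t \<omega>" .
        qed (use u inject_nonneg in simp)
        then show ?thesis by simp
      qed
    qed (use zero inject_regular[OF F1] inject_regular[OF F2] inject_regular[OF eF] u in \<open>simp_all add: scale_inc\<close>)
    then have c: "cost (0, y) ?x n e + 0 \<le> ennreal u * cost (0, y) x1 n e1 + ennreal v * cost (0, y) x2 n e2"
      by (simp only: st0)
    have G: "u * enn2real (gain (0, y) n e1) + v * enn2real (gain (0, y) n e2) \<le> enn2real (gain (0, y) n e)"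
      using enn2real_sum_mono[OF g gain_finite[OF eF]] u by (simp add: enn2real_mult)
    have "enn2real (cost (0, y) ?x n e) \<le> u * enn2real (cost (0, y) x1 n e1) + v * enn2real (cost (0, y) x2 n e2)"
      using enn2real_sum_mono[OF c] cost_finite[OF F1, of "(0, y)" x1] cost_finite[OF F2, of "(0, y)" x2] u
      by (simp add: enn2real_mult ennreal_mult_less_top)
    then have "\<beta> * enn2real (cost (0, y) ?x n e)
        \<le> \<beta> * (u * enn2real (cost (0, y) x1 n e1) + v * enn2real (cost (0, y) x2 n e2))"
      using beta by (intro mult_left_mono) auto
    with G have "u * payoff (0, y) x1 n e1 + v * payoff (0, y) x2 n e2 \<le> payoff (0, y) ?x n e"
      unfolding payoff_def by (simp add: algebra_simps)
    also have "\<dots> \<le> W n ?x y" by (rule payoff_le_W[OF e])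
    finally show ?thesis .
  qed
  \<comment> \<open>Passing to the suprema divides by the weights, so vanishing weights are treated
    apart.\<close>
  consider "u = 0" | "v = 0" | "0 < u" "0 < v" using u by linarith
  then show ?thesis
  proof cases
    case 3
    have "W n x1 y \<le> (W n ?x y - v * W n x2 y) / u"
    proof (rule W_le)
      fix e1 assume e1: "divs n G e1"
      have "W n x2 y \<le> (W n ?x y - u * payoff (0, y) x1 n e1) / v"
        by (rule W_le) (use pay[OF e1] 3 in \<open>simp add: field_simps\<close>)
      then show "payoff (0, y) x1 n e1 \<le> (W n ?x y - v * W n x2 y) / u"
        using 3 by (simp add: field_simps)
    qed
    then show ?thesis using 3 by (simp add: field_simps)
  qed (use u in simp_all)
qed

lemma W_right_derivative:
  "\<exists>l. ((\<lambda>x'. (W n x' y - W n x y) / (x' - x)) \<longlongrightarrow> l) (at_right x)"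
proof (rule exI, rule antimono_right_limit)
  fix s t assume st: "x < s" "s \<le> t"
  define v where "v = (s - x) / (t - x)"
  have v: "0 \<le> 1 - v" "0 \<le> v" "(1 - v) + v = 1" using st by (auto simp: v_def)
  have s: "(1 - v) * x + v * t = s"
  proof -
    have "(1 - v) * x + v * t = x + v * (t - x)" by (simp add: algebra_simps)
    then show ?thesis using st by (simp add: v_def)
  qed
  have "(1 - v) * W n x y + v * W n t y \<le> W n s y"
    using W_concave[OF v, of n x y t] unfolding s .
  then have "v * (W n t y - W n x y) \<le> W n s y - W n x y" by (simp add: algebra_simps)
  then show "(W n t y - W n x y) / (t - x) \<le> (W n s y - W n x y) / (s - x)"
    using st by (simp add: v_def field_simps)
next
  fix s assume s: "x < s"
  show "(W n s y - W n x y) / (s - x) \<le> \<beta>"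
    using W_lipschitz[of "s - x" n x y] s by (simp add: divide_le_eq)
qed

text \<open>The derivative is defined through \<open>Lim\<close>, so nothing is known of its value
  until the limit exists. Once identified as a genuine limit, it inherits the order of the
  difference quotients.\<close>

lemma Vn_rderiv_mono: "Vn_rderiv n M F P X Y qf \<beta> x y \<le> Vn_rderiv (Suc n) M F P X Y qf \<beta> x y"
proof -
  have lim: "((\<lambda>x'. (W n x' y - W n x y) / (x' - x)) \<longlongrightarrow> Vn_rderiv n M F P X Y qf \<beta> x y) (at_right x)" for n
  proof -
    obtain l where l: "((\<lambda>x'. (W n x' y - W n x y) / (x' - x)) \<longlongrightarrow> l) (at_right x)"
      using W_right_derivative by blast
    then have "Vn_rderiv n M F P X Y qf \<beta> x y = l"
      unfolding Vn_rderiv_def Vn_eq real_of_ereal.simps by (intro tendsto_Lim) simp_all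
    then show ?thesis using l by simp
  qed
  have "\<forall>\<^sub>F x' in at_right x. x < x'" by (simp add: eventually_at_filter)
  then have "\<forall>\<^sub>F x' in at_right x. (W n x' y - W n x y) / (x' - x) \<le> (W (Suc n) x' y - W (Suc n) x y) / (x' - x)"
  proof eventually_elim
    case (elim x')
    then show ?case using W_increment_mono[of "x' - x" n x y] by (intro divide_right_mono) simp_all
  qed
  then show ?thesis by (rule tendsto_le[OF trivial_limit_at_right_real lim lim])
qed

lemma lower_b_Suc: "lower_b n M F P X Y qf \<beta> y \<le> lower_b (Suc n) M F P X Y qf \<beta> y"
proof -
  define S where "S n = {x. 0 \<le> x \<and> Vn_rderiv n M F P X Y qf \<beta> x y > 1}" for n
  have sub: "S n \<subseteq> S (Suc n)"
    unfolding S_def using Vn_rderiv_mono[of n] by (auto intro: less_le_trans)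
  have lb: "lower_b n M F P X Y qf \<beta> y = (if S n = {} then 0 else Sup (ereal ` S n))" for n
    unfolding lower_b_def S_def Let_def ..
  show ?thesis
  proof (cases "S n = {}")
    case True
    have "0 \<le> Sup (ereal ` S (Suc n))" if ne: "S (Suc n) \<noteq> {}"
    proof -
      obtain x where "x \<in> S (Suc n)" using ne by blast
      then show ?thesis by (intro SUP_upper2[of x]) (auto simp: S_def)
    qed
    then show ?thesis using True by (simp add: lb)
  next
    case False
    then show ?thesis using sub by (auto simp: lb intro!: SUP_subset_mono)
  qed
qed

end

theorem theorem4p2:
  fixes M :: "'w measure" and F :: "real \<Rightarrow> 'w measure"
    and P :: "real \<times> 'e::topological_space \<Rightarrow> 'w measure"
    and X :: "real \<Rightarrow> 'w \<Rightarrow> real" and Y :: "real \<Rightarrow> 'w \<Rightarrow> 'e"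
    and \<theta> :: "real \<Rightarrow> 'w \<Rightarrow> 'w"
    and q :: real and qf :: "'e \<Rightarrow> real" and \<beta> :: real
  assumes radon: "radon_space TYPE('e)"
    and rp: "right_process M F P (\<lambda>t \<omega>. (X t \<omega>, Y t \<omega>)) \<theta>"
    and X_cadlag: "\<forall>\<omega>\<in>space M. \<forall>t>0. \<exists>l. ((\<lambda>s. X s \<omega>) \<longlongrightarrow> l) (at_left t)"
    and homog: "\<And>(f :: real \<times> 'e \<Rightarrow> ennreal) t x y. f \<in> borel_measurable borel \<Longrightarrow> 0 \<le> t \<Longrightarrow>
        (\<integral>\<^sup>+\<omega>. f (X t \<omega>, Y t \<omega>) \<partial>P (x, y)) = (\<integral>\<^sup>+\<omega>. f (X t \<omega> + x, Y t \<omega>) \<partial>P (0, y))"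
    and sup_bound: "\<exists>C<\<top>. \<forall>y. (\<integral>\<^sup>+\<omega>. (SUP s\<in>{0..1}. ennreal \<bar>X s \<omega>\<bar>) \<partial>P (0, y)) \<le> C"
    and q_pos: "q > 0"
    and qf_meas: "qf \<in> borel_measurable borel"
    and qf_gt: "\<forall>e. qf e > q"
    and beta: "\<beta> > 1"
  shows "mono (\<lambda>n. lower_b n M F P X Y qf \<beta> y)"
proof -
  interpret bailout M F P X Y \<theta> q qf \<beta>
    by (rule bailout.intro) (fact radon rp X_cadlag homog sup_bound q_pos qf_meas qf_gt beta)+
  show ?thesis using lower_b_Suc by (simp add: mono_iff_le_Suc)
qed

end
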